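(* Let $\bar u(x,t)\in\mathbb{R}^n$ be a smooth solution on $\mathbb{R}\times[0,T]$ of the balance law $$\partial_t u+\partial_xF(u)=G(u),$$ let $A$ be a symmetric positive definite $n\times n$ matrix, and let $\{u^{\varepsilon}\}_{0<\varepsilon\le1}$ be a family of smooth solutions on $\mathbb{R}\times[0,T]$ (with associated $v=v^{\varepsilon}$) of the relaxation system $$\partial_tu+\partial_xv=0,\qquad \partial_tv+A\,\partial_xu=-\frac1\varepsilon\Big(v-F(u)+\int^xG(u(z,t))\,dz\Big).$$ Suppose that $\bar u$ and $u^{\varepsilon}$ decay sufficiently fast at infinity and that: (1) (Entropy) there are $\eta,q:\mathbb{R}^n\to\mathbb{R}$ and $\alpha,\beta>0$ with $\eta$ strictly convex, $\mathrm{D}\eta(u)\,\mathrm{D}F(u)=\mathrm{D}q(u)$, $\beta I\le \mathrm{D}^2\eta(u)\le\tfrac12\alpha I$ for all $u\in\mathbb{R}^n$, $\eta(u)\ge\eta(0)=0$ and $\mathrm{D}\eta(0)=0$; (2) (Subcharacteristic condition) for this $\alpha$ there is $\nu>0$ with $\tfrac12\big(A\,\mathrm{D}^2\eta(u)+\mathrm{D}^2\eta(u)A\big)-\alpha\,\mathrm{D}F(u)^{\top}\mathrm{D}F(u)\ge\nu I$ for all $u\in\mathbb{R}^n$; (3) for some $M>0$, $|\mathrm{D}^2F(u)|\le M$ and $|\mathrm{D}^3\eta(u)|\le M$ for all $u\in\mathbb{R}^n$; (4) (Weak dissipation) $-\big(\mathrm{D}\eta(u)-\mathrm{D}\eta(w)\big)\big(G(u)-G(w)\big)\ge0$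 for all $u,w\in\mathbb{R}^n$; (5) (Source potential) there are $R:\mathbb{R}^n\to\mathbb{R}$ and a constant $C_R$ with $G(u)=-\mathrm{D}R(u)^{\top}$, $R(u)\ge R(0)=0$, $\mathrm{D}R(0)=0$, and $|\mathrm{D}R(u)|=|G(u)|\le C_R(1+R(u))$ for all $u\in\mathbb{R}^n$. Let $$\Psi(t)=\int_{\mathbb{R}}|\bar u-u^{\varepsilon}|^2+\varepsilon^2|(\bar u-u^{\varepsilon})_x|^2+\varepsilon^2|(\bar u-u^{\varepsilon})_t|^2\,dx .$$ Then for all $t\in[0,T]$ $$\Psi(t)+\varepsilon\int_{\mathbb{R}}R(u^{\varepsilon}(x,t))\,dx\le C\Big(\Psi(0)+\varepsilon\int_{\mathbb{R}}R(u^{\varepsilon}(x,0))\,dx+\varepsilon\Big)$$ with $C=C(\bar u,\alpha,\beta,\nu,M,T)>0$ independent of $\varepsilon$. If, in addition, $G\in C^2(\mathbb{R}^n)$, then for all $t\in[0,T]$ $$\Psi(t)+\varepsilon\int_{\mathbb{R}}\big[R^{rel}(\bar u,u^{\varepsilon})\big](x,t)\,dx\le C\Big(\Psi(0)+\varepsilon\int_{\mathbb{R}}\big[R^{rel}(\bar u,u^{\varepsilon})\big](x,0)\,dx+\varepsilon^2\Big),$$ again with $C>0$ independent of $\varepsilon$, where $R^{rel}(\bar u,u^{\varepsilon})=R(u^{\varepsilon})-R(\bar u)-\mathrm{D}R(\bar u)(u^{\varepsilon}-\bar u)$.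
   Context: $F,G:\mathbb{R}^n\to\mathbb{R}^n$ are column-vector valued, $F$ (and $\eta,q$) smooth, $G$ continuous with $G(0)=0$. $\mathrm{D}$ is the differential with respect to $u\in\mathbb{R}^n$, acting as a row operation; so $\mathrm{D}\eta$, $\mathrm{D}R$ are row vectors, $\mathrm{D}F$ is the Jacobian, $\mathrm{D}^2\eta$ the Hessian. Matrix inequalities are in the sense of quadratic forms. $\int^xG(u(z,t))\,dz$ denotes an antiderivative in $x$ of $G(u(\cdot,t))$; eliminating $v$ shows that $u^{\varepsilon}$ satisfies $\partial_tu+\partial_xF(u)=G(u)+\varepsilon(Au_{xx}-u_{tt})$. The data $F,G,R,\eta,A$ are fixed, and constants may depend on them. "Decays sufficiently fast at infinity" means: the functions and their derivatives tend to $0$ as $|x|\to\infty$, uniformly for $t\in[0,T]$, rapidly enough that all integrals and norms over $\mathbb{R}$ that occur are finite and may be differentiated in $t$, and that boundary terms from integration in $x$ vanish. *)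

theory Defs
  imports "HOL-Analysis.Analysis"
begin

text \<open>Differentiability classes. The derivative is taken within \<^term>\<open>S\<close>, so that for
  \<open>S = UNIV \<times> {0..T}\<close> smoothness is meant up to the boundary \<open>t = 0, t = T\<close>; there (and for
  \<open>S = UNIV\<close>) the derivative within \<^term>\<open>S\<close> is unique.\<close>

primrec Ck_on ::
  "nat \<Rightarrow> ('a::euclidean_space) set \<Rightarrow> ('a \<Rightarrow> 'b::real_normed_vector) \<Rightarrow> bool" where
  "Ck_on 0 S f \<longleftrightarrow> continuous_on S f"
| "Ck_on (Suc k) S f \<longleftrightarrow>
     (\<exists>f'. (\<forall>x\<in>S. (f has_derivative f' x) (at x within S)) \<and> (\<forall>h. Ck_on k S (\<lambda>x. f' x h)))"

definition smooth_on :: "('a::euclidean_space) set \<Rightarrow> ('a \<Rightarrow> 'b::real_normed_vector) \<Rightarrow> bool"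
  where "smooth_on S f \<longleftrightarrow> (\<forall>k. Ck_on k S f)"

text \<open>Differential calculus in the state variable. Row vectors such as \<open>D \<eta> u\<close> are elements of
  \<^typ>\<open>real^'n\<close>; a row times a column is \<open>\<bullet>\<close> and a row times a matrix is \<open>v*\<close>.\<close>

definition grad :: "(real^'n \<Rightarrow> real) \<Rightarrow> real^'n \<Rightarrow> real^'n" where
  "grad f u = (\<chi> i. frechet_derivative f (at u) (axis i 1))"

definition hessian :: "(real^'n \<Rightarrow> real) \<Rightarrow> real^'n \<Rightarrow> real^'n^'n" where
  "hessian f u = jacobian (grad f) (at u)"

primrec multi_deriv ::
  "('a::real_normed_vector \<Rightarrow> 'b::real_normed_vector) \<Rightarrow> 'a list \<Rightarrow> 'a \<Rightarrow> 'b" where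
  "multi_deriv f [] u = f u"
| "multi_deriv f (h # hs) u = frechet_derivative (multi_deriv f hs) (at u) h"

text \<open>The operator norm of the \<open>k\<close>-th derivative, a \<open>k\<close>-linear map, is at most \<open>M\<close>.\<close>

definition deriv_norm_le ::
  "nat \<Rightarrow> ('a::real_normed_vector \<Rightarrow> 'b::real_normed_vector) \<Rightarrow> 'a \<Rightarrow> real \<Rightarrow> bool" where
  "deriv_norm_le k f u M \<longleftrightarrow>
     (\<forall>hs. length hs = k \<longrightarrow> norm (multi_deriv f hs u) \<le> M * prod_list (map norm hs))"

definition quad_le :: "real^'n^'n \<Rightarrow> real^'n^'n \<Rightarrow> bool" where
  "quad_le P Q \<longleftrightarrow> (\<forall>x. x \<bullet> (P *v x) \<le> x \<bullet> (Q *v x))"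

definition sym_pos_def :: "real^'n^'n \<Rightarrow> bool" where
  "sym_pos_def P \<longleftrightarrow> transpose P = P \<and> (\<forall>x. x \<noteq> 0 \<longrightarrow> 0 < x \<bullet> (P *v x))"

definition strictly_convex :: "('a::real_vector \<Rightarrow> real) \<Rightarrow> bool" where
  "strictly_convex f \<longleftrightarrow>
     (\<forall>x y s. x \<noteq> y \<and> 0 < s \<and> s < 1 \<longrightarrow>
        f ((1 - s) *\<^sub>R x + s *\<^sub>R y) < (1 - s) * f x + s * f y)"

text \<open>Functions of space and time are written \<open>u x t\<close> with \<open>t \<in> {0..T}\<close>; the time derivative is
  one-sided at the endpoints.\<close>

definition dx :: "(real \<Rightarrow> real \<Rightarrow> 'a::real_normed_vector) \<Rightarrow> real \<Rightarrow> real \<Rightarrow> 'a" where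
  "dx u x t = vector_derivative (\<lambda>z. u z t) (at x)"

definition dt :: "real \<Rightarrow> (real \<Rightarrow> real \<Rightarrow> 'a::real_normed_vector) \<Rightarrow> real \<Rightarrow> real \<Rightarrow> 'a" where
  "dt T u x t = vector_derivative (\<lambda>s. u x s) (at t within {0..T})"

definition smooth_strip :: "real \<Rightarrow> (real \<Rightarrow> real \<Rightarrow> 'a::real_normed_vector) \<Rightarrow> bool" where
  "smooth_strip T u \<longleftrightarrow> smooth_on (UNIV \<times> {0..T}) (\<lambda>(x, t). u x t)"

text \<open>Sufficiently fast decay: \<open>u\<close> and its derivatives of order at most two (the order of the
  equations) tend to 0 as \<open>\<bar>x\<bar> \<rightarrow> \<infinity>\<close>, uniformly in \<open>t\<close>, and their squares have a common
  integrable majorant independent of \<open>t\<close>. The majorant makes quadratic integrals in these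
  functions finite and allows differentiation in \<open>t\<close> under the integral.\<close>

definition decays :: "real \<Rightarrow> (real \<Rightarrow> real \<Rightarrow> 'a::real_normed_vector) \<Rightarrow> bool" where
  "decays T u \<longleftrightarrow>
     (\<forall>i j. i + j \<le> 2 \<longrightarrow>
        uniform_limit {0..T} (\<lambda>x t. (dx ^^ i) ((dt T ^^ j) u) x t) (\<lambda>t. 0) at_infinity) \<and>
     (\<exists>h. integrable lborel h \<and>
        (\<forall>i j. i + j \<le> 2 \<longrightarrow>
           (\<forall>x. \<forall>t\<in>{0..T}. (norm ((dx ^^ i) ((dt T ^^ j) u) x t))\<^sup>2 \<le> h x)))"

definition balance_law_solution ::
  "(real^'n \<Rightarrow> real^'n) \<Rightarrow> (real^'n \<Rightarrow> real^'n) \<Rightarrow> real \<Rightarrow> (real \<Rightarrow> real \<Rightarrow> real^'n) \<Rightarrow> bool" where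
  "balance_law_solution F G T u \<longleftrightarrow>
     smooth_strip T u \<and>
     (\<forall>x. \<forall>t\<in>{0..T}. dt T u x t + dx (\<lambda>x t. F (u x t)) x t = G (u x t))"

text \<open>\<open>\<Gamma>\<close> is the antiderivative written \<open>\<integral>\<^sup>x G(u(z,t)) dz\<close>.\<close>

definition relaxation_solution ::
  "real^'n^'n \<Rightarrow> (real^'n \<Rightarrow> real^'n) \<Rightarrow> (real^'n \<Rightarrow> real^'n) \<Rightarrow> real \<Rightarrow> real \<Rightarrow>
   (real \<Rightarrow> real \<Rightarrow> real^'n) \<Rightarrow> (real \<Rightarrow> real \<Rightarrow> real^'n) \<Rightarrow> bool" where
  "relaxation_solution A F G T \<epsilon> u v \<longleftrightarrow>
     smooth_strip T u \<and> smooth_strip T v \<and>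
     (\<forall>x. \<forall>t\<in>{0..T}. dt T u x t + dx v x t = 0) \<and>
     (\<exists>\<Gamma>. (\<forall>x. \<forall>t\<in>{0..T}. ((\<lambda>z. \<Gamma> z t) has_vector_derivative G (u x t)) (at x)) \<and>
          (\<forall>x. \<forall>t\<in>{0..T}. dt T v x t + A *v dx u x t =
              - (1 / \<epsilon>) *\<^sub>R (v x t - F (u x t) + \<Gamma> x t)))"

definition Psi ::
  "real \<Rightarrow> real \<Rightarrow> (real \<Rightarrow> real \<Rightarrow> real^'n) \<Rightarrow> (real \<Rightarrow> real \<Rightarrow> real^'n) \<Rightarrow> real \<Rightarrow> real" where
  "Psi T \<epsilon> ubar u t =
     (let w = (\<lambda>x t. ubar x t - u x t) in
      \<integral>x. (norm (w x t))\<^sup>2 + \<epsilon>\<^sup>2 * (norm (dx w x t))\<^sup>2 + \<epsilon>\<^sup>2 * (norm (dt T w x t))\<^sup>2 \<partial>lborel)"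

definition Rrel :: "(real^'n \<Rightarrow> real) \<Rightarrow> real^'n \<Rightarrow> real^'n \<Rightarrow> real" where
  "Rrel R ubar u = R u - R ubar - grad R ubar \<bullet> (u - ubar)"

end

theory Submission
  imports Defs
begin

text \<open>
  The proof is a modified relative entropy argument for \<open>w = u - v\<close>, where \<open>u = u\<^sup>\<epsilon>\<close> and \<open>v\<close> is the
  smooth solution of the balance law. Testing the equation of \<open>w\<close> with \<open>D\<eta>(u) - D\<eta>(v)\<close> and with
  \<open>\<epsilon>\<alpha> w\<^sub>t\<close> gives an energy
  \<open>\<eta>(u|v) + \<epsilon> (D\<eta>(u) - D\<eta>(v)) \<bullet> w\<^sub>t + \<epsilon>\<^sup>2 (\<alpha>/2) (\<bar>w\<^sub>t\<bar>\<^sup>2 + w\<^sub>x \<bullet> A w\<^sub>x)\<close>.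
  It is equivalent to the integrand of \<open>\<Psi>\<close> because the gradient of \<open>\<eta>\<close> is cocoercive,
  \<open>\<bar>D\<eta>(u) - D\<eta>(v)\<bar>\<^sup>2 \<le> \<alpha> \<eta>(u|v)\<close>, and the subcharacteristic condition makes its dissipation
  control \<open>\<epsilon> \<bar>w\<^sub>t\<bar>\<^sup>2 + \<epsilon> \<bar>w\<^sub>x\<bar>\<^sup>2\<close>. Weak dissipation removes the source from the first test; in the second
  it is the time derivative of the potential \<open>\<epsilon>\<alpha> R\<close>, up to a remainder. For continuous \<open>G\<close> one tests
  with \<open>u\<^sub>t\<close> in place of \<open>w\<^sub>t\<close>, so that the remainder \<open>\<epsilon>\<alpha> u\<^sub>t \<bullet> G(v)\<close> only involves square integrable
  quantities. For \<open>G\<close> of class \<open>C\<^sup>2\<close> the potential is \<open>R(u|v)\<close>, which is nonnegative because weak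
  dissipation forces \<open>R\<close> to be convex. All inequalities hold pointwise up to an \<open>x\<close>-derivative, and
  Gronwall's lemma concludes.
\<close>

section \<open>Integrated energy estimates\<close>

text \<open>The factor \<alpha> of the second test comes from a balance. Differentiating the cross
  term \<open>\<epsilon> (D\<eta>(u) - D\<eta>(v)) \<bullet> w\<^sub>t\<close> costs up to
  \<open>\<epsilon> \<alpha>/2\<close> times the square of \<open>w\<^sub>t\<close>, because the
  Hessian of \<eta> is at most \<alpha>/2, while the second test gains
  \<open>\<epsilon> \<alpha>\<close>. Half of what remains pays, together with the subcharacteristic
  condition, for the flux difference; the other half and \<nu> stay available for the source.

  The obstacle is the source in the second test: weak dissipation has a sign only against
  differences of \<open>D\<eta>\<close>, and a continuous \<open>G\<close> has no Lipschitz bound.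
  So the source must be an exact time derivative up to terms at \<open>v\<close> or up to a
  second-order remainder. The residual \<open>\<epsilon> (A vxx - vtt)\<close> alone gives order
  \<open>\<epsilon>\<^sup>2\<close>; the weaker order \<epsilon> of the first estimate is due to
  \<open>\<epsilon> \<alpha> vt \<bullet> G v\<close>, which contains no factor that is small with
  \<open>w\<close>.

  Such forcing never enters Gronwall's lemma as an inhomogeneity: a multiple of the time-independent
  integrable majorant of \<open>v\<close> is added to the energy density, and the inequality becomes
  homogeneous.\<close>

lemma borel_measurable_vector_derivative:
  fixes f f' :: "real \<Rightarrow> real \<Rightarrow> real"
  assumes d: "\<And>x. ((\<lambda>s. f s x) has_vector_derivative f' t x) (at t within S)"
    and S: "\<And>n. r n \<in> S" "\<And>n. r n \<noteq> t" "r \<longlonglongrightarrow> t" and t: "t \<in> S"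
    and m: "\<And>s. s \<in> S \<Longrightarrow> f s \<in> borel_measurable M"
  shows "f' t \<in> borel_measurable M"
proof (rule borel_measurable_LIMSEQ_real)
  show "(\<lambda>n. (f (r n) x - f t x) / (r n - t)) \<longlonglongrightarrow> f' t x" for x
  proof -
    have "((\<lambda>s. (f s x - f t x) / (s - t)) \<longlongrightarrow> f' t x) (at t within S)"
      using d[of x] by (simp add: has_real_derivative_iff_has_vector_derivative[symmetric] has_field_derivative_iff)
    then show ?thesis
      using S unfolding tendsto_at_iff_sequentially comp_def by auto
  qed
  show "(\<lambda>x. (f (r n) x - f t x) / (r n - t)) \<in> borel_measurable M" for n
    using m[OF S(1)] m[OF t] by measurable
qed

lemma ex_seq_in_interval:
  fixes T t :: real
  assumes "0 < T" "t \<in> {0..T}"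
  obtains r :: "nat \<Rightarrow> real" where "\<And>n. r n \<in> {0..T}" "\<And>n. r n \<noteq> t" "r \<longlonglongrightarrow> t"
proof -
  have "t islimpt {0..T}"
    using assms islimpt_Icc[of 0 T t] by auto
  then obtain r where r: "\<forall>n. r n \<in> {0..T} - {t}" "r \<longlonglongrightarrow> t"
    unfolding islimpt_sequential by blast
  then show thesis using that[of r] by auto
qed

text \<open>The mean value inequality on \<open>{0..T}\<close> bounds every difference quotient in
  time by the majorant \<open>k\<close>, so dominated convergence applies to the quotients.
  Measurability of \<open>f' t\<close> comes from them as well: it is their pointwise limit along a
  sequence that avoids \<open>t\<close>.\<close>

lemma has_vector_derivative_integral_dominated:
  fixes f f' :: "real \<Rightarrow> real \<Rightarrow> real"
  assumes T: "0 < T"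
    and d: "\<And>x s. s \<in> {0..T} \<Longrightarrow> ((\<lambda>s. f s x) has_vector_derivative f' s x) (at s within {0..T})"
    and i: "\<And>s. s \<in> {0..T} \<Longrightarrow> integrable M (f s)"
    and k: "integrable M k" "\<And>x s. s \<in> {0..T} \<Longrightarrow> \<bar>f' s x\<bar> \<le> k x"
    and t: "t \<in> {0..T}"
  shows "integrable M (f' t)"
    and "((\<lambda>s. \<integral>x. f s x \<partial>M) has_vector_derivative (\<integral>x. f' t x \<partial>M)) (at t within {0..T})"
proof -
  obtain r where r: "\<And>n. r n \<in> {0..T}" "\<And>n. r n \<noteq> t" "r \<longlonglongrightarrow> t"
    using ex_seq_in_interval[OF T t] by blast
  have mf: "f' s \<in> borel_measurable M" if s: "s \<in> {0..T}" for s
  proof -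
    obtain r where r: "\<And>n. r n \<in> {0..T}" "\<And>n. r n \<noteq> s" "r \<longlonglongrightarrow> s"
      using ex_seq_in_interval[OF T s] by blast
    show ?thesis
      by (rule borel_measurable_vector_derivative[where f=f and f'=f' and t=s and S="{0..T}" and r=r]) (use d[OF s] r s i in auto)
  qed
  show "integrable M (f' t)"
    by (rule Bochner_Integration.integrable_bound[OF k(1) mf[OF t]]) (use k(2)[OF t] order_trans[OF _ abs_ge_self] in auto)
  have lip: "\<bar>(f s x - f t x) / (s - t)\<bar> \<le> k x" if s: "s \<in> {0..T}" "s \<noteq> t" for s x
  proof -
    have "norm (f s x - f t x) \<le> k x * norm (s - t)"
    proof (rule field_differentiable_bound[where S="{0..T}" and f'="\<lambda>s. f' s x"])
      show "((\<lambda>s. f s x) has_field_derivative f' s x) (at s within {0..T})" if "s \<in> {0..T}" for s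
        using d[OF that] by (simp add: has_real_derivative_iff_has_vector_derivative)
    qed (use k(2) s t in auto)
    then show ?thesis using s by (simp add: abs_divide divide_le_eq)
  qed
  have "((\<lambda>s. ((\<integral>x. f s x \<partial>M) - (\<integral>x. f t x \<partial>M)) / (s - t)) \<longlongrightarrow> (\<integral>x. f' t x \<partial>M)) (at t within {0..T})"
    unfolding tendsto_at_iff_sequentially comp_def
  proof (intro allI impI)
    fix X :: "nat \<Rightarrow> real" assume X: "\<forall>n. X n \<in> {0..T} - {t}" "X \<longlonglongrightarrow> t"
    have eq: "((\<integral>x. f (X n) x \<partial>M) - (\<integral>x. f t x \<partial>M)) / (X n - t) = (\<integral>x. (f (X n) x - f t x) / (X n - t) \<partial>M)" for n
      using X(1) i[of "X n"] i[OF t] by (simp add: Bochner_Integration.integral_diff)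
    show "(\<lambda>n. ((\<integral>x. f (X n) x \<partial>M) - (\<integral>x. f t x \<partial>M)) / (X n - t)) \<longlonglongrightarrow> (\<integral>x. f' t x \<partial>M)"
      unfolding eq
    proof (rule integral_dominated_convergence[where w=k])
      show "f' t \<in> borel_measurable M" by (rule mf[OF t])
      show "(\<lambda>x. (f (X n) x - f t x) / (X n - t)) \<in> borel_measurable M" for n
        using X(1) i[of "X n", THEN borel_measurable_integrable] i[OF t, THEN borel_measurable_integrable] by auto
      show "integrable M k" by (rule k)
      show "AE x in M. (\<lambda>n. (f (X n) x - f t x) / (X n - t)) \<longlonglongrightarrow> f' t x"
      proof (rule AE_I2)
        fix x
        have "((\<lambda>s. (f s x - f t x) / (s - t)) \<longlongrightarrow> f' t x) (at t within {0..T})"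
          using d[OF t, of x] by (simp add: has_real_derivative_iff_has_vector_derivative[symmetric] has_field_derivative_iff)
        then show "(\<lambda>n. (f (X n) x - f t x) / (X n - t)) \<longlonglongrightarrow> f' t x"
          using X unfolding tendsto_at_iff_sequentially comp_def by auto
      qed
      show "AE x in M. norm ((f (X n) x - f t x) / (X n - t)) \<le> k x" for n
        using X(1) lip[of "X n"] by auto
    qed
  qed
  then show "((\<lambda>s. \<integral>x. f s x \<partial>M) has_vector_derivative (\<integral>x. f' t x \<partial>M)) (at t within {0..T})"
    by (simp add: has_real_derivative_iff_has_vector_derivative[symmetric] has_field_derivative_iff)
qed

text \<open>On \<open>{- n..n}\<close> the integral is \<open>\<phi> n - \<phi> (- n)\<close>, which
  vanishes in the limit; dominated convergence replaces the interval by the line. The derivative may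
  be discontinuous, so its measurability is again taken from difference quotients.\<close>

lemma integral_derivative_eq_0:
  fixes \<phi> \<phi>' :: "real \<Rightarrow> real"
  assumes d: "\<And>x. (\<phi> has_vector_derivative \<phi>' x) (at x)"
    and k: "integrable lborel k" "\<And>x. \<bar>\<phi>' x\<bar> \<le> k x"
    and l: "(\<phi> \<longlongrightarrow> 0) at_infinity"
  shows "integrable lborel \<phi>'" and "(\<integral>x. \<phi>' x \<partial>lborel) = 0"
proof -
  have m\<phi>: "\<phi> \<in> borel_measurable lborel"
    using d by (auto intro!: borel_measurable_continuous_onI continuous_at_imp_continuous_on has_vector_derivative_continuous)
  have m: "\<phi>' \<in> borel_measurable lborel"
  proof (rule borel_measurable_LIMSEQ_real)
    show "(\<lambda>n. (\<phi> (x + 1 / real (Suc n)) - \<phi> x) / (1 / real (Suc n))) \<longlonglongrightarrow> \<phi>' x" for x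
    proof -
      have "((\<lambda>h. (\<phi> (x + h) - \<phi> x) / h) \<longlongrightarrow> \<phi>' x) (at 0)"
        using d[of x] by (simp add: has_real_derivative_iff_has_vector_derivative[symmetric] DERIV_def)
      moreover have "filterlim (\<lambda>n. 1 / real (Suc n)) (at 0) sequentially"
        by (rule filterlim_atI[OF LIMSEQ_Suc[OF lim_1_over_n]]) auto
      ultimately show ?thesis
        by (rule filterlim_compose)
    qed
    have "(\<lambda>x. \<phi> (x + c)) \<in> borel_measurable lborel" for c
      using m\<phi> by measurable
    then show "(\<lambda>x. (\<phi> (x + 1 / real (Suc n)) - \<phi> x) / (1 / real (Suc n))) \<in> borel_measurable lborel" for n
      using m\<phi> by (intro borel_measurable_divide borel_measurable_diff) auto
  qed
  show int: "integrable lborel \<phi>'"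
    by (rule Bochner_Integration.integrable_bound[OF k(1) m]) (use k(2) order_trans[OF _ abs_ge_self] in auto)
  have fin: "(\<integral>x. indicator {- real n..real n} x *\<^sub>R \<phi>' x \<partial>lborel) = \<phi> (real n) - \<phi> (- real n)" for n
  proof -
    have "(\<phi>' has_integral (\<phi> (real n) - \<phi> (- real n))) {- real n..real n}"
      by (rule fundamental_theorem_of_calculus) (auto intro!: has_vector_derivative_at_within[OF d])
    moreover have "(\<phi>' has_integral (\<integral>x. indicator {- real n..real n} x *\<^sub>R \<phi>' x \<partial>lborel)) {- real n..real n}"
    proof -
      have "set_integrable lborel {- real n..real n} \<phi>'"
        unfolding set_integrable_def by (rule integrable_mult_indicator[OF _ int]) auto
      from has_integral_integral_lborel[OF this[unfolded set_integrable_def]]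
      show ?thesis
        by (subst has_integral_restrict_UNIV[symmetric])
          (auto elim!: has_integral_eq[rotated] simp: indicator_def if_distrib cong: if_cong)
    qed
    ultimately show ?thesis using has_integral_unique by blast
  qed
  have "(\<lambda>n. \<integral>x. indicator {- real n..real n} x *\<^sub>R \<phi>' x \<partial>lborel) \<longlonglongrightarrow> (\<integral>x. \<phi>' x \<partial>lborel)"
  proof (rule integral_dominated_convergence[where w=k])
    show "AE x in lborel. (\<lambda>n. indicator {- real n..real n} x *\<^sub>R \<phi>' x) \<longlonglongrightarrow> \<phi>' x"
    proof (rule AE_I2)
      fix x :: real
      have "eventually (\<lambda>n. indicator {- real n..real n} x *\<^sub>R \<phi>' x = \<phi>' x) sequentially"
      proof -
        obtain N :: nat where "\<bar>x\<bar> \<le> real N" using real_arch_simple by blast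
        then show ?thesis
          by (intro eventually_sequentiallyI[of N]) (auto simp: indicator_def)
      qed
      then show "(\<lambda>n. indicator {- real n..real n} x *\<^sub>R \<phi>' x) \<longlonglongrightarrow> \<phi>' x"
        by (rule tendsto_eventually)
    qed
    show "AE x in lborel. norm (indicator {- real n..real n} x *\<^sub>R \<phi>' x) \<le> k x" for n
      using k(2) order_trans[OF abs_ge_zero k(2)] by (auto simp: indicator_def)
  qed (use m k in auto)
  moreover have "(\<lambda>n. \<phi> (real n) - \<phi> (- real n)) \<longlonglongrightarrow> 0 - 0"
  proof (rule tendsto_diff)
    have r: "filterlim real at_infinity sequentially"
      by (rule filterlim_mono[OF filterlim_real_sequentially at_top_le_at_infinity order_refl])
    have s: "filterlim (\<lambda>n. - real n) at_infinity sequentially"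
      by (rule filterlim_mono[OF _ at_bot_le_at_infinity order_refl])
        (simp add: filterlim_uminus_at_bot filterlim_real_sequentially)
    show "(\<lambda>n. \<phi> (real n)) \<longlonglongrightarrow> 0" by (rule filterlim_compose[OF l r])
    show "(\<lambda>n. \<phi> (- real n)) \<longlonglongrightarrow> 0" by (rule filterlim_compose[OF l s])
  qed
  ultimately show "(\<integral>x. \<phi>' x \<partial>lborel) = 0"
    unfolding fin using LIMSEQ_unique by fastforce
qed

text \<open>The product \<open>exp (- C s) * E s\<close> is nonincreasing. The sign of its
  derivative is examined in the open interval, where the derivative within \<open>{0..T}\<close> is
  two-sided.\<close>

lemma gronwall_differential:
  fixes E E' :: "real \<Rightarrow> real"
  assumes d: "\<And>s. s \<in> {0..T} \<Longrightarrow> (E has_vector_derivative E' s) (at s within {0..T})"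
    and le: "\<And>s. s \<in> {0..T} \<Longrightarrow> E' s \<le> C * E s" and t: "t \<in> {0..T}"
  shows "E t \<le> exp (C * t) * E 0"
proof -
  have "exp (- (C * t)) * E t \<le> exp (- (C * 0)) * E 0"
  proof (rule DERIV_nonpos_imp_decreasing_open[where f="\<lambda>s. exp (- (C * s)) * E s"])
    show "0 \<le> t" using t by auto
    show "\<exists>y. ((\<lambda>s. exp (- (C * s)) * E s) has_real_derivative y) (at x) \<and> y \<le> 0" if x: "0 < x" "x < t" for x
    proof -
      have "(E has_real_derivative E' x) (at x within {0..T})"
        using d[of x] x t by (simp add: has_real_derivative_iff_has_vector_derivative)
      moreover have "at x within {0..T} = at x"
        using x t by (intro at_within_interior) (auto simp: interior_atLeastAtMost_real)
      ultimately have "(E has_real_derivative E' x) (at x)" by simp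
      then have "((\<lambda>s. exp (- (C * s)) * E s) has_real_derivative exp (- (C * x)) * (E' x - C * E x)) (at x)"
        by (auto intro!: derivative_eq_intros simp: algebra_simps)
      moreover have "exp (- (C * x)) * (E' x - C * E x) \<le> 0"
        using le[of x] x t by (intro mult_nonneg_nonpos) auto
      ultimately show ?thesis by blast
    qed
    have "continuous_on {0..T} E"
      using d by (intro continuous_on_vector_derivative) auto
    then show "continuous_on {0..t} (\<lambda>s. exp (- (C * s)) * E s)"
      using t by (auto intro!: continuous_intros elim: continuous_on_subset)
  qed
  then have "exp (C * t) * (exp (- (C * t)) * E t) \<le> exp (C * t) * E 0"
    by (intro mult_left_mono) auto
  then show ?thesis by (simp add: exp_minus mult.assoc[symmetric])
qed

text \<open>The flux disappears in the \<open>x\<close>-integral, so a pointwise differential inequality for a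
  density is turned into a bound on its integral.\<close>

lemma energy_estimate:
  fixes e e' \<phi> \<phi>' :: "real \<Rightarrow> real \<Rightarrow> real"
  assumes T: "0 < T"
    and e: "\<And>x t. t \<in> {0..T} \<Longrightarrow> ((\<lambda>s. e x s) has_vector_derivative e' x t) (at t within {0..T})"
    and ei: "\<And>t. t \<in> {0..T} \<Longrightarrow> integrable lborel (\<lambda>x. e x t)"
    and k: "integrable lborel k" "\<And>x t. t \<in> {0..T} \<Longrightarrow> \<bar>e' x t\<bar> \<le> k x"
    and \<phi>: "\<And>x t. t \<in> {0..T} \<Longrightarrow> ((\<lambda>z. \<phi> z t) has_vector_derivative \<phi>' x t) (at x)"
    and l: "integrable lborel l" "\<And>x t. t \<in> {0..T} \<Longrightarrow> \<bar>\<phi>' x t\<bar> \<le> l x"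
    and lim: "\<And>t. t \<in> {0..T} \<Longrightarrow> ((\<lambda>x. \<phi> x t) \<longlongrightarrow> 0) at_infinity"
    and le: "\<And>x t. t \<in> {0..T} \<Longrightarrow> e' x t + \<phi>' x t \<le> C * e x t"
    and t: "t \<in> {0..T}"
  shows "(\<integral>x. e x t \<partial>lborel) \<le> exp (C * t) * (\<integral>x. e x 0 \<partial>lborel)"
proof -
  note D = has_vector_derivative_integral_dominated[of T "\<lambda>s x. e x s" "\<lambda>s x. e' x s" lborel k, OF T e ei k]
  note P = integral_derivative_eq_0[OF \<phi> l(1) l(2) lim]
  show ?thesis
  proof (rule gronwall_differential[OF _ _ t])
    fix s assume s: "s \<in> {0..T}"
    show "((\<lambda>s. \<integral>x. e x s \<partial>lborel) has_vector_derivative (\<integral>x. e' x s \<partial>lborel)) (at s within {0..T})"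
      using D(2)[OF _ _ _ s] by blast
    have i: "integrable lborel (\<lambda>x. e' x s)" "integrable lborel (\<lambda>x. \<phi>' x s)"
      using D(1)[OF _ _ _ s] P(1)[OF s s s] by blast+
    have "(\<integral>x. e' x s \<partial>lborel) = (\<integral>x. e' x s + \<phi>' x s \<partial>lborel)"
      using i P(2)[OF s s s] by simp
    also have "\<dots> \<le> (\<integral>x. C * e x s \<partial>lborel)"
      using i ei[OF s] le[OF s] by (intro integral_mono) auto
    finally show "(\<integral>x. e' x s \<partial>lborel) \<le> C * (\<integral>x. e x s \<partial>lborel)" by simp
  qed
qed

section \<open>Entropy and flux: consequences of the structural hypotheses\<close>

text \<open>The mean value inequality for \<open>f - D v\<close> on the segment. The hypotheses
  concern the segment only, because for \<open>G\<close> the derivative is Lipschitz merely on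
  bounded sets.\<close>

lemma norm_remainder_le:
  fixes f :: "'a::euclidean_space \<Rightarrow> 'b::real_normed_vector"
  assumes d: "\<And>x. x \<in> closed_segment v u \<Longrightarrow> (f has_derivative D x) (at x)"
    and lip: "\<And>x y. x \<in> closed_segment v u \<Longrightarrow> norm (D x y - D v y) \<le> K * norm (x - v) * norm y"
    and K: "0 \<le> K"
  shows "norm (f u - f v - D v (u - v)) \<le> K * (norm (u - v))\<^sup>2"
proof -
  have v: "v \<in> closed_segment v u" by simp
  have "norm (f u - f v - D v (u - v)) \<le> norm (u - v) * (K * norm (u - v))"
  proof (rule differentiable_bound_linearization[of v u "closed_segment v u" f D v])
    fix x assume x: "x \<in> closed_segment v u"
    have "norm (x - v) \<le> norm (u - v)"
      using segment_bound1[OF x] by (simp add: norm_minus_commute)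
    have *: "norm (D x y - D v y) \<le> (K * norm (u - v)) * norm y" for y
    proof -
      have "norm (D x y - D v y) \<le> K * norm (x - v) * norm y" by (rule lip[OF x])
      also have "\<dots> \<le> (K * norm (u - v)) * norm y"
        using \<open>norm (x - v) \<le> norm (u - v)\<close> K by (intro mult_right_mono mult_left_mono) auto
      finally show ?thesis .
    qed
    show "onorm (D x - D v) \<le> K * norm (u - v)"
      using * K by (intro onorm_le) (auto simp: fun_diff_def)
    show "(f has_derivative D x) (at x within closed_segment v u)"
      using d[OF x] has_derivative_at_withinI by blast
  next
    fix t :: real assume "t \<in> {0..1}"
    then show "v + t *\<^sub>R (u - v) \<in> closed_segment v u"
      by (auto simp: in_segment algebra_simps intro!: exI[of _ t])
  qed (rule v)
  then show ?thesis by (simp add: power2_eq_square algebra_simps)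
qed

lemma norm_diff_le_of_derivative:
  fixes f :: "'a::euclidean_space \<Rightarrow> 'b::real_normed_vector"
  assumes d: "\<And>x. (f has_derivative D x) (at x)" and le: "\<And>x y. norm (D x y) \<le> K * norm y"
  shows "norm (f u - f v) \<le> K * norm (u - v)"
proof (rule differentiable_bound[of UNIV f D K])
  show "onorm (D x) \<le> K" for x by (rule onorm_le) (rule le)
qed (use d in auto)

text \<open>Maclaurin's formula with Lagrange remainder for \<open>s \<mapsto> f (v + s d)\<close>
  on \<open>[0, 1]\<close>, which asks for the second derivative pointwise and not for its
  continuity.\<close>

lemma taylor2_along_segment:
  fixes f :: "'a::real_inner \<Rightarrow> real"
  assumes f: "\<And>x. (f has_derivative (\<lambda>y. g x \<bullet> y)) (at x)"
    and g: "\<And>x. (g has_derivative H x) (at x)"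
  obtains \<xi> where "f u - f v - g v \<bullet> (u - v) = (H \<xi> (u - v) \<bullet> (u - v)) / 2"
proof -
  define d where "d = u - v"
  define diff where "diff = (\<lambda>(m::nat) s. if m = 0 then f (v + s *\<^sub>R d) else if m = 1 then g (v + s *\<^sub>R d) \<bullet> d
     else H (v + s *\<^sub>R d) d \<bullet> d)"
  have lin: "((\<lambda>s. v + s *\<^sub>R d) has_derivative (\<lambda>h. h *\<^sub>R d)) (at s)" for s
    by (auto intro!: derivative_eq_intros)
  have Hl: "H x (c *\<^sub>R y) = c *\<^sub>R H x y" for x c y
    using has_derivative_linear[OF g[of x]] by (simp add: linear_scale)
  have "((\<lambda>s. f (v + s *\<^sub>R d)) has_real_derivative g (v + s *\<^sub>R d) \<bullet> d) (at s)" for s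
    using has_derivative_compose[OF lin f[of "v + s *\<^sub>R d"]]
    by (simp add: has_field_derivative_def mult_commute_abs)
  moreover have "((\<lambda>s. g (v + s *\<^sub>R d) \<bullet> d) has_real_derivative H (v + s *\<^sub>R d) d \<bullet> d) (at s)" for s
    using has_derivative_inner_left[OF has_derivative_compose[OF lin g[of "v + s *\<^sub>R d"]], of d]
    by (simp add: has_field_derivative_def mult_commute_abs Hl)
  ultimately have "\<forall>m t. m < 2 \<and> 0 \<le> t \<and> t \<le> 1 \<longrightarrow> (diff m has_real_derivative diff (Suc m) t) (at t)"
    by (auto simp: diff_def less_2_cases_iff)
  from Maclaurin[of 1 2 diff "diff 0", OF _ _ _ this]
  obtain t where "diff 0 1 = (\<Sum>m<2. diff m 0 / fact m * 1 ^ m) + diff 2 t / fact 2 * 1 ^ 2"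
    by auto
  then have "f u - f v - g v \<bullet> (u - v) = (H (v + t *\<^sub>R d) d \<bullet> d) / 2"
    by (simp add: diff_def d_def numeral_2_eq_2)
  then show thesis using that unfolding d_def by blast
qed

text \<open>The hypotheses on the data in derivative form, on a Euclidean space: \<open>g\<close>
  and \<open>H\<close> stand for the gradient and Hessian of \<eta>, \<open>J\<close> for the
  Jacobian of \<open>F\<close>. \<open>HJ_sym\<close> says that the Hessian symmetrises the
  Jacobian, which is the local content of having an entropy flux. In \<open>subchar\<close> the
  symmetrised matrix product has become the form \<open>H u y \<bullet> A y\<close>.\<close>

locale entropy_structure =
  fixes \<eta> q R :: "'a::euclidean_space \<Rightarrow> real"
    and g F G A :: "'a \<Rightarrow> 'a" and H J :: "'a \<Rightarrow> 'a \<Rightarrow> 'a"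
    and \<alpha> \<beta> \<nu> M L a\<^sub>0 a\<^sub>1 :: real
  assumes \<eta>_deriv: "(\<eta> has_derivative (\<lambda>y. g u \<bullet> y)) (at u)"
    and g_deriv: "(g has_derivative H u) (at u)"
    and F_deriv: "(F has_derivative J u) (at u)"
    and q_deriv: "(q has_derivative (\<lambda>y. g u \<bullet> J u y)) (at u)"
    and R_deriv: "(R has_derivative (\<lambda>y. - G u \<bullet> y)) (at u)"
    and G_cont: "continuous_on UNIV G"
    and H_sym: "H u x \<bullet> y = x \<bullet> H u y"
    and HJ_sym: "H u x \<bullet> J u y = H u y \<bullet> J u x"
    and H_lower: "\<beta> * (norm y)\<^sup>2 \<le> H u y \<bullet> y"
    and H_upper: "H u y \<bullet> y \<le> \<alpha> / 2 * (norm y)\<^sup>2"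
    and H_norm: "norm (H u y) \<le> \<alpha> / 2 * norm y"
    and H_lip: "norm (H u y - H v y) \<le> M * norm (u - v) * norm y"
    and J_norm: "norm (J u y) \<le> L * norm y"
    and J_lip: "norm (J u y - J v y) \<le> M * norm (u - v) * norm y"
    and subchar: "\<nu> * (norm y)\<^sup>2 + \<alpha> * (norm (J u y))\<^sup>2 \<le> H u y \<bullet> A y"
    and dissipation: "(g u - g v) \<bullet> (G u - G v) \<le> 0"
    and R_nonneg: "0 \<le> R u"
    and A_linear: "bounded_linear A"
    and A_sym: "A x \<bullet> y = x \<bullet> A y"
    and A_lower: "a\<^sub>0 * (norm y)\<^sup>2 \<le> y \<bullet> A y"
    and A_norm: "norm (A y) \<le> a\<^sub>1 * norm y"
    and pos: "0 < \<alpha>" "0 < \<beta>" "0 < \<nu>" "0 < M" "0 < L" "0 < a\<^sub>0" "0 < a\<^sub>1"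
begin

lemma H_linear: "bounded_linear (H u)"
  using g_deriv has_derivative_bounded_linear by blast

lemma J_linear: "bounded_linear (J u)"
  using F_deriv has_derivative_bounded_linear by blast

definition etarel :: "'a \<Rightarrow> 'a \<Rightarrow> real" where
  "etarel u v = \<eta> u - \<eta> v - g v \<bullet> (u - v)"

lemma g_lip: "norm (g u - g v) \<le> \<alpha> / 2 * norm (u - v)"
  by (rule norm_diff_le_of_derivative[OF g_deriv H_norm])

lemma F_lip: "norm (F u - F v) \<le> L * norm (u - v)"
  by (rule norm_diff_le_of_derivative[OF F_deriv J_norm])

lemma g_remainder: "norm (g u - g v - H v (u - v)) \<le> M * (norm (u - v))\<^sup>2"
  by (rule norm_remainder_le) (use g_deriv H_lip pos in auto)

lemma F_remainder: "norm (F u - F v - J v (u - v)) \<le> M * (norm (u - v))\<^sup>2"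
  by (rule norm_remainder_le) (use F_deriv J_lip pos in auto)

lemma etarel_lower: "\<beta> / 2 * (norm (u - v))\<^sup>2 \<le> etarel u v"
  using taylor2_along_segment[OF \<eta>_deriv g_deriv, of u v] H_lower[of "u - v"]
  by (metis etarel_def divide_right_mono times_divide_eq_left zero_le_numeral)

lemma etarel_upper: "etarel u v \<le> \<alpha> / 4 * (norm (u - v))\<^sup>2"
proof -
  obtain \<xi> where "etarel u v = (H \<xi> (u - v) \<bullet> (u - v)) / 2"
    using taylor2_along_segment[OF \<eta>_deriv g_deriv, of u v] unfolding etarel_def by metis
  then show ?thesis using H_upper[of \<xi> "u - v"] by simp
qed

text \<open>Evaluating the convexity inequality at the gradient step \<open>u - (2/\<alpha>) (g u - g v)\<close>.\<close>

lemma cocoercive: "(norm (g u - g v))\<^sup>2 \<le> \<alpha> * etarel u v"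
proof -
  define p where "p = g u - g v"
  \<comment> \<open>The step size minimises
    \<open>\<alpha> / 4 * (norm (z - u))\<^sup>2 + p \<bullet> (z - u)\<close>, which bounds
    \<open>etarel z v - etarel u v\<close> from above by \<open>etarel_upper\<close> and the
    three-point identity below.\<close>
  define z where "z = u - (2 / \<alpha>) *\<^sub>R p"
  have "0 \<le> etarel z v"
    using etarel_lower[of z v] pos by (meson mult_nonneg_nonneg order_trans zero_le_power2 less_imp_le divide_pos_pos zero_less_numeral)
  moreover have "etarel z v = etarel z u + etarel u v + p \<bullet> (z - u)"
    unfolding etarel_def p_def by (simp add: inner_diff algebra_simps)
  moreover have "etarel z u \<le> \<alpha> / 4 * (norm (z - u))\<^sup>2" by (rule etarel_upper)
  moreover have z: "z - u = - ((2 / \<alpha>) *\<^sub>R p)" unfolding z_def by simp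
  moreover have "\<alpha> / 4 * (norm (z - u))\<^sup>2 = (norm p)\<^sup>2 / \<alpha>"
    unfolding z norm_minus_cancel norm_scaleR using pos by (simp add: field_simps power2_eq_square)
  moreover have "p \<bullet> (z - u) = - 2 * ((norm p)\<^sup>2 / \<alpha>)"
    unfolding z by (simp add: power2_norm_eq_inner)
  ultimately have "(norm p)\<^sup>2 / \<alpha> \<le> etarel u v" by linarith
  then show ?thesis
    using pos unfolding p_def[symmetric] by (simp add: field_simps)
qed

end

section \<open>Pointwise energy inequalities\<close>

lemma mult_le_sum_squares: "x * y \<le> x\<^sup>2 + y\<^sup>2" for x y :: real
proof -
  have "2 * (x * y) \<le> x\<^sup>2 + y\<^sup>2"
    using zero_le_power2[of "x - y"] by (simp add: power2_diff)
  moreover have "0 \<le> x\<^sup>2 + y\<^sup>2" by simp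
  ultimately show ?thesis by linarith
qed

context entropy_structure
begin

text \<open>\<open>E0'\<close> is the \<open>t\<close>-derivative of the energy density \<open>E0\<close> and \<open>\<Phi>0'\<close> the \<open>x\<close>-derivative of its flux \<open>\<Phi>0\<close>
  along \<open>u = v + w\<close>; the derivatives of \<open>v\<close> and \<open>w\<close> are passed as independent vectors.\<close>

definition E0 :: "real \<Rightarrow> 'a \<Rightarrow> 'a \<Rightarrow> 'a \<Rightarrow> 'a \<Rightarrow> real" where
  "E0 \<epsilon> u v wt wx = etarel u v + \<epsilon> * ((g u - g v) \<bullet> wt) + \<epsilon>\<^sup>2 * (\<alpha> / 2) * (wt \<bullet> wt + wx \<bullet> A wx)"

definition E0' :: "real \<Rightarrow> 'a \<Rightarrow> 'a \<Rightarrow> 'a \<Rightarrow> 'a \<Rightarrow> 'a \<Rightarrow> 'a \<Rightarrow> 'a \<Rightarrow> real" where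
  "E0' \<epsilon> u v vt wt wx wtt wtx = (g u - g v) \<bullet> (vt + wt) - H v vt \<bullet> (u - v)
     + \<epsilon> * ((H u (vt + wt) - H v vt) \<bullet> wt + (g u - g v) \<bullet> wtt) + \<epsilon>\<^sup>2 * \<alpha> * (wt \<bullet> wtt + wtx \<bullet> A wx)"

definition \<Phi>0 :: "real \<Rightarrow> 'a \<Rightarrow> 'a \<Rightarrow> 'a \<Rightarrow> 'a \<Rightarrow> real" where
  "\<Phi>0 \<epsilon> u v wt wx = q u - q v - g v \<bullet> (F u - F v) - \<epsilon> * ((g u - g v) \<bullet> A wx) - \<epsilon>\<^sup>2 * \<alpha> * (wt \<bullet> A wx)"

definition \<Phi>0' :: "real \<Rightarrow> 'a \<Rightarrow> 'a \<Rightarrow> 'a \<Rightarrow> 'a \<Rightarrow> 'a \<Rightarrow> 'a \<Rightarrow> 'a \<Rightarrow> real" where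
  "\<Phi>0' \<epsilon> u v vx wt wx wtx wxx = (g u - g v) \<bullet> J u (vx + wx) - H v vx \<bullet> (F u - F v)
     - \<epsilon> * ((H u (vx + wx) - H v vx) \<bullet> A wx + (g u - g v) \<bullet> A wxx)
     - \<epsilon>\<^sup>2 * \<alpha> * (wtx \<bullet> A wx + wt \<bullet> A wxx)"

lemmas lin_simps = linear_add[OF bounded_linear.linear[OF H_linear]] linear_diff[OF bounded_linear.linear[OF H_linear]]
  linear_add[OF bounded_linear.linear[OF J_linear]] linear_diff[OF bounded_linear.linear[OF J_linear]]
  linear_add[OF bounded_linear.linear[OF A_linear]] linear_diff[OF bounded_linear.linear[OF A_linear]]

text \<open>The second derivatives \<open>wtt\<close> and \<open>A wxx\<close> enter only through
  \<open>\<epsilon> wtt - \<epsilon> A wxx\<close>, tested with \<open>g u - g v\<close> and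
  \<open>\<epsilon> \<alpha> wt\<close>, and \<open>S\<close> removes both. The balance law for
  \<open>vt\<close> and the symmetries of \<open>H\<close> and of \<open>H\<close> with
  \<open>J\<close> turn the terms without a factor \<epsilon> into the source product and the Taylor
  remainders of \<open>g\<close> and \<open>F\<close> at \<open>v\<close>. The source tested with
  \<open>wt\<close> is kept on the left because the two estimates treat it differently.\<close>

lemma base_identity:
  assumes S: "\<epsilon> *\<^sub>R (wtt - A wxx) = - wt - (J u (vx + wx) - J v vx) + (G u - G v) + \<epsilon> *\<^sub>R (A vxx - vtt)"
    and v: "vt + J v vx = G v"
  shows "E0' \<epsilon> u v vt wt wx wtt wtx + \<Phi>0' \<epsilon> u v vx wt wx wtx wxx - \<epsilon> * \<alpha> * (wt \<bullet> (G u - G v)) =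
     (g u - g v) \<bullet> (G u - G v) + (g u - g v - H v (u - v)) \<bullet> G v - H v vx \<bullet> (F u - F v - J v (u - v))
     - \<epsilon> * (H u wx \<bullet> A wx) - \<epsilon> * ((H u vx - H v vx) \<bullet> A wx) + \<epsilon> * ((g u - g v) \<bullet> (A vxx - vtt))
     + \<epsilon> * (H u wt \<bullet> wt) + \<epsilon> * ((H u vt - H v vt) \<bullet> wt) - \<epsilon> * \<alpha> * (wt \<bullet> wt)
     - \<epsilon> * \<alpha> * (wt \<bullet> (J u wx + (J u vx - J v vx))) + \<epsilon>\<^sup>2 * \<alpha> * (wt \<bullet> (A vxx - vtt))"
proof -
  define p where "p = g u - g v"
  have pS: "\<epsilon> * (x \<bullet> wtt) - \<epsilon> * (x \<bullet> A wxx) = x \<bullet> (- wt - (J u (vx + wx) - J v vx) + (G u - G v) + \<epsilon> *\<^sub>R (A vxx - vtt))" for x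
    unfolding S[symmetric] by (simp add: inner_simps algebra_simps)
  have "E0' \<epsilon> u v vt wt wx wtt wtx + \<Phi>0' \<epsilon> u v vx wt wx wtx wxx
    = p \<bullet> (vt + wt) - H v vt \<bullet> (u - v) + \<epsilon> * ((H u (vt + wt) - H v vt) \<bullet> wt)
      + p \<bullet> J u (vx + wx) - H v vx \<bullet> (F u - F v) - \<epsilon> * ((H u (vx + wx) - H v vx) \<bullet> A wx)
      + (\<epsilon> * (p \<bullet> wtt) - \<epsilon> * (p \<bullet> A wxx)) + \<epsilon> * \<alpha> * (\<epsilon> * (wt \<bullet> wtt) - \<epsilon> * (wt \<bullet> A wxx))"
    unfolding E0'_def \<Phi>0'_def p_def by (simp add: algebra_simps power2_eq_square)
  moreover have "H v vt \<bullet> (u - v) = G v \<bullet> H v (u - v) - H v (u - v) \<bullet> J v vx"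
    unfolding v[symmetric] using H_sym[of v vt "u - v"] by (simp add: inner_add_left inner_commute)
  moreover have "H v (u - v) \<bullet> J v vx = H v vx \<bullet> J v (u - v)" by (rule HJ_sym)
  moreover have "p \<bullet> vt = p \<bullet> G v - p \<bullet> J v vx"
    unfolding v[symmetric] by (simp add: inner_simps)
  ultimately show ?thesis
    unfolding pS p_def[symmetric]
    by (simp add: inner_simps lin_simps algebra_simps power2_eq_square inner_commute)
qed


lemma inner_le: "norm x \<le> a \<Longrightarrow> norm y \<le> b \<Longrightarrow> x \<bullet> y \<le> a * b" for x y :: 'a
  by (meson Cauchy_Schwarz_ineq2 abs_ge_self mult_mono norm_ge_zero order_trans)

lemma minus_inner_le: "norm x \<le> a \<Longrightarrow> norm y \<le> b \<Longrightarrow> - (x \<bullet> y) \<le> a * b" for x y :: 'a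
  using inner_le[of "-x" a y b] by simp

text \<open>The coefficients of the seven estimates \<open>s\<close> in
  \<open>base_inequality\<close>, with numerical factors rounded up.\<close>

definition C0 :: "real \<Rightarrow> real" where
  "C0 B = M * (1 + L) * B + \<alpha> * B * M + M * B * a\<^sub>1 + \<alpha> * (a\<^sub>1 + 1) + M * B + \<alpha> * M * B + \<alpha> * (a\<^sub>1 + 1)"

lemma C0_pos: "0 \<le> B \<Longrightarrow> 0 < C0 B"
  unfolding C0_def using pos by (intro add_nonneg_pos add_nonneg_nonneg) auto

lemma norm_E_le: "norm (A x - y) \<le> (a\<^sub>1 + 1) * b" if "norm x \<le> b" "norm y \<le> b"
proof -
  have "norm (A x - y) \<le> norm (A x) + norm y" by (rule norm_triangle_ineq4)
  also have "\<dots> \<le> a\<^sub>1 * b + b"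
    by (intro add_mono that order_trans[OF A_norm] mult_left_mono) (use pos in auto)
  finally show ?thesis by (simp add: algebra_simps)
qed

lemma norm_G_le: "norm (G v) \<le> (1 + L) * b" if "vt + J v vx = G v" "norm vt \<le> b" "norm vx \<le> b"
proof -
  have "norm (G v) \<le> norm vt + norm (J v vx)" unfolding that(1)[symmetric] by (rule norm_triangle_ineq)
  also have "\<dots> \<le> b + L * b"
    by (intro add_mono that order_trans[OF J_norm] mult_left_mono) (use pos in auto)
  finally show ?thesis by (simp add: algebra_simps)
qed

lemma norm_H_diff_le: "norm (H u y - H v y) \<le> M * norm (u - v) * B" if "norm y \<le> B"
  by (rule order_trans[OF H_lip]) (use pos that in \<open>auto intro!: mult_left_mono\<close>)

lemma norm_J_diff_le: "norm (J u y - J v y) \<le> M * norm (u - v) * B" if "norm y \<le> B"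
  by (rule order_trans[OF J_lip]) (use pos that in \<open>auto intro!: mult_left_mono\<close>)

text \<open>Balance of the dissipation: \<open>- \<epsilon> \<alpha>\<close> from the test with
  \<open>wt\<close> against \<open>\<epsilon> \<alpha> / 2\<close> from the Hessian leaves
  \<open>- \<epsilon> \<alpha> / 2\<close> for the square of \<open>wt\<close>. Young's inequality
  for \<open>wt \<bullet> J u wx\<close> uses half of this and the
  \<open>\<alpha> * (norm (J u wx))\<^sup>2\<close> supplied by \<open>subchar\<close>; the rest is
  retained on the right. First derivatives of \<open>v\<close> act as coefficients, bounded by the
  constant \<open>B\<close>; second derivatives act as forcing, bounded by \<open>b\<close>, later
  the square root of an integrable function.\<close>

lemma base_inequality:
  fixes \<epsilon> B b :: real
  assumes \<epsilon>: "0 < \<epsilon>"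
    and S: "\<epsilon> *\<^sub>R (wtt - A wxx) = - wt - (J u (vx + wx) - J v vx) + (G u - G v) + \<epsilon> *\<^sub>R (A vxx - vtt)"
    and v: "vt + J v vx = G v"
    and B: "norm vt \<le> B" "norm vx \<le> B" and b: "norm vxx \<le> b" "norm vtt \<le> b"
  shows "E0' \<epsilon> u v vt wt wx wtt wtx + \<Phi>0' \<epsilon> u v vx wt wx wtx wxx - \<epsilon> * \<alpha> * (wt \<bullet> (G u - G v))
    \<le> C0 B * ((norm (u - v))\<^sup>2 + \<epsilon>\<^sup>2 * (norm wx)\<^sup>2 + \<epsilon>\<^sup>2 * (norm wt)\<^sup>2 + \<epsilon>\<^sup>2 * b\<^sup>2)
      - \<epsilon> * (\<alpha> / 4) * (norm wt)\<^sup>2 - \<epsilon> * \<nu> * (norm wx)\<^sup>2"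
proof -
  define X Y Z K where "X = norm (u - v)" and "Y = norm wt" and "Z = norm wx" and "K = norm (J u wx)"
  note XYZK = this
  have nn: "0 \<le> X" "0 \<le> Y" "0 \<le> Z" "0 \<le> K" "0 \<le> B" "0 \<le> b"
    using B b norm_ge_zero order_trans unfolding XYZK by blast+
  have pX: "norm (g u - g v) \<le> \<alpha> / 2 * X" unfolding X_def by (rule g_lip)
  have E: "norm (A vxx - vtt) \<le> (a\<^sub>1 + 1) * b" using b by (rule norm_E_le)
  have Hvx: "norm (H v vx) \<le> \<alpha> / 2 * B"
    by (rule order_trans[OF H_norm]) (use pos B in auto)
  have t2: "(g u - g v - H v (u - v)) \<bullet> G v \<le> (M * X\<^sup>2) * ((1 + L) * B)"
    by (intro inner_le norm_G_le[OF v B]) (simp add: X_def g_remainder)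
  have t3: "- (H v vx \<bullet> (F u - F v - J v (u - v))) \<le> (\<alpha> / 2 * B) * (M * X\<^sup>2)"
    by (intro minus_inner_le Hvx) (simp add: X_def F_remainder)
  have t4: "\<epsilon> * (\<nu> * Z\<^sup>2 + \<alpha> * K\<^sup>2) \<le> \<epsilon> * (H u wx \<bullet> A wx)"
    unfolding XYZK using \<epsilon> subchar by (intro mult_left_mono) auto
  have t5: "\<epsilon> * - ((H u vx - H v vx) \<bullet> A wx) \<le> \<epsilon> * ((M * X * B) * (a\<^sub>1 * Z))"
    unfolding XYZK using \<epsilon> B by (intro mult_left_mono minus_inner_le norm_H_diff_le A_norm) auto
  have t6: "\<epsilon> * ((g u - g v) \<bullet> (A vxx - vtt)) \<le> \<epsilon> * ((\<alpha> / 2 * X) * ((a\<^sub>1 + 1) * b))"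
    using \<epsilon> by (intro mult_left_mono inner_le pX E) auto
  have t7: "\<epsilon> * (H u wt \<bullet> wt) \<le> \<epsilon> * (\<alpha> / 2 * Y\<^sup>2)"
    unfolding XYZK using \<epsilon> H_upper by (intro mult_left_mono) auto
  have t8: "\<epsilon> * ((H u vt - H v vt) \<bullet> wt) \<le> \<epsilon> * ((M * X * B) * Y)"
    unfolding XYZK using \<epsilon> B by (intro mult_left_mono inner_le norm_H_diff_le) auto
  have t9: "wt \<bullet> wt = Y\<^sup>2" unfolding XYZK by (simp add: power2_norm_eq_inner)
  have t10: "\<epsilon> * \<alpha> * - (wt \<bullet> (J u wx + (J u vx - J v vx))) \<le> \<epsilon> * \<alpha> * (Y * (K + M * X * B))"
    unfolding XYZK using \<epsilon> B pos
    by (intro mult_left_mono minus_inner_le order_trans[OF norm_triangle_ineq] add_mono norm_J_diff_le) auto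
  have t11: "\<epsilon>\<^sup>2 * \<alpha> * (wt \<bullet> (A vxx - vtt)) \<le> \<epsilon>\<^sup>2 * \<alpha> * (Y * ((a\<^sub>1 + 1) * b))"
    using \<epsilon> pos by (intro mult_left_mono inner_le E) (auto simp: XYZK)
  have young: "\<epsilon> * \<alpha> * (Y * K) \<le> \<epsilon> * (\<alpha> / 4) * Y\<^sup>2 + \<epsilon> * \<alpha> * K\<^sup>2"
  proof -
    have "Y * K \<le> Y\<^sup>2 / 4 + K\<^sup>2"
      using zero_le_power2[of "Y / 2 - K"] by (simp add: power2_eq_square algebra_simps)
    then have "\<epsilon> * \<alpha> * (Y * K) \<le> \<epsilon> * \<alpha> * (Y\<^sup>2 / 4 + K\<^sup>2)" using \<epsilon> pos by (intro mult_left_mono) auto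
    then show ?thesis by (simp add: algebra_simps)
  qed
  \<comment> \<open>Apart from the dissipative terms and \<open>Y * K\<close>, every derivative of
    \<open>w\<close> and every \<open>b\<close> carries its own factor \<epsilon>, so each error is
    a product of two of \<open>X\<close>, \<open>e\<close>, \<open>f\<close>,
    \<open>c\<close>.\<close>
  define e f c Q where "e = \<epsilon> * Z" and "f = \<epsilon> * Y" and "c = \<epsilon> * b" and "Q = X\<^sup>2 + e\<^sup>2 + f\<^sup>2 + c\<^sup>2"
  note prod = mult_le_sum_squares
  have Q: "X * e \<le> Q" "X * f \<le> Q" "X * c \<le> Q" "f * c \<le> Q" "X\<^sup>2 \<le> Q"
    unfolding Q_def using prod[of X e] prod[of X f] prod[of X c] prod[of f c]
      zero_le_power2[of X] zero_le_power2[of e] zero_le_power2[of f] zero_le_power2[of c] by linarith+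
  have "0 \<le> Q" unfolding Q_def by simp
  have s: "M * (1 + L) * B * X\<^sup>2 \<le> M * (1 + L) * B * Q" "\<alpha> * B * M * (X\<^sup>2 / 2) \<le> \<alpha> * B * M * Q"
    "M * B * a\<^sub>1 * (X * e) \<le> M * B * a\<^sub>1 * Q" "\<alpha> * (a\<^sub>1 + 1) * (X * c / 2) \<le> \<alpha> * (a\<^sub>1 + 1) * Q"
    "M * B * (X * f) \<le> M * B * Q" "\<alpha> * M * B * (X * f) \<le> \<alpha> * M * B * Q"
    "\<alpha> * (a\<^sub>1 + 1) * (f * c) \<le> \<alpha> * (a\<^sub>1 + 1) * Q"
    using Q \<open>0 \<le> Q\<close> pos nn by (auto intro!: mult_left_mono)
  have "E0' \<epsilon> u v vt wt wx wtt wtx + \<Phi>0' \<epsilon> u v vx wt wx wtx wxx - \<epsilon> * \<alpha> * (wt \<bullet> (G u - G v))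
    \<le> 0 + (M * X\<^sup>2) * ((1 + L) * B) + (\<alpha> / 2 * B) * (M * X\<^sup>2) - \<epsilon> * (\<nu> * Z\<^sup>2 + \<alpha> * K\<^sup>2)
      + \<epsilon> * ((M * X * B) * (a\<^sub>1 * Z)) + \<epsilon> * ((\<alpha> / 2 * X) * ((a\<^sub>1 + 1) * b)) + \<epsilon> * (\<alpha> / 2 * Y\<^sup>2)
      + \<epsilon> * ((M * X * B) * Y) - \<epsilon> * \<alpha> * Y\<^sup>2 + \<epsilon> * \<alpha> * (Y * (K + M * X * B)) + \<epsilon>\<^sup>2 * \<alpha> * (Y * ((a\<^sub>1 + 1) * b))"
    unfolding base_identity[OF S v] t9
    using dissipation[of u v] t2 t3 t4 t5 t6 t7 t8 t10 t11 by linarith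
  also have "\<dots> = M * (1 + L) * B * X\<^sup>2 + \<alpha> * B * M * (X\<^sup>2 / 2) + M * B * a\<^sub>1 * (X * e)
      + \<alpha> * (a\<^sub>1 + 1) * (X * c / 2) + M * B * (X * f) + \<alpha> * M * B * (X * f) + \<alpha> * (a\<^sub>1 + 1) * (f * c)
      + \<epsilon> * \<alpha> * (Y * K) - \<epsilon> * \<alpha> * K\<^sup>2 - \<epsilon> * \<nu> * Z\<^sup>2 - \<epsilon> * (\<alpha> / 2) * Y\<^sup>2"
    unfolding e_def f_def c_def by (simp add: power2_eq_square field_simps)
  also have "\<dots> \<le> C0 B * Q - \<epsilon> * (\<alpha> / 4) * Y\<^sup>2 - \<epsilon> * \<nu> * Z\<^sup>2"
  proof -
    have "\<epsilon> * (\<alpha> / 2) * Y\<^sup>2 = 2 * (\<epsilon> * (\<alpha> / 4) * Y\<^sup>2)" by simp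
    moreover have "C0 B * Q = M * (1 + L) * B * Q + \<alpha> * B * M * Q + M * B * a\<^sub>1 * Q + \<alpha> * (a\<^sub>1 + 1) * Q
        + M * B * Q + \<alpha> * M * B * Q + \<alpha> * (a\<^sub>1 + 1) * Q"
      unfolding C0_def by (simp only: distrib_right)
    ultimately show ?thesis using s young by linarith
  qed
  also have "Q = X\<^sup>2 + \<epsilon>\<^sup>2 * Z\<^sup>2 + \<epsilon>\<^sup>2 * Y\<^sup>2 + \<epsilon>\<^sup>2 * b\<^sup>2"
    unfolding Q_def e_def f_def c_def by (simp add: power_mult_distrib)
  finally show ?thesis unfolding XYZK .
qed


text \<open>\<open>\<alpha> * (2 + L)\<^sup>2\<close> and
  \<open>\<alpha>\<^sup>2 * L\<^sup>2 / \<nu>\<close> are the costs of absorbing products with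
  \<open>wt\<close> and \<open>wx\<close> into the dissipation left by
  \<open>base_inequality\<close>; the other summands are coefficients of direct estimates.\<close>

definition C1 :: "real \<Rightarrow> real" where
  "C1 B = \<alpha> * (1 + L) + \<alpha> * (2 + L)\<^sup>2 + \<alpha>\<^sup>2 * L\<^sup>2 / \<nu> + \<alpha> + \<alpha> * a\<^sub>1 + \<alpha> * M * B + \<alpha> * (a\<^sub>1 + 1)"

lemma C1_pos: "0 \<le> B \<Longrightarrow> 0 < C1 B"
  unfolding C1_def using pos by (intro add_nonneg_pos add_nonneg_nonneg) auto

text \<open>Since \<open>R\<close> is a potential of \<open>- G\<close>, the equation is tested here with \<open>u\<^sub>t\<close> rather than \<open>w\<^sub>t\<close>:
  what remains of the source is \<open>G\<close> at the smooth state, which is controlled by \<open>v\<^sub>t\<close> and \<open>v\<^sub>x\<close>.\<close>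

lemma source_inequality:
  fixes \<epsilon> B b :: real
  assumes \<epsilon>: "0 < \<epsilon>" "\<epsilon> \<le> 1"
    and S: "\<epsilon> *\<^sub>R (wtt - A wxx) = - wt - (J u (vx + wx) - J v vx) + (G u - G v) + \<epsilon> *\<^sub>R (A vxx - vtt)"
    and v: "vt + J v vx = G v"
    and B: "norm vx \<le> B"
    and b: "norm vt \<le> b" "norm vx \<le> b" "norm vxx \<le> b" "norm vtt \<le> b" "norm vtx \<le> b"
  shows "\<epsilon> * \<alpha> * (wt \<bullet> (G u - G v)) + \<epsilon> * \<alpha> * (- G u \<bullet> (vt + wt))
      + \<epsilon>\<^sup>2 * \<alpha> * (vtt \<bullet> wt + vt \<bullet> wtt) - \<epsilon>\<^sup>2 * \<alpha> * (vtx \<bullet> A wx + vt \<bullet> A wxx)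
    \<le> C1 B * ((norm (u - v))\<^sup>2 + \<epsilon>\<^sup>2 * (norm wx)\<^sup>2 + \<epsilon>\<^sup>2 * (norm wt)\<^sup>2 + \<epsilon> * b\<^sup>2)
      + \<epsilon> * (\<alpha> / 4) * (norm wt)\<^sup>2 + \<epsilon> * \<nu> * (norm wx)\<^sup>2" (is "?lhs \<le> _")
proof -
  define X Y Z where "X = norm (u - v)" and "Y = norm wt" and "Z = norm wx"
  note XYZ = this
  have nn: "0 \<le> X" "0 \<le> Y" "0 \<le> Z" "0 \<le> B" "0 \<le> b"
    using B b norm_ge_zero order_trans unfolding XYZ by blast+
  \<comment> \<open>Testing with \<open>vt\<close> produces \<open>vt \<bullet> wtt\<close> and
    \<open>vt \<bullet> A wxx\<close>, which the energy does not control; the equation eliminates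
    them.\<close>
  have vS: "\<epsilon> * (vt \<bullet> wtt) - \<epsilon> * (vt \<bullet> A wxx) =
      vt \<bullet> (- wt - (J u (vx + wx) - J v vx) + (G u - G v) + \<epsilon> *\<^sub>R (A vxx - vtt))"
    unfolding S[symmetric] by (simp add: inner_simps algebra_simps)
  have "?lhs = \<epsilon> * \<alpha> * (wt \<bullet> (G u - G v)) + \<epsilon> * \<alpha> * (- G u \<bullet> (vt + wt)) + \<epsilon>\<^sup>2 * \<alpha> * (vtt \<bullet> wt)
     - \<epsilon>\<^sup>2 * \<alpha> * (vtx \<bullet> A wx) + \<epsilon> * \<alpha> * (\<epsilon> * (vt \<bullet> wtt) - \<epsilon> * (vt \<bullet> A wxx))"
    by (simp add: algebra_simps power2_eq_square)
  \<comment> \<open>All occurrences of \<open>G u\<close> cancel: the test with \<open>wt\<close>,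
    the potential and the test with \<open>vt\<close> leave
    \<open>- ((vt + wt) \<bullet> G v)\<close>.\<close>
  also have "\<dots> = \<epsilon> * \<alpha> * - ((vt + wt) \<bullet> G v) + \<epsilon>\<^sup>2 * \<alpha> * (vtt \<bullet> wt) + \<epsilon>\<^sup>2 * \<alpha> * - (vtx \<bullet> A wx)
     + \<epsilon> * \<alpha> * - (vt \<bullet> wt) + \<epsilon> * \<alpha> * - (vt \<bullet> J u wx) + \<epsilon> * \<alpha> * - (vt \<bullet> (J u vx - J v vx))
     + \<epsilon>\<^sup>2 * \<alpha> * (vt \<bullet> (A vxx - vtt))"
    unfolding vS by (simp add: inner_simps lin_simps algebra_simps power2_eq_square inner_commute)
  also have "\<dots> \<le> \<epsilon> * \<alpha> * ((b + Y) * ((1 + L) * b)) + \<epsilon>\<^sup>2 * \<alpha> * (b * Y) + \<epsilon>\<^sup>2 * \<alpha> * (b * (a\<^sub>1 * Z))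
     + \<epsilon> * \<alpha> * (b * Y) + \<epsilon> * \<alpha> * (b * (L * Z)) + \<epsilon> * \<alpha> * (b * (M * X * B))
     + \<epsilon>\<^sup>2 * \<alpha> * (b * ((a\<^sub>1 + 1) * b))"
    unfolding XYZ using \<epsilon> pos b B
    by (intro add_mono mult_left_mono minus_inner_le inner_le norm_E_le norm_G_le[OF v] A_norm J_norm
        norm_J_diff_le order_trans[OF norm_triangle_ineq]) auto
  also have "\<dots> = \<alpha> * (1 + L) * (\<epsilon> * b\<^sup>2) + \<epsilon> * (\<alpha> * (2 + L) * b * Y) + \<alpha> * ((\<epsilon> * b) * (\<epsilon> * Y))
     + \<alpha> * a\<^sub>1 * ((\<epsilon> * b) * (\<epsilon> * Z)) + \<epsilon> * (\<alpha> * L * b * Z) + \<alpha> * M * B * ((\<epsilon> * b) * X)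
     + \<alpha> * (a\<^sub>1 + 1) * (\<epsilon> * b)\<^sup>2"
    by (simp add: algebra_simps power2_eq_square)
  finally have le: "?lhs \<le> \<dots>" .
  define Q where "Q = X\<^sup>2 + \<epsilon>\<^sup>2 * Z\<^sup>2 + \<epsilon>\<^sup>2 * Y\<^sup>2 + \<epsilon> * b\<^sup>2"
  \<comment> \<open>Terms quadratic in \<open>\<epsilon> * b\<close> are weakened to order
    \<epsilon>, since the source contributes \<open>\<epsilon> * b\<^sup>2\<close> anyway.\<close>
  have eb: "(\<epsilon> * b)\<^sup>2 \<le> \<epsilon> * b\<^sup>2"
  proof -
    have "\<epsilon>\<^sup>2 \<le> \<epsilon>" using \<epsilon> by (simp add: power2_eq_square mult_left_le)
    then show ?thesis unfolding power_mult_distrib by (intro mult_right_mono) auto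
  qed
  have eb0: "0 \<le> \<epsilon> * b\<^sup>2" using \<epsilon> by simp
  have sq: "0 \<le> X\<^sup>2" "0 \<le> \<epsilon>\<^sup>2 * Z\<^sup>2" "0 \<le> \<epsilon>\<^sup>2 * Y\<^sup>2" by auto
  have "0 \<le> Q" unfolding Q_def using sq eb0 by linarith
  have Q: "\<epsilon> * b\<^sup>2 \<le> Q" "(\<epsilon> * b) * (\<epsilon> * Y) \<le> Q" "(\<epsilon> * b) * (\<epsilon> * Z) \<le> Q" "(\<epsilon> * b) * X \<le> Q" "(\<epsilon> * b)\<^sup>2 \<le> Q"
    unfolding Q_def using sq eb eb0 mult_le_sum_squares[of "\<epsilon> * b" "\<epsilon> * Y"] mult_le_sum_squares[of "\<epsilon> * b" "\<epsilon> * Z"]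
      mult_le_sum_squares[of "\<epsilon> * b" X] power_mult_distrib[of \<epsilon> Y 2] power_mult_distrib[of \<epsilon> Z 2] by linarith+
  have s: "\<alpha> * (1 + L) * (\<epsilon> * b\<^sup>2) \<le> \<alpha> * (1 + L) * Q" "\<alpha> * ((\<epsilon> * b) * (\<epsilon> * Y)) \<le> \<alpha> * Q"
    "\<alpha> * a\<^sub>1 * ((\<epsilon> * b) * (\<epsilon> * Z)) \<le> \<alpha> * a\<^sub>1 * Q" "\<alpha> * M * B * ((\<epsilon> * b) * X) \<le> \<alpha> * M * B * Q"
    "\<alpha> * (a\<^sub>1 + 1) * (\<epsilon> * b)\<^sup>2 \<le> \<alpha> * (a\<^sub>1 + 1) * Q"
    "\<alpha> * (2 + L)\<^sup>2 * (\<epsilon> * b\<^sup>2) \<le> \<alpha> * (2 + L)\<^sup>2 * Q" "\<alpha>\<^sup>2 * L\<^sup>2 / \<nu> * (\<epsilon> * b\<^sup>2) \<le> \<alpha>\<^sup>2 * L\<^sup>2 / \<nu> * Q"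
    using Q pos nn by (auto intro!: mult_left_mono divide_right_mono)
  \<comment> \<open>\<open>2 + L\<close> adds the factor \<open>1 + L\<close> of
    \<open>wt \<bullet> G v\<close> and the factor \<open>1\<close> of
    \<open>vt \<bullet> wt\<close>.\<close>
  have y1: "\<epsilon> * (\<alpha> * (2 + L) * b * Y) \<le> \<epsilon> * (\<alpha> / 4) * Y\<^sup>2 + \<alpha> * (2 + L)\<^sup>2 * (\<epsilon> * b\<^sup>2)"
  proof -
    have "(2 + L) * b * Y \<le> Y\<^sup>2 / 4 + (2 + L)\<^sup>2 * b\<^sup>2"
      using zero_le_power2[of "Y / 2 - (2 + L) * b"] by (simp add: power2_eq_square algebra_simps)
    then have "\<epsilon> * \<alpha> * ((2 + L) * b * Y) \<le> \<epsilon> * \<alpha> * (Y\<^sup>2 / 4 + (2 + L)\<^sup>2 * b\<^sup>2)"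
      using \<epsilon> pos by (intro mult_left_mono) auto
    then show ?thesis by (simp add: algebra_simps)
  qed
  have y2: "\<epsilon> * (\<alpha> * L * b * Z) \<le> \<epsilon> * \<nu> * Z\<^sup>2 + \<alpha>\<^sup>2 * L\<^sup>2 / \<nu> * (\<epsilon> * b\<^sup>2)"
  proof -
    define r where "r = \<alpha> * L * b"
    have "r * (\<nu> * Z) \<le> r\<^sup>2 + (\<nu> * Z)\<^sup>2" by (rule mult_le_sum_squares)
    then have "r * Z \<le> \<nu> * Z\<^sup>2 + r\<^sup>2 / \<nu>" using pos by (simp add: field_simps power2_eq_square)
    then have "\<epsilon> * (r * Z) \<le> \<epsilon> * (\<nu> * Z\<^sup>2 + r\<^sup>2 / \<nu>)" using \<epsilon> by (intro mult_left_mono) auto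
    then show ?thesis unfolding r_def power_mult_distrib by (simp add: algebra_simps)
  qed
  have "C1 B * Q = \<alpha> * (1 + L) * Q + \<alpha> * (2 + L)\<^sup>2 * Q + \<alpha>\<^sup>2 * L\<^sup>2 / \<nu> * Q + \<alpha> * Q + \<alpha> * a\<^sub>1 * Q
      + \<alpha> * M * B * Q + \<alpha> * (a\<^sub>1 + 1) * Q"
    unfolding C1_def by (simp only: distrib_right)
  then have "?lhs \<le> C1 B * Q + \<epsilon> * (\<alpha> / 4) * Y\<^sup>2 + \<epsilon> * \<nu> * Z\<^sup>2"
    using le s y1 y2 by linarith
  then show ?thesis unfolding Q_def XYZ .
qed

text \<open>One entry for each of the squares of \<open>u - v\<close>, \<open>wt\<close> and
  \<open>wx\<close>: a quarter of the lower bound \<open>\<beta> / 2\<close> for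
  \<open>etarel\<close>, half of the \<open>\<alpha> / 6\<close> that the cross term leaves, and the
  coercivity of \<open>A\<close>.\<close>

definition c0 :: real where
  "c0 = Min {\<beta> / 8, \<alpha> / 12, \<alpha> * a\<^sub>0 / 2}"

lemma c0: "0 < c0" "c0 \<le> \<beta> / 8" "c0 \<le> \<alpha> / 12" "c0 \<le> \<alpha> * a\<^sub>0 / 2"
  unfolding c0_def using pos by auto

text \<open>Young's inequality with weights \<open>3 / (4 * \<alpha>)\<close> and
  \<open>\<alpha> / 3\<close>, whose product is exactly \<open>1 / 4\<close>, splits the cross term;
  \<open>cocoercive\<close> then charges it to three quarters of \<open>etarel\<close>. The
  Lipschitz bound for \<open>g\<close> combined with \<open>etarel_lower\<close> would lose the
  ratio of \<alpha> to \<beta>. The extra summand with \<open>\<alpha> / 12\<close> is a reserve for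
  the second cross term in \<open>relative_energy_estimate\<close>.\<close>

lemma E0_lower:
  assumes \<epsilon>: "0 < \<epsilon>"
  shows "c0 * ((norm (u - v))\<^sup>2 + \<epsilon>\<^sup>2 * (norm wx)\<^sup>2 + \<epsilon>\<^sup>2 * (norm wt)\<^sup>2) + \<epsilon>\<^sup>2 * (\<alpha> / 12 * (norm wt)\<^sup>2) \<le> E0 \<epsilon> u v wt wx"
proof -
  define P Y where "P = norm (g u - g v)" and "Y = norm wt"
  have "- (\<epsilon> * ((g u - g v) \<bullet> wt)) \<le> \<epsilon> * (P * Y)"
    using mult_left_mono[OF minus_inner_le[OF order_refl order_refl, of "g u - g v" wt], of \<epsilon>] \<epsilon> by (simp add: P_def Y_def)
  also have "\<epsilon> * (P * Y) \<le> 3 / 4 * (P\<^sup>2 / \<alpha>) + \<epsilon>\<^sup>2 * (\<alpha> / 3 * Y\<^sup>2)"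
    using zero_le_power2[of "3 * P - 2 * \<alpha> * \<epsilon> * Y"] pos by (simp add: field_simps power2_eq_square)
  also have "P\<^sup>2 / \<alpha> \<le> etarel u v"
    using cocoercive[of u v] pos by (simp add: P_def divide_le_eq mult.commute)
  finally have 1: "- (\<epsilon> * ((g u - g v) \<bullet> wt)) \<le> 3 / 4 * etarel u v + \<epsilon>\<^sup>2 * (\<alpha> / 3 * Y\<^sup>2)" by simp
  have 2: "c0 * (norm (u - v))\<^sup>2 \<le> etarel u v / 4"
    using mult_right_mono[OF c0(2), of "(norm (u - v))\<^sup>2"] etarel_lower[of u v] by simp
  have "c0 * (norm wx)\<^sup>2 \<le> \<alpha> / 2 * (a\<^sub>0 * (norm wx)\<^sup>2)"
    using mult_right_mono[OF c0(4), of "(norm wx)\<^sup>2"] by simp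
  also have "\<dots> \<le> \<alpha> / 2 * (wx \<bullet> A wx)" using A_lower pos by (intro mult_left_mono) auto
  finally have 3: "\<epsilon>\<^sup>2 * (c0 * (norm wx)\<^sup>2) \<le> \<epsilon>\<^sup>2 * (\<alpha> / 2 * (wx \<bullet> A wx))" by (intro mult_left_mono) auto
  have 4: "\<epsilon>\<^sup>2 * (c0 * Y\<^sup>2) \<le> \<epsilon>\<^sup>2 * (\<alpha> / 12 * Y\<^sup>2)"
    using c0(3) by (intro mult_left_mono mult_right_mono) auto
  have "wt \<bullet> wt = Y\<^sup>2" unfolding Y_def by (simp add: power2_norm_eq_inner)
  then have "E0 \<epsilon> u v wt wx = etarel u v + \<epsilon> * ((g u - g v) \<bullet> wt) + \<epsilon>\<^sup>2 * (\<alpha> / 2 * Y\<^sup>2) + \<epsilon>\<^sup>2 * (\<alpha> / 2 * (wx \<bullet> A wx))"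
    unfolding E0_def by (simp add: algebra_simps)
  moreover have "\<epsilon>\<^sup>2 * (\<alpha> / 2 * Y\<^sup>2) = \<epsilon>\<^sup>2 * (\<alpha> / 3 * Y\<^sup>2) + \<epsilon>\<^sup>2 * (\<alpha> / 12 * Y\<^sup>2) + \<epsilon>\<^sup>2 * (\<alpha> / 12 * Y\<^sup>2)"
    by (simp add: algebra_simps)
  moreover have "c0 * ((norm (u - v))\<^sup>2 + \<epsilon>\<^sup>2 * (norm wx)\<^sup>2 + \<epsilon>\<^sup>2 * Y\<^sup>2)
    = c0 * (norm (u - v))\<^sup>2 + \<epsilon>\<^sup>2 * (c0 * (norm wx)\<^sup>2) + \<epsilon>\<^sup>2 * (c0 * Y\<^sup>2)"
    by (simp add: algebra_simps)
  ultimately show ?thesis using 1 2 3 4 unfolding Y_def[symmetric] by linarith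
qed

lemma E0_upper:
  assumes \<epsilon>: "0 < \<epsilon>"
  shows "E0 \<epsilon> u v wt wx \<le> (2 * \<alpha> + \<alpha> * a\<^sub>1) * ((norm (u - v))\<^sup>2 + \<epsilon>\<^sup>2 * (norm wx)\<^sup>2 + \<epsilon>\<^sup>2 * (norm wt)\<^sup>2)"
proof -
  define X Y Z where "X = norm (u - v)" and "Y = norm wt" and "Z = norm wx"
  note XYZ = this
  have 1: "etarel u v \<le> \<alpha> / 4 * X\<^sup>2" unfolding XYZ by (rule etarel_upper)
  have "\<epsilon> * ((g u - g v) \<bullet> wt) \<le> \<epsilon> * ((\<alpha> / 2 * X) * Y)"
    unfolding XYZ using \<epsilon> by (intro mult_left_mono inner_le g_lip) auto
  also have "\<dots> = \<alpha> / 2 * (X * (\<epsilon> * Y))" by simp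
  also have "\<dots> \<le> \<alpha> / 2 * (X\<^sup>2 + (\<epsilon> * Y)\<^sup>2)"
    using pos mult_le_sum_squares by (intro mult_left_mono) auto
  finally have 2: "\<epsilon> * ((g u - g v) \<bullet> wt) \<le> \<alpha> / 2 * (X\<^sup>2 + (\<epsilon> * Y)\<^sup>2)" .
  have "wx \<bullet> A wx \<le> Z * (a\<^sub>1 * Z)" unfolding XYZ by (intro inner_le A_norm) auto
  then have 3: "\<epsilon>\<^sup>2 * (\<alpha> / 2) * (wt \<bullet> wt + wx \<bullet> A wx) \<le> \<epsilon>\<^sup>2 * (\<alpha> / 2) * (Y\<^sup>2 + Z * (a\<^sub>1 * Z))"
    using pos by (intro mult_left_mono add_mono) (auto simp: XYZ power2_norm_eq_inner)
  have "E0 \<epsilon> u v wt wx \<le> \<alpha> / 4 * X\<^sup>2 + \<alpha> / 2 * (X\<^sup>2 + (\<epsilon> * Y)\<^sup>2) + \<epsilon>\<^sup>2 * (\<alpha> / 2) * (Y\<^sup>2 + Z * (a\<^sub>1 * Z))"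
    unfolding E0_def using 1 2 3 by linarith
  also have "\<dots> = 3 / 4 * (\<alpha> * X\<^sup>2) + \<alpha> * (\<epsilon>\<^sup>2 * Y\<^sup>2) + 1 / 2 * (\<alpha> * a\<^sub>1 * (\<epsilon>\<^sup>2 * Z\<^sup>2))"
    by (simp add: field_simps power2_eq_square)
  also have "\<dots> \<le> (2 * \<alpha> + \<alpha> * a\<^sub>1) * (X\<^sup>2 + \<epsilon>\<^sup>2 * Z\<^sup>2 + \<epsilon>\<^sup>2 * Y\<^sup>2)"
  proof -
    have "0 \<le> \<alpha> * X\<^sup>2" "0 \<le> \<alpha> * (\<epsilon>\<^sup>2 * Y\<^sup>2)" "0 \<le> \<alpha> * (\<epsilon>\<^sup>2 * Z\<^sup>2)" "0 \<le> \<alpha> * a\<^sub>1 * X\<^sup>2"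
      "0 \<le> \<alpha> * a\<^sub>1 * (\<epsilon>\<^sup>2 * Z\<^sup>2)" "0 \<le> \<alpha> * a\<^sub>1 * (\<epsilon>\<^sup>2 * Y\<^sup>2)"
      using pos by auto
    then show ?thesis unfolding distrib_left distrib_right by linarith
  qed
  finally show ?thesis unfolding XYZ .
qed

text \<open>Large enough for both energies: \<open>3 * \<alpha> + \<alpha> * a\<^sub>1\<close> on
  the integrand of \<open>Psi\<close> and \<open>6 * \<alpha> + c0\<close> on the majorant of
  \<open>v\<close> both fit.\<close>

definition C2 :: real where "C2 = 8 * \<alpha> + \<alpha> * a\<^sub>1 + c0"

lemma C2_pos: "0 < C2"
  unfolding C2_def using pos c0(1) by (intro add_nonneg_pos) auto

end

section \<open>Decaying profiles\<close>

text \<open>Bookkeeping for integrability: vector quantities are dominated by a function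
  \<open>sqrt (k x)\<close>, and \<open>dominated_inner\<close> yields the integrable weight
  \<open>k\<close> for scalar densities. The constant never enters an estimate, so it is quantified
  away.\<close>

definition dominated :: "real \<Rightarrow> (real \<Rightarrow> real) \<Rightarrow> (real \<Rightarrow> real \<Rightarrow> 'b::real_normed_vector) \<Rightarrow> bool" where
  "dominated T s f \<longleftrightarrow> (\<exists>c\<ge>0. \<forall>x. \<forall>t\<in>{0..T}. norm (f x t) \<le> c * s x)"

lemma dominatedI:
  assumes "0 \<le> c" "\<And>x t. t \<in> {0..T} \<Longrightarrow> norm (f x t) \<le> c * s x"
  shows "dominated T s f"
  using assms unfolding dominated_def by blast

lemma dominated_by:
  assumes "dominated T s f" "0 \<le> c" "\<And>x t. t \<in> {0..T} \<Longrightarrow> norm (g x t) \<le> c * norm (f x t)"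
  shows "dominated T s g"
proof -
  obtain d where "d \<ge> 0" and d: "\<And>x t. t \<in> {0..T} \<Longrightarrow> norm (f x t) \<le> d * s x"
    using assms(1) unfolding dominated_def by blast
  show ?thesis
  proof (rule dominatedI[of "c * d"])
    fix x t assume t: "t \<in> {0..T}"
    show "norm (g x t) \<le> c * d * s x"
      using order_trans[OF assms(3)[OF t, of x] mult_left_mono[OF d[OF t, of x] assms(2)]] by (simp add: mult.assoc)
  qed (use assms(2) \<open>d \<ge> 0\<close> in auto)
qed

lemma dominated_add:
  assumes "dominated T s f" "dominated T s g"
  shows "dominated T s (\<lambda>x t. f x t + g x t)"
proof -
  obtain c d where "c \<ge> 0" "d \<ge> 0" and c: "\<And>x t. t \<in> {0..T} \<Longrightarrow> norm (f x t) \<le> c * s x"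
    and d: "\<And>x t. t \<in> {0..T} \<Longrightarrow> norm (g x t) \<le> d * s x"
    using assms unfolding dominated_def by blast
  then show ?thesis
    by (intro dominatedI[of "c + d"]) (auto simp: distrib_right intro!: order_trans[OF norm_triangle_ineq] add_mono)
qed

lemma dominated_minus: "dominated T s f \<Longrightarrow> dominated T s (\<lambda>x t. - f x t)"
  by (rule dominated_by[of T s f 1]) auto

lemma dominated_diff:
  "dominated T s f \<Longrightarrow> dominated T s g \<Longrightarrow> dominated T s (\<lambda>x t. f x t - g x t)"
  using dominated_add[OF _ dominated_minus, of T s f g] by simp

lemma dominated_cmult: "dominated T s f \<Longrightarrow> dominated T s (\<lambda>x t. c * f x t)" for c :: real
  by (rule dominated_by[of T s f "\<bar>c\<bar>"]) (auto simp: abs_mult)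

lemma dominated_scaleR: "dominated T s f \<Longrightarrow> dominated T s (\<lambda>x t. c *\<^sub>R f x t)"
  by (rule dominated_by[of T s f "\<bar>c\<bar>"]) auto

lemma dominated_inner:
  fixes f g :: "real \<Rightarrow> real \<Rightarrow> 'b::real_inner"
  assumes "dominated T (\<lambda>x. sqrt (k x)) f" "dominated T (\<lambda>x. sqrt (k x)) g" and k: "\<And>x. 0 \<le> k x"
  shows "dominated T k (\<lambda>x t. f x t \<bullet> g x t)"
proof -
  obtain c d where "c \<ge> 0" "d \<ge> 0" and c: "\<And>x t. t \<in> {0..T} \<Longrightarrow> norm (f x t) \<le> c * sqrt (k x)"
    and d: "\<And>x t. t \<in> {0..T} \<Longrightarrow> norm (g x t) \<le> d * sqrt (k x)"
    using assms unfolding dominated_def by blast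
  show ?thesis
  proof (rule dominatedI[of "c * d"])
    fix x t assume t: "t \<in> {0..T}"
    have "norm (f x t \<bullet> g x t) \<le> norm (f x t) * norm (g x t)" by (simp add: Cauchy_Schwarz_ineq2)
    also have "\<dots> \<le> (c * sqrt (k x)) * (d * sqrt (k x))"
      using c[OF t] d[OF t] \<open>c \<ge> 0\<close> k by (intro mult_mono) auto
    also have "\<dots> = c * d * k x"
      using real_sqrt_mult_self[of "k x"] k[of x] by (simp add: algebra_simps)
    finally show "norm (f x t \<bullet> g x t) \<le> c * d * k x" .
  qed (use \<open>c \<ge> 0\<close> \<open>d \<ge> 0\<close> in auto)
qed

lemma dominated_mono:
  assumes "dominated T s f" "\<And>x. s x \<le> s' x"
  shows "dominated T s' f"
  using assms unfolding dominated_def by (meson mult_left_mono order_trans)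

lemma dominatedD:
  fixes f :: "real \<Rightarrow> real \<Rightarrow> real"
  assumes "dominated T s f" "integrable lborel s"
  obtains k where "integrable lborel k" "\<And>x t. t \<in> {0..T} \<Longrightarrow> \<bar>f x t\<bar> \<le> k x"
proof -
  obtain c where "\<And>x t. t \<in> {0..T} \<Longrightarrow> norm (f x t) \<le> c * s x"
    using assms(1) unfolding dominated_def by blast
  then show thesis using that[of "\<lambda>x. c * s x"] assms(2) by auto
qed

lemma dominated_integrable:
  fixes f :: "real \<Rightarrow> real \<Rightarrow> real"
  assumes "dominated T s f" "integrable lborel s" "t \<in> {0..T}" "continuous_on UNIV (\<lambda>x. f x t)"
  shows "integrable lborel (\<lambda>x. f x t)"
proof -
  obtain k where k: "integrable lborel k" "\<And>x t. t \<in> {0..T} \<Longrightarrow> \<bar>f x t\<bar> \<le> k x"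
    using dominatedD[OF assms(1,2)] by blast
  have "(\<lambda>x. f x t) \<in> borel_measurable lborel"
    using assms(4) borel_measurable_continuous_onI by simp
  then show ?thesis
    by (rule Bochner_Integration.integrable_bound[OF k(1)]) (use k(2)[OF assms(3)] order_trans[OF _ abs_ge_self] in auto)
qed

text \<open>Comparability turns the bound \<open>D * W\<close> into \<open>D / c\<close> times the
  energy, the rate in Gronwall's lemma, and costs the factor \<open>C / c\<close> in passing between
  \<open>W\<close> and \<open>e\<close>. As \<open>W\<close> may contain time-independent forcing,
  the inequality can be homogeneous.\<close>

lemma weighted_energy_estimate:
  fixes e e' \<phi> \<phi>' W :: "real \<Rightarrow> real \<Rightarrow> real"
  assumes T: "0 < T"
    and e: "\<And>x t. t \<in> {0..T} \<Longrightarrow> ((\<lambda>s. e x s) has_vector_derivative e' x t) (at t within {0..T})"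
    and ei: "\<And>t. t \<in> {0..T} \<Longrightarrow> integrable lborel (\<lambda>x. e x t)"
    and k: "integrable lborel k" "dominated T k e'" "dominated T k \<phi>'"
    and \<phi>: "\<And>x t. t \<in> {0..T} \<Longrightarrow> ((\<lambda>z. \<phi> z t) has_vector_derivative \<phi>' x t) (at x)"
    and lim: "\<And>t. t \<in> {0..T} \<Longrightarrow> ((\<lambda>x. \<phi> x t) \<longlongrightarrow> 0) at_infinity"
    and W: "\<And>t. t \<in> {0..T} \<Longrightarrow> integrable lborel (\<lambda>x. W x t)"
      "\<And>x t. t \<in> {0..T} \<Longrightarrow> 0 \<le> W x t"
      "\<And>x t. t \<in> {0..T} \<Longrightarrow> c * W x t \<le> e x t"
      "\<And>x t. t \<in> {0..T} \<Longrightarrow> e x t \<le> C * W x t"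
      "\<And>x t. t \<in> {0..T} \<Longrightarrow> e' x t + \<phi>' x t \<le> D * W x t"
    and pos: "0 < c" "0 < C" "0 < D"
    and t: "t \<in> {0..T}"
  shows "(\<integral>x. W x t \<partial>lborel) \<le> C / c * exp (D / c * T) * (\<integral>x. W x 0 \<partial>lborel)"
proof -
  obtain ke where ke: "integrable lborel ke" "\<And>x t. t \<in> {0..T} \<Longrightarrow> \<bar>e' x t\<bar> \<le> ke x"
    using dominatedD[OF k(2,1)] by blast
  obtain kp where kp: "integrable lborel kp" "\<And>x t. t \<in> {0..T} \<Longrightarrow> \<bar>\<phi>' x t\<bar> \<le> kp x"
    using dominatedD[OF k(3,1)] by blast
  have t0: "0 \<in> {0..T}" using T by auto
  have W0: "0 \<le> (\<integral>x. W x 0 \<partial>lborel)"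
    using W(2)[OF t0] by (intro integral_nonneg_AE) auto
  have ineq: "e' x t + \<phi>' x t \<le> D / c * e x t" if t: "t \<in> {0..T}" for x t
  proof -
    have "e' x t + \<phi>' x t \<le> D / c * (c * W x t)" using W(5)[OF t, of x] pos by simp
    also have "\<dots> \<le> D / c * e x t" using W(3)[OF t] pos by (intro mult_left_mono) auto
    finally show ?thesis .
  qed
  have "c * (\<integral>x. W x t \<partial>lborel) = (\<integral>x. c * W x t \<partial>lborel)" by simp
  also have "\<dots> \<le> (\<integral>x. e x t \<partial>lborel)"
    using W[OF t] ei[OF t] by (intro integral_mono) auto
  also have "\<dots> \<le> exp (D / c * t) * (\<integral>x. e x 0 \<partial>lborel)"
    by (rule energy_estimate[OF T e ei ke \<phi> kp lim ineq t])
  also have "\<dots> \<le> exp (D / c * t) * (\<integral>x. C * W x 0 \<partial>lborel)"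
    using W[OF t0] ei[OF t0] by (intro mult_left_mono integral_mono) auto
  also have "\<dots> \<le> exp (D / c * T) * (\<integral>x. C * W x 0 \<partial>lborel)"
    using t W0 pos by (intro mult_right_mono) (auto intro!: divide_right_mono mult_left_mono)
  also have "\<dots> = c * (C / c * exp (D / c * T) * (\<integral>x. W x 0 \<partial>lborel))"
    using pos by simp
  finally show ?thesis using pos by (simp only: mult_le_cancel_left_pos)
qed

text \<open>All derivatives are parameters, so that the difference of two profiles is a profile with
  the differences as derivatives. \<open>utx\<close> is at once the \<open>t\<close>-derivative of
  \<open>ux\<close> and the \<open>x\<close>-derivative of \<open>ut\<close>, as the energy and the
  flux require.\<close>

locale profile =
  fixes T :: real and u ut ux utt utx uxx :: "real \<Rightarrow> real \<Rightarrow> 'a::euclidean_space" and h :: "real \<Rightarrow> real"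
  assumes deriv_t: "\<And>x t. t \<in> {0..T} \<Longrightarrow> ((\<lambda>s. u x s) has_vector_derivative ut x t) (at t within {0..T})"
      "\<And>x t. t \<in> {0..T} \<Longrightarrow> ((\<lambda>s. ut x s) has_vector_derivative utt x t) (at t within {0..T})"
      "\<And>x t. t \<in> {0..T} \<Longrightarrow> ((\<lambda>s. ux x s) has_vector_derivative utx x t) (at t within {0..T})"
    and deriv_x: "\<And>x t. t \<in> {0..T} \<Longrightarrow> ((\<lambda>z. u z t) has_vector_derivative ux x t) (at x)"
      "\<And>x t. t \<in> {0..T} \<Longrightarrow> ((\<lambda>z. ut z t) has_vector_derivative utx x t) (at x)"
      "\<And>x t. t \<in> {0..T} \<Longrightarrow> ((\<lambda>z. ux z t) has_vector_derivative uxx x t) (at x)"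
    and lim: "\<And>t. t \<in> {0..T} \<Longrightarrow> ((\<lambda>x. u x t) \<longlongrightarrow> 0) at_infinity"
      "\<And>t. t \<in> {0..T} \<Longrightarrow> ((\<lambda>x. ut x t) \<longlongrightarrow> 0) at_infinity"
      "\<And>t. t \<in> {0..T} \<Longrightarrow> ((\<lambda>x. ux x t) \<longlongrightarrow> 0) at_infinity"
    and h: "integrable lborel h"
    and le: "\<And>x t. t \<in> {0..T} \<Longrightarrow> (norm (u x t))\<^sup>2 \<le> h x"
      "\<And>x t. t \<in> {0..T} \<Longrightarrow> (norm (ut x t))\<^sup>2 \<le> h x"
      "\<And>x t. t \<in> {0..T} \<Longrightarrow> (norm (ux x t))\<^sup>2 \<le> h x"
      "\<And>x t. t \<in> {0..T} \<Longrightarrow> (norm (utt x t))\<^sup>2 \<le> h x"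
      "\<And>x t. t \<in> {0..T} \<Longrightarrow> (norm (utx x t))\<^sup>2 \<le> h x"
      "\<And>x t. t \<in> {0..T} \<Longrightarrow> (norm (uxx x t))\<^sup>2 \<le> h x"
    and T: "0 < T"
begin

lemma h_nonneg: "0 \<le> h x"
  using le(1)[of 0 x] T order_trans[OF zero_le_power2] by auto

lemma le_sqrt:
  assumes "t \<in> {0..T}"
  shows "norm (u x t) \<le> sqrt (h x)" "norm (ut x t) \<le> sqrt (h x)" "norm (ux x t) \<le> sqrt (h x)"
    "norm (utt x t) \<le> sqrt (h x)" "norm (utx x t) \<le> sqrt (h x)" "norm (uxx x t) \<le> sqrt (h x)"
  using le[OF assms, of x] by (auto intro!: real_le_rsqrt)

lemma dominated_profile:
  "dominated T (\<lambda>x. sqrt (h x)) u" "dominated T (\<lambda>x. sqrt (h x)) ut" "dominated T (\<lambda>x. sqrt (h x)) ux"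
  "dominated T (\<lambda>x. sqrt (h x)) utt" "dominated T (\<lambda>x. sqrt (h x)) utx" "dominated T (\<lambda>x. sqrt (h x)) uxx"
  using le_sqrt by (auto intro!: dominatedI[of 1])

lemma continuous_x:
  assumes "t \<in> {0..T}"
  shows "continuous_on S (\<lambda>x. u x t)" "continuous_on S (\<lambda>x. ut x t)" "continuous_on S (\<lambda>x. ux x t)"
  using deriv_x[OF assms] by (meson continuous_at_imp_continuous_on has_vector_derivative_continuous)+

end

lemma profile_diff:
  assumes "profile T u ut ux utt utx uxx h" "profile T v vt vx vtt vtx vxx k"
  shows "profile T (\<lambda>x t. u x t - v x t) (\<lambda>x t. ut x t - vt x t) (\<lambda>x t. ux x t - vx x t)
    (\<lambda>x t. utt x t - vtt x t) (\<lambda>x t. utx x t - vtx x t) (\<lambda>x t. uxx x t - vxx x t) (\<lambda>x. 2 * (h x + k x))"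
proof -
  interpret u: profile T u ut ux utt utx uxx h by fact
  interpret v: profile T v vt vx vtt vtx vxx k by fact
  have sq: "(norm (a - b))\<^sup>2 \<le> 2 * (c + d)" if "(norm a)\<^sup>2 \<le> c" "(norm b)\<^sup>2 \<le> d" for a b :: 'a and c d
  proof -
    have "(norm (a - b))\<^sup>2 \<le> (norm a + norm b)\<^sup>2"
      by (intro power_mono norm_triangle_ineq4) auto
    also have "\<dots> \<le> 2 * ((norm a)\<^sup>2 + (norm b)\<^sup>2)"
      using zero_le_power2[of "norm a - norm b"] by (simp add: power2_sum power2_diff)
    also have "\<dots> \<le> 2 * (c + d)" using that by (intro mult_left_mono add_mono) auto
    finally show ?thesis .
  qed
  show ?thesis
    using u.T u.h v.h
    by unfold_locales
      (auto intro!: has_vector_derivative_diff u.deriv_t v.deriv_t u.deriv_x v.deriv_x sq u.le v.le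
        tendsto_eq_intros u.lim v.lim simp del: distrib_left_numeral)
qed

lemma has_vector_derivative_chain:
  fixes f :: "'a::real_normed_vector \<Rightarrow> 'b::real_normed_vector"
  assumes "(f has_derivative D) (at (u t))" "(u has_vector_derivative u') (at t within S)"
  shows "((\<lambda>s. f (u s)) has_vector_derivative D u') (at t within S)"
proof -
  have "((\<lambda>s. f (u s)) has_derivative (\<lambda>h. D (h *\<^sub>R u'))) (at t within S)"
    using has_derivative_compose[OF assms(2)[unfolded has_vector_derivative_def] assms(1)] .
  moreover have "D (h *\<^sub>R u') = h *\<^sub>R D u'" for h
    using has_derivative_linear[OF assms(1)] by (simp add: linear_scale)
  ultimately show ?thesis unfolding has_vector_derivative_def by simp
qed

lemmas has_vector_derivative_inner = bounded_bilinear.has_vector_derivative[OF bounded_bilinear_inner]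

context entropy_structure
begin

lemma A_has_vector_derivative:
  "(f has_vector_derivative f') (at t within S) \<Longrightarrow> ((\<lambda>s. A (f s)) has_vector_derivative A f') (at t within S)"
  using bounded_linear.has_vector_derivative[OF A_linear] .

lemma E0_has_vector_derivative:
  assumes "(v has_vector_derivative vt) (at t within S)" "(w has_vector_derivative wt t) (at t within S)"
    "(wt has_vector_derivative wtt) (at t within S)" "(wx has_vector_derivative wtx) (at t within S)"
  shows "((\<lambda>s. E0 \<epsilon> (v s + w s) (v s) (wt s) (wx s)) has_vector_derivative
    E0' \<epsilon> (v t + w t) (v t) vt (wt t) (wx t) wtt wtx) (at t within S)"
proof -
  note u = has_vector_derivative_add[OF assms(1,2)]
  show ?thesis
    unfolding E0_def etarel_def
    apply (rule has_vector_derivative_eq_rhs)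
     apply (rule has_vector_derivative_add has_vector_derivative_diff has_vector_derivative_mult_right
        has_vector_derivative_inner has_vector_derivative_chain[OF \<eta>_deriv] has_vector_derivative_chain[OF g_deriv]
        A_has_vector_derivative assms u)+
    \<comment> \<open>Symmetry of \<open>A\<close> merges the two halves of the derivative of
      \<open>wx \<bullet> A wx\<close>.\<close>
    unfolding E0'_def using A_sym[of wtx "wx t"]
    apply (simp add: inner_simps lin_simps algebra_simps inner_commute)
    done
qed

lemma \<Phi>0_has_vector_derivative:
  assumes "(v has_vector_derivative vx) (at x)" "(w has_vector_derivative wx x) (at x)"
    "(wt has_vector_derivative wtx) (at x)" "(wx has_vector_derivative wxx) (at x)"
  shows "((\<lambda>z. \<Phi>0 \<epsilon> (v z + w z) (v z) (wt z) (wx z)) has_vector_derivative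
    \<Phi>0' \<epsilon> (v x + w x) (v x) vx (wt x) (wx x) wtx wxx) (at x)"
proof -
  note u = has_vector_derivative_add[OF assms(1,2)]
  show ?thesis
    unfolding \<Phi>0_def
    apply (rule has_vector_derivative_eq_rhs)
     apply (rule has_vector_derivative_add has_vector_derivative_diff has_vector_derivative_mult_right
        has_vector_derivative_inner has_vector_derivative_chain[OF q_deriv] has_vector_derivative_chain[OF g_deriv]
        has_vector_derivative_chain[OF F_deriv] A_has_vector_derivative assms u)+
    unfolding \<Phi>0'_def
    apply (simp add: inner_simps lin_simps algebra_simps inner_commute)
    done
qed

end

section \<open>The relative energy estimates\<close>

text \<open>\<open>w_eq\<close> is the difference of the two evolution equations, in which
  \<open>v\<close> leaves the residual \<open>\<epsilon> (A vxx - vtt)\<close>. \<open>B\<close> and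
  \<open>hv\<close> describe \<open>v\<close> alone and enter the final bounds, whereas
  \<open>hw\<close> depends on the relaxation solution and only serves integrability.\<close>

locale relaxation_pair =
  entropy_structure \<eta> q R g F G A H J \<alpha> \<beta> \<nu> M L a\<^sub>0 a\<^sub>1 +
  v: profile T v vt vx vtt vtx vxx hv + w: profile T w wt wx wtt wtx wxx hw
  for \<eta> q R :: "'a::euclidean_space \<Rightarrow> real"
    and g F G A :: "'a \<Rightarrow> 'a" and H J :: "'a \<Rightarrow> 'a \<Rightarrow> 'a"
    and \<alpha> \<beta> \<nu> M L a\<^sub>0 a\<^sub>1 T :: real
    and v vt vx vtt vtx vxx :: "real \<Rightarrow> real \<Rightarrow> 'a" and hv :: "real \<Rightarrow> real"
    and w wt wx wtt wtx wxx :: "real \<Rightarrow> real \<Rightarrow> 'a" and hw :: "real \<Rightarrow> real" +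
  fixes \<epsilon> B :: real
  assumes \<epsilon>: "0 < \<epsilon>" "\<epsilon> \<le> 1"
    and w_eq: "\<And>x t. t \<in> {0..T} \<Longrightarrow> \<epsilon> *\<^sub>R (wtt x t - A (wxx x t)) =
      - wt x t - (J (v x t + w x t) (vx x t + wx x t) - J (v x t) (vx x t)) + (G (v x t + w x t) - G (v x t))
      + \<epsilon> *\<^sub>R (A (vxx x t) - vtt x t)"
    and v_eq: "\<And>x t. t \<in> {0..T} \<Longrightarrow> vt x t + J (v x t) (vx x t) = G (v x t)"
    and B: "\<And>x t. t \<in> {0..T} \<Longrightarrow> norm (vt x t) \<le> B" "\<And>x t. t \<in> {0..T} \<Longrightarrow> norm (vx x t) \<le> B"
    and R_integrable: "\<And>t. t \<in> {0..T} \<Longrightarrow> integrable lborel (\<lambda>x. R (v x t + w x t))"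
begin

lemma B_nonneg: "0 \<le> B"
  using order_trans[OF norm_ge_zero B(1)[of 0 0]] w.T by simp

definition Y :: "real \<Rightarrow> real \<Rightarrow> real" where
  "Y x t = (norm (w x t))\<^sup>2 + \<epsilon>\<^sup>2 * (norm (wx x t))\<^sup>2 + \<epsilon>\<^sup>2 * (norm (wt x t))\<^sup>2"

section \<open>Integrable majorants for the energy and flux densities\<close>

definition k where "k x = hv x + hw x"

lemma k: "0 \<le> k x" "integrable lborel k" "hv x \<le> k x" "hw x \<le> k x"
  using v.h_nonneg w.h_nonneg v.h w.h unfolding k_def by auto

lemma dominated_vw:
  "dominated T (\<lambda>x. sqrt (k x)) v" "dominated T (\<lambda>x. sqrt (k x)) vt" "dominated T (\<lambda>x. sqrt (k x)) vx"
  "dominated T (\<lambda>x. sqrt (k x)) vtt" "dominated T (\<lambda>x. sqrt (k x)) vtx" "dominated T (\<lambda>x. sqrt (k x)) vxx"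
  "dominated T (\<lambda>x. sqrt (k x)) w" "dominated T (\<lambda>x. sqrt (k x)) wt" "dominated T (\<lambda>x. sqrt (k x)) wx"
  "dominated T (\<lambda>x. sqrt (k x)) wtt" "dominated T (\<lambda>x. sqrt (k x)) wtx" "dominated T (\<lambda>x. sqrt (k x)) wxx"
proof -
  have "sqrt (hv x) \<le> sqrt (k x)" "sqrt (hw x) \<le> sqrt (k x)" for x
    by (auto intro!: real_sqrt_le_mono simp: k)
  note * = v.dominated_profile[THEN dominated_mono, OF this(1)] w.dominated_profile[THEN dominated_mono, OF this(2)]
  show "dominated T (\<lambda>x. sqrt (k x)) v" "dominated T (\<lambda>x. sqrt (k x)) vt" "dominated T (\<lambda>x. sqrt (k x)) vx"
    "dominated T (\<lambda>x. sqrt (k x)) vtt" "dominated T (\<lambda>x. sqrt (k x)) vtx" "dominated T (\<lambda>x. sqrt (k x)) vxx"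
    "dominated T (\<lambda>x. sqrt (k x)) w" "dominated T (\<lambda>x. sqrt (k x)) wt" "dominated T (\<lambda>x. sqrt (k x)) wx"
    "dominated T (\<lambda>x. sqrt (k x)) wtt" "dominated T (\<lambda>x. sqrt (k x)) wtx" "dominated T (\<lambda>x. sqrt (k x)) wxx"
    by (fact *)+
qed

lemma dominated_A: "dominated T (\<lambda>x. sqrt (k x)) f \<Longrightarrow> dominated T (\<lambda>x. sqrt (k x)) (\<lambda>x t. A (f x t))"
  by (rule dominated_by[of _ _ f a\<^sub>1]) (use pos A_norm in auto)

lemma dominated_H: "dominated T (\<lambda>x. sqrt (k x)) f \<Longrightarrow> dominated T (\<lambda>x. sqrt (k x)) (\<lambda>x t. H (c x t) (f x t))"
  by (rule dominated_by[of _ _ f "\<alpha> / 2"]) (use pos H_norm in auto)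

lemma dominated_J: "dominated T (\<lambda>x. sqrt (k x)) f \<Longrightarrow> dominated T (\<lambda>x. sqrt (k x)) (\<lambda>x t. J (c x t) (f x t))"
  by (rule dominated_by[of _ _ f L]) (use pos J_norm in auto)

lemma dominated_g_diff: "dominated T (\<lambda>x. sqrt (k x)) (\<lambda>x t. g (v x t + w x t) - g (v x t))"
  by (rule dominated_by[OF dominated_vw(7), of "\<alpha> / 2"]) (use pos g_lip[of "v x t + w x t" "v x t" for x t] in auto)

lemma dominated_F_diff: "dominated T (\<lambda>x. sqrt (k x)) (\<lambda>x t. F (v x t + w x t) - F (v x t))"
  by (rule dominated_by[OF dominated_vw(7), of L]) (use pos F_lip[of "v x t + w x t" "v x t" for x t] in auto)

lemma dominated_cong:
  assumes "dominated T s f" "\<And>x t. t \<in> {0..T} \<Longrightarrow> f x t = f' x t"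
  shows "dominated T s f'"
  using assms unfolding dominated_def by auto

lemmas dominated_intros = dominated_vw dominated_g_diff dominated_F_diff k(1) dominated_add dominated_diff
  dominated_cmult dominated_scaleR dominated_minus dominated_inner dominated_A dominated_H dominated_J

text \<open>\<open>G\<close> is merely continuous, so its decay along \<open>v\<close> cannot be
  read off from that of \<open>v\<close>; the balance law expresses it by first derivatives.\<close>

lemma dominated_G_v: "dominated T (\<lambda>x. sqrt (k x)) (\<lambda>x t. G (v x t))"
  by (rule dominated_cong[where f="\<lambda>x t. vt x t + J (v x t) (vx x t)"]) ((rule dominated_intros)+, rule v_eq)

text \<open>Likewise the equation for \<open>w\<close> expresses the difference by derivatives of
  \<open>v\<close> and \<open>w\<close>. Second derivatives are admissible, as the bound is purely
  qualitative.\<close>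

lemma dominated_G_diff: "dominated T (\<lambda>x. sqrt (k x)) (\<lambda>x t. G (v x t + w x t) - G (v x t))"
proof (rule dominated_cong)
  show "dominated T (\<lambda>x. sqrt (k x)) (\<lambda>x t. \<epsilon> *\<^sub>R (wtt x t - A (wxx x t)) + wt x t
    + (J (v x t + w x t) (vx x t + wx x t) - J (v x t) (vx x t)) - \<epsilon> *\<^sub>R (A (vxx x t) - vtt x t))"
    by (rule dominated_intros)+
qed (simp add: w_eq)

lemma dominated_E0': "dominated T k (\<lambda>x t. E0' \<epsilon> (v x t + w x t) (v x t) (vt x t) (wt x t) (wx x t) (wtt x t) (wtx x t))"
  unfolding E0'_def by (simp only: add_diff_cancel_left' mult.assoc) (rule dominated_intros)+

lemma dominated_\<Phi>0': "dominated T k (\<lambda>x t. \<Phi>0' \<epsilon> (v x t + w x t) (v x t) (vx x t) (wt x t) (wx x t) (wtx x t) (wxx x t))"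
  unfolding \<Phi>0'_def by (simp only: mult.assoc) (rule dominated_intros)+

lemma Y_nonneg: "0 \<le> Y x t"
  unfolding Y_def by simp

lemma dominated_Y: "dominated T k Y"
proof -
  have "Y = (\<lambda>x t. w x t \<bullet> w x t + \<epsilon>\<^sup>2 * (wx x t \<bullet> wx x t) + \<epsilon>\<^sup>2 * (wt x t \<bullet> wt x t))"
    by (auto simp: Y_def power2_norm_eq_inner fun_eq_iff)
  then show ?thesis by (simp only:) (rule dominated_intros)+
qed

lemma Y_integrable: "t \<in> {0..T} \<Longrightarrow> integrable lborel (\<lambda>x. Y x t)"
  by (rule dominated_integrable[OF dominated_Y k(2)])
    (auto simp: Y_def intro!: continuous_intros w.continuous_x)

lemma E0_pair_lower:
  "c0 * Y x t + \<epsilon>\<^sup>2 * (\<alpha> / 12 * (norm (wt x t))\<^sup>2) \<le> E0 \<epsilon> (v x t + w x t) (v x t) (wt x t) (wx x t)"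
  using E0_lower[OF \<epsilon>(1), of "v x t + w x t" "v x t" "wx x t" "wt x t"] unfolding Y_def by simp

lemma E0_pair_upper:
  "E0 \<epsilon> (v x t + w x t) (v x t) (wt x t) (wx x t) \<le> (2 * \<alpha> + \<alpha> * a\<^sub>1) * Y x t"
  using E0_upper[OF \<epsilon>(1), of "v x t + w x t" "v x t" "wt x t" "wx x t"] unfolding Y_def by simp

lemma E0_pair_integrable:
  assumes t: "t \<in> {0..T}"
  shows "integrable lborel (\<lambda>x. E0 \<epsilon> (v x t + w x t) (v x t) (wt x t) (wx x t))"
proof (rule dominated_integrable[OF _ k(2) t])
  show "dominated T k (\<lambda>x t. E0 \<epsilon> (v x t + w x t) (v x t) (wt x t) (wx x t))"
  proof (rule dominated_by[OF dominated_Y])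
    fix x t
    have "0 \<le> E0 \<epsilon> (v x t + w x t) (v x t) (wt x t) (wx x t)"
    proof -
      have "0 \<le> c0 * Y x t + \<epsilon>\<^sup>2 * (\<alpha> / 12 * (norm (wt x t))\<^sup>2)" using c0(1) pos Y_nonneg by auto
      then show ?thesis using E0_pair_lower[of x t] by linarith
    qed
    then show "norm (E0 \<epsilon> (v x t + w x t) (v x t) (wt x t) (wx x t)) \<le> (2 * \<alpha> + \<alpha> * a\<^sub>1) * norm (Y x t)"
      using E0_pair_upper[of x t] Y_nonneg[of x t] by simp
  qed (use pos in auto)
  have c: "continuous_on UNIV \<eta>" "continuous_on UNIV g" "continuous_on UNIV A"
    using \<eta>_deriv g_deriv linear_continuous_on[OF A_linear]
    by (auto intro!: continuous_at_imp_continuous_on has_derivative_continuous)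
  show "continuous_on UNIV (\<lambda>x. E0 \<epsilon> (v x t + w x t) (v x t) (wt x t) (wx x t))"
    unfolding E0_def etarel_def
    by (intro continuous_intros v.continuous_x w.continuous_x t continuous_on_compose2[OF c(1)]
        continuous_on_compose2[OF c(2)] continuous_on_compose2[OF c(3)]) auto
qed

lemma \<Phi>0_lim:
  assumes t: "t \<in> {0..T}"
  shows "((\<lambda>x. \<Phi>0 \<epsilon> (v x t + w x t) (v x t) (wt x t) (wx x t)) \<longlongrightarrow> 0) at_infinity"
proof -
  have u: "((\<lambda>x. v x t + w x t) \<longlongrightarrow> 0) at_infinity"
    using tendsto_add[OF v.lim(1)[OF t] w.lim(1)[OF t]] by simp
  have c: "isCont q 0" "isCont g 0" "isCont F 0" "isCont A 0"
    using q_deriv g_deriv F_deriv linear_continuous_at[OF A_linear]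
    by (auto intro!: has_derivative_continuous)
  note [tendsto_intros] = isCont_tendsto_compose[OF c(1)] isCont_tendsto_compose[OF c(2)] isCont_tendsto_compose[OF c(3)]
    isCont_tendsto_compose[OF c(4)]
  have "((\<lambda>x. \<Phi>0 \<epsilon> (v x t + w x t) (v x t) (wt x t) (wx x t)) \<longlongrightarrow>
    q 0 - q 0 - g 0 \<bullet> (F 0 - F 0) - \<epsilon> * ((g 0 - g 0) \<bullet> A 0) - \<epsilon>\<^sup>2 * \<alpha> * (0 \<bullet> A 0)) at_infinity"
    unfolding \<Phi>0_def by (intro tendsto_intros u v.lim w.lim t)
  then show ?thesis by simp
qed

lemma R_has_vector_derivative:
  "t \<in> {0..T} \<Longrightarrow> ((\<lambda>s. R (v x s + w x s)) has_vector_derivative - G (v x t + w x t) \<bullet> (vt x t + wt x t)) (at t within {0..T})"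
  by (rule has_vector_derivative_chain[OF R_deriv has_vector_derivative_add[OF v.deriv_t(1) w.deriv_t(1)]])

text \<open>Testing with \<open>u\<^sub>t\<close> instead of \<open>w\<^sub>t\<close> adds the
  indefinite term \<open>\<epsilon>\<^sup>2 * \<alpha> * (vt \<bullet> wt)\<close> to the energy. It
  is absorbed by the reserve in \<open>E0_lower\<close> and a multiple of
  \<open>\<epsilon> * hv\<close>. Since \<open>hv\<close> does not depend on \<open>t\<close>,
  adding it leaves \<open>e'\<close> unchanged, and forcing of order \<epsilon> becomes a multiple
  of \<open>W\<close>.\<close>

proposition relative_energy_estimate:
  assumes t: "t \<in> {0..T}"
  shows "(\<integral>x. Y x t \<partial>lborel) + \<epsilon> * (\<integral>x. R (v x t + w x t) \<partial>lborel) \<le>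
    C2 / c0 * exp ((C0 B + C1 B) / c0 * T) * ((\<integral>x. Y x 0 \<partial>lborel) + \<epsilon> * (\<integral>x. R (v x 0 + w x 0) \<partial>lborel) + \<epsilon> * (\<integral>x. hv x \<partial>lborel))"
proof -
  define e where "e x t = E0 \<epsilon> (v x t + w x t) (v x t) (wt x t) (wx x t) + \<epsilon> * \<alpha> * R (v x t + w x t)
    + \<epsilon>\<^sup>2 * \<alpha> * (vt x t \<bullet> wt x t) + (3 * \<alpha> + c0) * \<epsilon> * hv x" for x t
  define e' where "e' x t = E0' \<epsilon> (v x t + w x t) (v x t) (vt x t) (wt x t) (wx x t) (wtt x t) (wtx x t)
    + \<epsilon> * \<alpha> * (- G (v x t + w x t) \<bullet> (vt x t + wt x t)) + \<epsilon>\<^sup>2 * \<alpha> * (vt x t \<bullet> wtt x t + vtt x t \<bullet> wt x t)" for x t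
  define \<phi> where "\<phi> x t = \<Phi>0 \<epsilon> (v x t + w x t) (v x t) (wt x t) (wx x t) - \<epsilon>\<^sup>2 * \<alpha> * (vt x t \<bullet> A (wx x t))" for x t
  define \<phi>' where "\<phi>' x t = \<Phi>0' \<epsilon> (v x t + w x t) (v x t) (vx x t) (wt x t) (wx x t) (wtx x t) (wxx x t)
    - \<epsilon>\<^sup>2 * \<alpha> * (vt x t \<bullet> A (wxx x t) + vtx x t \<bullet> A (wx x t))" for x t
  define W where "W x t = Y x t + \<epsilon> * R (v x t + w x t) + \<epsilon> * hv x" for x t
  have \<epsilon>2: "\<epsilon>\<^sup>2 \<le> \<epsilon>" using \<epsilon> by (simp add: power2_eq_square mult_left_le)
  have \<epsilon>2h: "\<epsilon>\<^sup>2 * hv x \<le> \<epsilon> * hv x" for x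
    using \<epsilon>2 v.h_nonneg by (intro mult_right_mono) auto
  have cross: "\<bar>\<epsilon>\<^sup>2 * \<alpha> * (vt x t \<bullet> wt x t)\<bar> \<le> \<epsilon>\<^sup>2 * (\<alpha> / 12 * (norm (wt x t))\<^sup>2) + 3 * \<alpha> * \<epsilon> * hv x"
    if t: "t \<in> {0..T}" for x t
  proof -
    define b where "b = sqrt (hv x)"
    have b2: "b\<^sup>2 = hv x" unfolding b_def using v.h_nonneg by simp
    have "\<bar>vt x t \<bullet> wt x t\<bar> \<le> b * norm (wt x t)"
      using v.le_sqrt(2)[OF t, of x] unfolding b_def
      by (rule order_trans[OF Cauchy_Schwarz_ineq2 mult_right_mono]) auto
    \<comment> \<open>The weight \<open>1 / 12\<close> matches the reserve in
      \<open>E0_lower\<close>; its price \<open>3\<close> is the origin of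
      \<open>3 * \<alpha>\<close> in \<open>e\<close>.\<close>
    also have "\<dots> \<le> (norm (wt x t))\<^sup>2 / 12 + 3 * b\<^sup>2"
      using zero_le_power2[of "norm (wt x t) - 6 * b"] by (simp add: power2_diff field_simps power2_eq_square)
    finally have "\<epsilon>\<^sup>2 * \<alpha> * \<bar>vt x t \<bullet> wt x t\<bar> \<le> \<epsilon>\<^sup>2 * \<alpha> * ((norm (wt x t))\<^sup>2 / 12 + 3 * hv x)"
      unfolding b2 using pos by (intro mult_left_mono) auto
    also have "\<dots> = \<epsilon>\<^sup>2 * (\<alpha> / 12 * (norm (wt x t))\<^sup>2) + 3 * \<alpha> * (\<epsilon>\<^sup>2 * hv x)"
      by (simp add: algebra_simps)
    also have "\<dots> \<le> \<epsilon>\<^sup>2 * (\<alpha> / 12 * (norm (wt x t))\<^sup>2) + 3 * \<alpha> * (\<epsilon> * hv x)"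
      using \<epsilon>2h pos by (intro add_left_mono mult_left_mono) auto
    finally show ?thesis using pos by (simp add: abs_mult mult.assoc)
  qed
  have lower: "c0 * W x t \<le> e x t" if t: "t \<in> {0..T}" for x t
  proof -
    have "c0 * (\<epsilon> * R (v x t + w x t)) \<le> \<alpha> * (\<epsilon> * R (v x t + w x t))"
      using c0(1,3) pos \<epsilon> R_nonneg by (intro mult_right_mono) auto
    then show ?thesis
      using E0_pair_lower[of x t] cross[OF t, of x] unfolding W_def e_def by (simp add: algebra_simps)
  qed
  have upper: "e x t \<le> C2 * W x t" if t: "t \<in> {0..T}" for x t
  proof -
    have p: "0 \<le> \<alpha> * a\<^sub>1 * (\<epsilon> * R (v x t + w x t))" "0 \<le> \<alpha> * (\<epsilon> * R (v x t + w x t))" "0 \<le> c0 * (\<epsilon> * R (v x t + w x t))"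
      "0 \<le> \<alpha> * a\<^sub>1 * (\<epsilon> * hv x)" "0 \<le> \<alpha> * (\<epsilon> * hv x)" "0 \<le> c0 * (\<epsilon> * hv x)" "0 \<le> \<alpha> * Y x t" "0 \<le> c0 * Y x t"
      "0 \<le> \<alpha> * a\<^sub>1 * Y x t"
      using pos \<epsilon> R_nonneg v.h_nonneg c0(1) Y_nonneg by auto
    have "\<epsilon>\<^sup>2 * (norm (wt x t))\<^sup>2 \<le> Y x t" unfolding Y_def by simp
    then have "\<alpha> * (\<epsilon>\<^sup>2 * (norm (wt x t))\<^sup>2) \<le> \<alpha> * Y x t" using pos by (intro mult_left_mono) auto
    then have "\<epsilon>\<^sup>2 * (\<alpha> / 12 * (norm (wt x t))\<^sup>2) \<le> \<alpha> * Y x t" using p by (simp add: algebra_simps)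
    then have "e x t \<le> 2 * (\<alpha> * Y x t) + \<alpha> * a\<^sub>1 * Y x t + \<alpha> * (\<epsilon> * R (v x t + w x t)) + \<alpha> * Y x t + 6 * (\<alpha> * (\<epsilon> * hv x)) + c0 * (\<epsilon> * hv x)"
      using E0_pair_upper[of x t] cross[OF t, of x] unfolding e_def by (simp add: algebra_simps)
    also have "\<dots> \<le> 8 * (\<alpha> * Y x t) + 8 * (\<alpha> * (\<epsilon> * R (v x t + w x t))) + 8 * (\<alpha> * (\<epsilon> * hv x))
       + (\<alpha> * a\<^sub>1 * Y x t + \<alpha> * a\<^sub>1 * (\<epsilon> * R (v x t + w x t)) + \<alpha> * a\<^sub>1 * (\<epsilon> * hv x))
       + (c0 * Y x t + c0 * (\<epsilon> * R (v x t + w x t)) + c0 * (\<epsilon> * hv x))"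
      using p by linarith
    also have "\<dots> = C2 * W x t"
      unfolding C2_def W_def by (simp add: algebra_simps)
    finally show ?thesis .
  qed
  have ineq: "e' x t + \<phi>' x t \<le> (C0 B + C1 B) * W x t" if t: "t \<in> {0..T}" for x t
  proof -
    define b where "b = sqrt (hv x)"
    have b2: "b\<^sup>2 = hv x" unfolding b_def using v.h_nonneg by simp
    note b = v.le_sqrt[OF t, of x, folded b_def]
    have RW: "0 \<le> \<epsilon> * R (v x t + w x t)" using \<epsilon> R_nonneg by auto
    \<comment> \<open>When the two inequalities are added, the source tested with \<open>wt\<close>
      and the dissipation with \<open>\<alpha> / 4\<close> and \<nu> cancel exactly.\<close>
    have "e' x t + \<phi>' x t \<le> C0 B * (Y x t + \<epsilon>\<^sup>2 * hv x) + C1 B * (Y x t + \<epsilon> * hv x)"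
      using base_inequality[OF \<epsilon>(1) w_eq[OF t] v_eq[OF t] B(1)[OF t] B(2)[OF t] b(6) b(4), of "wtx x t"]
        source_inequality[OF \<epsilon> w_eq[OF t] v_eq[OF t] B(2)[OF t] b(2) b(3) b(6) b(4) b(5)]
      unfolding e'_def \<phi>'_def Y_def b2 by (simp add: algebra_simps)
    also have "\<dots> \<le> C0 B * W x t + C1 B * W x t"
      unfolding W_def using \<epsilon>2h[of x] RW \<epsilon> v.h_nonneg[of x] C0_pos[OF B_nonneg] C1_pos[OF B_nonneg]
      by (intro add_mono mult_left_mono) auto
    finally show ?thesis by (simp add: distrib_right)
  qed
  have int_e: "integrable lborel (\<lambda>x. e x t)" if t: "t \<in> {0..T}" for t
  proof -
    have "integrable lborel (\<lambda>x. vt x t \<bullet> wt x t)"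
      by (rule dominated_integrable[OF _ k(2) t])
        ((rule dominated_intros)+, auto intro!: continuous_intros v.continuous_x w.continuous_x t)
    then show ?thesis
      unfolding e_def using E0_pair_integrable[OF t] R_integrable[OF t] v.h by auto
  qed
  have int_W: "integrable lborel (\<lambda>x. W x t)" if t: "t \<in> {0..T}" for t
    unfolding W_def using Y_integrable[OF t] R_integrable[OF t] v.h by auto
  have G: "dominated T (\<lambda>x. sqrt (k x)) (\<lambda>x t. G (v x t + w x t))"
    by (rule dominated_cong[OF dominated_add[OF dominated_G_diff dominated_G_v]]) simp
  have De: "dominated T k e'"
    unfolding e'_def mult.assoc by (rule dominated_E0' G dominated_intros)+
  have D\<phi>: "dominated T k \<phi>'"
    unfolding \<phi>'_def mult.assoc by (rule dominated_\<Phi>0' dominated_intros)+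
  have W_nonneg: "0 \<le> W x t" for x t
    using Y_nonneg \<epsilon> R_nonneg v.h_nonneg by (simp add: W_def)
  have est: "(\<integral>x. W x t \<partial>lborel) \<le> C2 / c0 * exp ((C0 B + C1 B) / c0 * T) * (\<integral>x. W x 0 \<partial>lborel)"
  proof (rule weighted_energy_estimate[OF w.T _ int_e k(2) De D\<phi> _ _ int_W W_nonneg lower upper ineq c0(1) C2_pos add_pos_pos[OF C0_pos[OF B_nonneg] C1_pos[OF B_nonneg]] t])
    fix x t assume t: "t \<in> {0..T}"
    show "(e x has_vector_derivative e' x t) (at t within {0..T})"
      unfolding e_def[abs_def] e'_def
      apply (rule has_vector_derivative_eq_rhs)
       apply (rule has_vector_derivative_add has_vector_derivative_mult_right has_vector_derivative_const
          E0_has_vector_derivative[where wt="\<lambda>s. wt x s" and w="\<lambda>s. w x s" and wx="\<lambda>s. wx x s"]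
          R_has_vector_derivative has_vector_derivative_inner v.deriv_t w.deriv_t t)+
      apply simp
      done
    show "((\<lambda>z. \<phi> z t) has_vector_derivative \<phi>' x t) (at x)"
      unfolding \<phi>_def \<phi>'_def
      by (rule has_vector_derivative_diff has_vector_derivative_mult_right
          \<Phi>0_has_vector_derivative[where wt="\<lambda>z. wt z t" and w="\<lambda>z. w z t" and wx="\<lambda>z. wx z t"]
          has_vector_derivative_inner A_has_vector_derivative v.deriv_x w.deriv_x t)+
  next
    fix t assume t: "t \<in> {0..T}"
    note isCont_tendsto_compose[OF linear_continuous_at[OF A_linear] w.lim(3)[OF t]]
    then have "((\<lambda>x. \<phi> x t) \<longlongrightarrow> 0 - \<epsilon>\<^sup>2 * \<alpha> * (0 \<bullet> A 0)) at_infinity"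
      unfolding \<phi>_def by (intro tendsto_intros \<Phi>0_lim t v.lim)
    then show "((\<lambda>x. \<phi> x t) \<longlongrightarrow> 0) at_infinity" by simp
  qed
  have int_eq: "(\<integral>x. W x t \<partial>lborel) = (\<integral>x. Y x t \<partial>lborel) + \<epsilon> * (\<integral>x. R (v x t + w x t) \<partial>lborel) + \<epsilon> * (\<integral>x. hv x \<partial>lborel)"
    if t: "t \<in> {0..T}" for t
    unfolding W_def using Y_integrable[OF t] R_integrable[OF t] v.h by simp
  have t0: "0 \<in> {0..T}" using w.T by auto
  \<comment> \<open>On the left the majorant is dropped; at time \<open>0\<close> it stays and gives
    the term of order \<epsilon>.\<close>
  have "0 \<le> \<epsilon> * (\<integral>x. hv x \<partial>lborel)" using \<epsilon> v.h_nonneg by (auto intro!: integral_nonneg_AE)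
  then show ?thesis using est unfolding int_eq[OF t] int_eq[OF t0] by linarith
qed

end

context relaxation_pair
begin

text \<open>\<open>Rrel R y z\<close> with \<open>- G\<close> in place of the gradient of
  \<open>R\<close> and the two states exchanged.\<close>

definition Rr :: "'a \<Rightarrow> 'a \<Rightarrow> real" where
  "Rr z y = R z - R y + G y \<bullet> (z - y)"

text \<open>With the potential relative to \<open>v\<close>, the source and the time derivative of
  the potential leave only the second-order remainder of \<open>G\<close>, tested with the bounded
  \<open>vt\<close>. It suffices to bound this remainder by the square of \<open>w\<close> plus the
  relative potential itself, because multiplied by \<epsilon> both are controlled by
  \<open>W\<close>. The only forcing is the residual, hence the order
  \<open>\<epsilon>\<^sup>2\<close>.\<close>

proposition relative_energy_estimate_C2:
  assumes DG: "\<And>z. (G has_derivative DG z) (at z)"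
    and DG_sym: "\<And>z x y. DG z x \<bullet> y = x \<bullet> DG z y"
    and DG_bound: "\<And>x t y. t \<in> {0..T} \<Longrightarrow> norm (DG (v x t) y) \<le> Cd * norm y"
    and remainder: "\<And>x t. t \<in> {0..T} \<Longrightarrow> norm (G (v x t + w x t) - G (v x t) - DG (v x t) (w x t))
      \<le> Cg * ((norm (w x t))\<^sup>2 + Rr (v x t + w x t) (v x t))"
    and C: "0 \<le> Cd" "0 \<le> Cg"
    and Rr_nonneg: "\<And>z y. 0 \<le> Rr z y"
    and R_0: "R 0 = 0"
    and t: "t \<in> {0..T}"
  shows "(\<integral>x. Y x t \<partial>lborel) + \<epsilon> * (\<integral>x. Rr (v x t + w x t) (v x t) \<partial>lborel) \<le>
    C2 / c0 * exp ((C0 B + \<alpha> * Cg * B) / c0 * T) *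
      ((\<integral>x. Y x 0 \<partial>lborel) + \<epsilon> * (\<integral>x. Rr (v x 0 + w x 0) (v x 0) \<partial>lborel) + \<epsilon>\<^sup>2 * (\<integral>x. hv x \<partial>lborel))"
proof -
  define e where "e x t = E0 \<epsilon> (v x t + w x t) (v x t) (wt x t) (wx x t) + \<alpha> * (\<epsilon> * Rr (v x t + w x t) (v x t))
    + c0 * (\<epsilon>\<^sup>2 * hv x)" for x t
  define Rr' where "Rr' x t = DG (v x t) (vt x t) \<bullet> w x t - (G (v x t + w x t) - G (v x t)) \<bullet> (vt x t + wt x t)" for x t
  define e' where "e' x t = E0' \<epsilon> (v x t + w x t) (v x t) (vt x t) (wt x t) (wx x t) (wtt x t) (wtx x t)
    + \<epsilon> * \<alpha> * Rr' x t" for x t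
  define \<phi> where "\<phi> x t = \<Phi>0 \<epsilon> (v x t + w x t) (v x t) (wt x t) (wx x t)" for x t
  define \<phi>' where "\<phi>' x t = \<Phi>0' \<epsilon> (v x t + w x t) (v x t) (vx x t) (wt x t) (wx x t) (wtx x t) (wxx x t)" for x t
  define W where "W x t = Y x t + \<epsilon> * Rr (v x t + w x t) (v x t) + \<epsilon>\<^sup>2 * hv x" for x t
  define D where "D = C0 B + \<alpha> * Cg * B"
  have RW: "0 \<le> \<epsilon> * Rr (v x t + w x t) (v x t)" for x t using \<epsilon> Rr_nonneg by auto
  have hW: "0 \<le> \<epsilon>\<^sup>2 * hv x" for x using v.h_nonneg by auto
  have "0 < D" unfolding D_def using C0_pos[OF B_nonneg] C B_nonneg pos by (intro add_pos_nonneg) auto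
  have lower: "c0 * W x t \<le> e x t" for x t
  proof -
    have "c0 * (\<epsilon> * Rr (v x t + w x t) (v x t)) \<le> \<alpha> * (\<epsilon> * Rr (v x t + w x t) (v x t))"
      using c0(1,3) pos RW by (intro mult_right_mono) auto
    moreover have "0 \<le> \<epsilon>\<^sup>2 * (\<alpha> / 12 * (norm (wt x t))\<^sup>2)" using pos by auto
    ultimately show ?thesis
      using E0_pair_lower[of x t] unfolding W_def e_def by (simp add: algebra_simps)
  qed
  have upper: "e x t \<le> C2 * W x t" for x t
  proof -
    have "0 \<le> \<alpha> * a\<^sub>1 * (\<epsilon> * Rr (v x t + w x t) (v x t))" "0 \<le> \<alpha> * (\<epsilon> * Rr (v x t + w x t) (v x t))"
      "0 \<le> c0 * (\<epsilon> * Rr (v x t + w x t) (v x t))"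
      "0 \<le> \<alpha> * a\<^sub>1 * (\<epsilon>\<^sup>2 * hv x)" "0 \<le> \<alpha> * (\<epsilon>\<^sup>2 * hv x)" "0 \<le> \<alpha> * Y x t" "0 \<le> c0 * Y x t"
      using pos \<epsilon> Rr_nonneg v.h_nonneg c0(1) Y_nonneg by auto
    then show ?thesis
      using E0_pair_upper[of x t] unfolding e_def W_def C2_def distrib_left distrib_right by linarith
  qed
  have ineq: "e' x t + \<phi>' x t \<le> D * W x t" if t: "t \<in> {0..T}" for x t
  proof -
    define b where "b = sqrt (hv x)"
    have b2: "b\<^sup>2 = hv x" unfolding b_def using v.h_nonneg by simp
    note b = v.le_sqrt[OF t, of x, folded b_def]
    define r where "r = G (v x t + w x t) - G (v x t) - DG (v x t) (w x t)"
    have er: "\<epsilon> * norm r \<le> Cg * W x t"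
    proof -
      have "\<epsilon> * norm r \<le> \<epsilon> * (Cg * ((norm (w x t))\<^sup>2 + Rr (v x t + w x t) (v x t)))"
        unfolding r_def using remainder[OF t, of x] \<epsilon> by (intro mult_left_mono) auto
      also have "\<dots> = Cg * (\<epsilon> * (norm (w x t))\<^sup>2 + \<epsilon> * Rr (v x t + w x t) (v x t))"
        by (simp add: algebra_simps)
      also have "\<dots> \<le> Cg * W x t"
      proof (intro mult_left_mono C)
        have "\<epsilon> * (norm (w x t))\<^sup>2 \<le> (norm (w x t))\<^sup>2" using \<epsilon> by (simp add: mult_left_le_one_le)
        then show "\<epsilon> * (norm (w x t))\<^sup>2 + \<epsilon> * Rr (v x t + w x t) (v x t) \<le> W x t"
          using hW[of x] zero_le_power2[of "\<epsilon> * norm (wx x t)"] zero_le_power2[of "\<epsilon> * norm (wt x t)"]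
          unfolding W_def Y_def power_mult_distrib by linarith
      qed
      finally show ?thesis .
    qed
    \<comment> \<open>Symmetry of \<open>DG\<close> rewrites
      \<open>DG (v x t) (vt x t) \<bullet> w x t\<close> as a test with \<open>vt\<close>.\<close>
    have src: "\<epsilon> * \<alpha> * (wt x t \<bullet> (G (v x t + w x t) - G (v x t))) + \<epsilon> * \<alpha> * Rr' x t = \<epsilon> * \<alpha> * - (r \<bullet> vt x t)"
      unfolding Rr'_def r_def using DG_sym[of "v x t" "vt x t" "w x t"]
      by (simp add: inner_simps algebra_simps inner_commute)
    \<comment> \<open>The dissipation retained by \<open>base_inequality\<close> is discarded
      here.\<close>
    have "0 \<le> \<epsilon> * (\<alpha> / 4) * (norm (wt x t))\<^sup>2" "0 \<le> \<epsilon> * \<nu> * (norm (wx x t))\<^sup>2"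
      using pos \<epsilon> by auto
    then have "e' x t + \<phi>' x t \<le> C0 B * (Y x t + \<epsilon>\<^sup>2 * hv x) + \<epsilon> * \<alpha> * - (r \<bullet> vt x t)"
      using base_inequality[OF \<epsilon>(1) w_eq[OF t] v_eq[OF t] B(1)[OF t] B(2)[OF t] b(6) b(4), of "wtx x t"] src
      unfolding e'_def \<phi>'_def Y_def b2 by (simp only: add_diff_cancel_left')
    moreover have "\<epsilon> * \<alpha> * - (r \<bullet> vt x t) \<le> \<alpha> * B * (Cg * W x t)"
    proof -
      have "- (r \<bullet> vt x t) \<le> norm r * B"
        by (rule minus_inner_le) (use B(1)[OF t] in auto)
      then have "\<epsilon> * \<alpha> * - (r \<bullet> vt x t) \<le> \<epsilon> * \<alpha> * (norm r * B)"
        using \<epsilon> pos by (intro mult_left_mono) auto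
      also have "\<dots> = \<alpha> * B * (\<epsilon> * norm r)" by simp
      also have "\<dots> \<le> \<alpha> * B * (Cg * W x t)"
        using er pos B_nonneg by (intro mult_left_mono) auto
      finally show ?thesis .
    qed
    ultimately have "e' x t + \<phi>' x t \<le> C0 B * (Y x t + \<epsilon>\<^sup>2 * hv x) + \<alpha> * B * (Cg * W x t)" by linarith
    also have "C0 B * (Y x t + \<epsilon>\<^sup>2 * hv x) \<le> C0 B * W x t"
      unfolding W_def using RW C0_pos[OF B_nonneg] by (intro mult_left_mono) auto
    finally show ?thesis unfolding D_def by (simp add: algebra_simps)
  qed
  have Rv_integrable: "integrable lborel (\<lambda>x. R (v x t))" if t: "t \<in> {0..T}" for t
  proof (rule dominated_integrable[OF _ k(2) t])
    \<comment> \<open>Nonnegativity of \<open>Rr 0 (v x t)\<close> reads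
      \<open>R v \<le> - (G v \<bullet> v)\<close>, so the potential along \<open>v\<close> has a
      quadratic majorant.\<close>
    have "norm (R (v x t)) \<le> 1 * norm (G (v x t) \<bullet> v x t)" for x t
      using Rr_nonneg[of 0 "v x t"] R_nonneg[of "v x t"] by (simp add: Rr_def R_0)
    then show "dominated T k (\<lambda>x t. R (v x t))"
      by (intro dominated_by[OF dominated_inner[OF dominated_G_v dominated_vw(1) k(1)], of 1]) simp_all
    have "continuous_on UNIV R"
      using R_deriv by (auto intro!: continuous_at_imp_continuous_on has_derivative_continuous)
    then show "continuous_on UNIV (\<lambda>x. R (v x t))"
      by (rule continuous_on_compose2) (auto intro: v.continuous_x t)
  qed
  have int_Rr: "integrable lborel (\<lambda>x. Rr (v x t + w x t) (v x t))" if t: "t \<in> {0..T}" for t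
  proof -
    have "integrable lborel (\<lambda>x. G (v x t) \<bullet> w x t)"
    proof (rule dominated_integrable[OF _ k(2) t])
      show "dominated T k (\<lambda>x t. G (v x t) \<bullet> w x t)"
        by (rule dominated_G_v dominated_intros)+
      show "continuous_on UNIV (\<lambda>x. G (v x t) \<bullet> w x t)"
        by (intro continuous_intros v.continuous_x w.continuous_x t continuous_on_compose2[OF G_cont]) auto
    qed
    then show ?thesis unfolding Rr_def using R_integrable[OF t] Rv_integrable[OF t] by auto
  qed
  have int_e: "integrable lborel (\<lambda>x. e x t)" if t: "t \<in> {0..T}" for t
    unfolding e_def using E0_pair_integrable[OF t] int_Rr[OF t] v.h by auto
  have int_W: "integrable lborel (\<lambda>x. W x t)" if t: "t \<in> {0..T}" for t
    unfolding W_def using Y_integrable[OF t] int_Rr[OF t] v.h by auto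
  have DDG: "dominated T (\<lambda>x. sqrt (k x)) (\<lambda>x t. DG (v x t) (vt x t))"
    by (rule dominated_by[OF dominated_vw(2)]) (use DG_bound C in auto)
  have De: "dominated T k e'"
    unfolding e'_def Rr'_def mult.assoc by (rule dominated_E0' dominated_G_diff DDG dominated_intros)+
  have D\<phi>: "dominated T k \<phi>'"
    unfolding \<phi>'_def by (rule dominated_\<Phi>0')
  have W_nonneg: "0 \<le> W x t" for x t
    using Y_nonneg[of x t] RW[of x t] hW[of x] by (simp add: W_def)
  have est: "(\<integral>x. W x t \<partial>lborel) \<le> C2 / c0 * exp (D / c0 * T) * (\<integral>x. W x 0 \<partial>lborel)"
  proof (rule weighted_energy_estimate[OF w.T _ int_e k(2) De D\<phi> _ _ int_W W_nonneg lower upper ineq c0(1) C2_pos \<open>0 < D\<close> t])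
    fix x t assume t: "t \<in> {0..T}"
    show "(e x has_vector_derivative e' x t) (at t within {0..T})"
      unfolding e_def[abs_def] e'_def Rr_def Rr'_def
      apply (rule has_vector_derivative_eq_rhs)
       apply (rule has_vector_derivative_add has_vector_derivative_diff has_vector_derivative_mult_right has_vector_derivative_const
          E0_has_vector_derivative[where wt="\<lambda>s. wt x s" and w="\<lambda>s. w x s" and wx="\<lambda>s. wx x s"]
          has_vector_derivative_chain[OF R_deriv] has_vector_derivative_chain[OF DG]
          has_vector_derivative_inner v.deriv_t w.deriv_t t)+
      apply (simp add: inner_simps algebra_simps)
      done
    show "((\<lambda>z. \<phi> z t) has_vector_derivative \<phi>' x t) (at x)"
      unfolding \<phi>_def \<phi>'_def
      by (rule \<Phi>0_has_vector_derivative[where wt="\<lambda>z. wt z t" and w="\<lambda>z. w z t" and wx="\<lambda>z. wx z t"]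
          v.deriv_x w.deriv_x t)+
  next
    fix t assume t: "t \<in> {0..T}"
    show "((\<lambda>x. \<phi> x t) \<longlongrightarrow> 0) at_infinity"
      unfolding \<phi>_def by (rule \<Phi>0_lim[OF t])
  qed
  have int_eq: "(\<integral>x. W x t \<partial>lborel) = (\<integral>x. Y x t \<partial>lborel) + \<epsilon> * (\<integral>x. Rr (v x t + w x t) (v x t) \<partial>lborel)
      + \<epsilon>\<^sup>2 * (\<integral>x. hv x \<partial>lborel)"
    if t: "t \<in> {0..T}" for t
    unfolding W_def using Y_integrable[OF t] int_Rr[OF t] v.h by simp
  have t0: "0 \<in> {0..T}" using w.T by auto
  have "0 \<le> \<epsilon>\<^sup>2 * (\<integral>x. hv x \<partial>lborel)" using v.h_nonneg by (auto intro!: integral_nonneg_AE)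
  then show ?thesis using est unfolding int_eq[OF t] int_eq[OF t0] D_def by linarith
qed

end

section \<open>Differentiability up to the boundary of the strip\<close>

lemma Ck_on_cong:
  assumes "Ck_on k S f" "\<And>x. x \<in> S \<Longrightarrow> f x = g x"
  shows "Ck_on k S g"
proof (cases k)
  case 0
  then show ?thesis using assms continuous_on_cong[of S S f g] by simp
next
  case (Suc j)
  with assms(1) obtain f' where f': "\<And>x. x \<in> S \<Longrightarrow> (f has_derivative f' x) (at x within S)"
    "\<And>h. Ck_on j S (\<lambda>x. f' x h)" by auto
  have "(g has_derivative f' x) (at x within S)" if "x \<in> S" for x
    using has_derivative_transform[OF that _ f'(1)[OF that], of g] assms(2) by simp
  with f'(2) Suc show ?thesis by auto
qed

lemma Ck_on_continuous_on: "Ck_on k S f \<Longrightarrow> continuous_on S f"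
proof (cases k)
  case (Suc j)
  assume "Ck_on k S f"
  with Suc obtain f' where "\<And>x. x \<in> S \<Longrightarrow> (f has_derivative f' x) (at x within S)" by auto
  then show ?thesis by (rule has_derivative_continuous_on)
qed simp

lemma Ck_on_bounded_linear:
  assumes "bounded_linear l" "Ck_on k S f"
  shows "Ck_on k S (\<lambda>x. l (f x))"
  using assms(2)
proof (induction k arbitrary: f)
  case 0
  then show ?case using bounded_linear.continuous_on[OF assms(1)] by simp
next
  case (Suc k)
  then obtain f' where f': "\<And>x. x \<in> S \<Longrightarrow> (f has_derivative f' x) (at x within S)" "\<And>h. Ck_on k S (\<lambda>x. f' x h)"
    by auto
  show ?case
    using bounded_linear.has_derivative[OF assms(1) f'(1)] Suc.IH[OF f'(2)]
    by (auto intro!: exI[of _ "\<lambda>x h. l (f' x h)"])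
qed

lemma Ck_on_compose_affine:
  assumes l: "bounded_linear l" and "Ck_on k UNIV f"
  shows "Ck_on k S (\<lambda>z. f (p + l z))"
  using assms(2)
proof (induction k arbitrary: f)
  case 0
  then show ?case
    by (auto intro!: continuous_intros continuous_on_compose2[of UNIV f] linear_continuous_on[OF l])
next
  case (Suc k)
  then obtain f' where f': "\<And>x. (f has_derivative f' x) (at x)" "\<And>h. Ck_on k UNIV (\<lambda>x. f' x h)"
    by auto
  have "((\<lambda>z. p + l z) has_derivative l) (at z within S)" for z
    using has_derivative_add[OF has_derivative_const bounded_linear_imp_has_derivative[OF l]] by simp
  from has_derivative_compose[OF this f'(1)] Suc.IH[OF f'(2)] show ?case
    by (auto intro!: exI[of _ "\<lambda>z h. f' (p + l z) (l h)"])
qed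

text \<open>Restriction of the full derivative to horizontal and vertical lines gives its values on
  \<open>(1, 0)\<close> and \<open>(0, 1)\<close>. At \<open>t = 0\<close> and \<open>t = T\<close>
  the time derivative is one-sided and still unique because \<open>0 < T\<close>, so it agrees with
  \<open>dt\<close>.\<close>

lemma strip_partial_derivatives:
  fixes u :: "real \<Rightarrow> real \<Rightarrow> 'a::euclidean_space"
  assumes T: "0 < T" and u: "Ck_on (Suc k) (UNIV \<times> {0..T}) (\<lambda>(x, t). u x t)"
  shows "Ck_on k (UNIV \<times> {0..T}) (\<lambda>(x, t). dx u x t)"
    and "Ck_on k (UNIV \<times> {0..T}) (\<lambda>(x, t). dt T u x t)"
    and "t \<in> {0..T} \<Longrightarrow> ((\<lambda>z. u z t) has_vector_derivative dx u x t) (at x)"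
    and "t \<in> {0..T} \<Longrightarrow> ((\<lambda>s. u x s) has_vector_derivative dt T u x t) (at t within {0..T})"
proof -
  let ?S = "UNIV \<times> {0..T}"
  obtain f' where f': "\<And>z. z \<in> ?S \<Longrightarrow> ((\<lambda>(x, t). u x t) has_derivative f' z) (at z within ?S)"
    "\<And>h. Ck_on k ?S (\<lambda>z. f' z h)"
    using u unfolding Ck_on.simps by blast
  have lin: "linear (f' (x, t))" if "t \<in> {0..T}" for x t
    by (rule has_derivative_linear[OF f'(1)]) (use that in simp)
  have X: "((\<lambda>z. u z t) has_vector_derivative f' (x, t) (1, 0)) (at x)" if t: "t \<in> {0..T}" for x t
  proof -
    have "((\<lambda>(x, t). u x t) has_derivative f' (x, t)) (at (x, t) within (\<lambda>z. (z, t)) ` UNIV)"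
      by (rule has_derivative_subset[OF f'(1)]) (use t in auto)
    from has_derivative_in_compose[OF has_derivative_Pair[OF has_derivative_ident has_derivative_const] this]
    have d: "((\<lambda>z. u z t) has_derivative (\<lambda>h. f' (x, t) (h, 0))) (at x)" by simp
    have eq: "f' (x, t) (h, 0) = h *\<^sub>R f' (x, t) (1, 0)" for h
      using linear_scale[OF lin[OF t, of x], of h "(1, 0)"] by simp
    show ?thesis
      unfolding has_vector_derivative_def by (rule has_derivative_eq_rhs[OF d]) (rule ext, rule eq)
  qed
  have Tt: "((\<lambda>s. u x s) has_vector_derivative f' (x, t) (0, 1)) (at t within {0..T})" if t: "t \<in> {0..T}" for x t
  proof -
    have "((\<lambda>(x, t). u x t) has_derivative f' (x, t)) (at (x, t) within (\<lambda>s. (x, s)) ` {0..T})"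
      by (rule has_derivative_subset[OF f'(1)]) (use t in auto)
    from has_derivative_in_compose[OF has_derivative_Pair[OF has_derivative_const has_derivative_ident] this]
    have d: "((\<lambda>s. u x s) has_derivative (\<lambda>h. f' (x, t) (0, h))) (at t within {0..T})" by simp
    have eq: "f' (x, t) (0, h) = h *\<^sub>R f' (x, t) (0, 1)" for h
      using linear_scale[OF lin[OF t, of x], of h "(0, 1)"] by simp
    show ?thesis
      unfolding has_vector_derivative_def by (rule has_derivative_eq_rhs[OF d]) (rule ext, rule eq)
  qed
  have dx: "dx u x t = f' (x, t) (1, 0)" if "t \<in> {0..T}" for x t
    unfolding dx_def using X[OF that] by (rule vector_derivative_at)
  have dt: "dt T u x t = f' (x, t) (0, 1)" if "t \<in> {0..T}" for x t
    unfolding dt_def using vector_derivative_within_closed_interval[OF T that Tt[OF that]] .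
  show "Ck_on k ?S (\<lambda>(x, t). dx u x t)" by (rule Ck_on_cong[OF f'(2)[of "(1, 0)"]]) (auto simp: dx)
  show "Ck_on k ?S (\<lambda>(x, t). dt T u x t)" by (rule Ck_on_cong[OF f'(2)[of "(0, 1)"]]) (auto simp: dt)
  show "t \<in> {0..T} \<Longrightarrow> ((\<lambda>z. u z t) has_vector_derivative dx u x t) (at x)" unfolding dx by (rule X)
  show "t \<in> {0..T} \<Longrightarrow> ((\<lambda>s. u x s) has_vector_derivative dt T u x t) (at t within {0..T})" unfolding dt by (rule Tt)
qed

text \<open>Schwarz's theorem up to the boundary of the strip: differentiate
  \<open>u(x,t) = u(x,0) + \<integral> u\<^sub>t(x,s) ds\<close> under the integral sign.\<close>

lemma strip_mixed_derivative:
  fixes u :: "real \<Rightarrow> real \<Rightarrow> 'a::euclidean_space"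
  assumes T: "0 < T" and u: "Ck_on (Suc (Suc k)) (UNIV \<times> {0..T}) (\<lambda>(x, t). u x t)" and t: "t \<in> {0..T}"
  shows "((\<lambda>s. dx u x s) has_vector_derivative dx (dt T u) x t) (at t within {0..T})"
proof -
  let ?S = "UNIV \<times> {0..T}" and ?utx = "dx (dt T u)"
  note u1 = strip_partial_derivatives[OF T u]
  note u2 = strip_partial_derivatives[OF T u1(2)]
  note cont = Ck_on_continuous_on
  have ct: "continuous_on {0..T} (\<lambda>s. v x s)" if "Ck_on j ?S (\<lambda>(x, t). v x t)" for v :: "real \<Rightarrow> real \<Rightarrow> 'a" and j x
  proof -
    have "continuous_on {0..T} (\<lambda>s. (\<lambda>(x, t). v x t) (x, s))"
      by (rule continuous_on_compose2[OF cont[OF that]]) (auto intro!: continuous_intros)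
    then show ?thesis by simp
  qed
  have eq: "dx u x s = dx u x 0 + integral {0..s} (?utx x)" if s: "s \<in> {0..T}" for s
  proof -
    have u_eq: "u z s = u z 0 + integral (cbox 0 s) (dt T u z)" for z
    proof -
      have "(dt T u z has_integral (u z s - u z 0)) {0..s}"
        using s by (intro fundamental_theorem_of_calculus) (auto intro!: has_vector_derivative_within_subset[OF u1(4)])
      from integral_unique[OF this] show ?thesis by simp
    qed
    have "((\<lambda>z. integral (cbox 0 s) (dt T u z)) has_vector_derivative integral (cbox 0 s) (?utx x)) (at x within UNIV)"
    proof (rule leibniz_rule_vector_derivative)
      show "((\<lambda>z. dt T u z r) has_vector_derivative ?utx z r) (at z within UNIV)" if "r \<in> cbox 0 s" for z r
        using u2(3)[of r z] that s by auto
      show "dt T u z integrable_on cbox 0 s" for z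
        using s by (auto intro!: integrable_continuous_interval continuous_on_subset[OF ct[OF u1(2)]])
      show "continuous_on (UNIV \<times> cbox 0 s) (\<lambda>(z, r). ?utx z r)"
        by (rule continuous_on_subset[OF cont[OF u2(1)]]) (use s in auto)
    qed auto
    moreover have "((\<lambda>z. u z 0) has_vector_derivative dx u x 0) (at x)" using T by (intro u1(3)) auto
    ultimately have "((\<lambda>z. u z s) has_vector_derivative dx u x 0 + integral (cbox 0 s) (?utx x)) (at x)"
      unfolding u_eq using has_vector_derivative_add by blast
    from vector_derivative_at[OF this] show ?thesis by (simp add: dx_def)
  qed
  have "((\<lambda>s. integral {0..s} (?utx x)) has_vector_derivative ?utx x t) (at t within {0..T})"
    by (rule integral_has_vector_derivative[OF ct[OF u2(1)] t])
  from has_vector_derivative_add[OF has_vector_derivative_const this]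
  have "((\<lambda>s. dx u x 0 + integral {0..s} (?utx x)) has_vector_derivative ?utx x t) (at t within {0..T})"
    by simp
  then show ?thesis
    by (rule has_vector_derivative_transform[OF t, rotated]) (rule eq)
qed

text \<open>The map \<open>(x, t) \<mapsto> p + x a + t b\<close> pulls \<open>f\<close> back to a
  function on the strip \<open>t \<in> {0..1}\<close>, where \<open>strip_mixed_derivative\<close>
  applies, even at the boundary point \<open>(0, 0)\<close>.\<close>

lemma symmetric_second_derivative:
  fixes f :: "'a::euclidean_space \<Rightarrow> 'b::euclidean_space"
  assumes f: "Ck_on 2 UNIV f" and D: "\<And>x. (f has_derivative D x) (at x)"
    and a: "((\<lambda>x. D x a) has_derivative Da) (at p)" and b: "((\<lambda>x. D x b) has_derivative Db) (at p)"
  shows "Da b = Db a"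
proof -
  define l where "l = (\<lambda>(x::real, t::real). x *\<^sub>R a + t *\<^sub>R b)"
  define u where "u x t = f (p + l (x, t))" for x t
  have l: "bounded_linear l"
    unfolding l_def split_def
    by (intro bounded_linear_add bounded_linear_scaleR_const bounded_linear_fst bounded_linear_snd)
  have "Ck_on 2 (UNIV \<times> {0..1}) (\<lambda>z. f (p + l z))"
    by (rule Ck_on_compose_affine[OF l f])
  then have C: "Ck_on (Suc (Suc 0)) (UNIV \<times> {0..1}) (\<lambda>(x, t). u x t)"
    unfolding u_def by (simp add: numeral_2_eq_2 split_def)
  note u1 = strip_partial_derivatives[OF zero_less_one C]
  have lx: "((\<lambda>z. p + l (z, t)) has_vector_derivative a) (at x)" for x t
    unfolding has_vector_derivative_def l_def split_conv by (auto intro!: derivative_eq_intros)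
  have lt: "((\<lambda>s. p + l (x, s)) has_vector_derivative b) (at t within {0..1})" for x t
    unfolding has_vector_derivative_def l_def split_conv by (auto intro!: derivative_eq_intros)
  have dx: "dx u x t = D (p + l (x, t)) a" for x t
    unfolding dx_def u_def by (rule vector_derivative_at[OF has_vector_derivative_chain[OF D lx]])
  have dt: "dt 1 u x t = D (p + l (x, t)) b" if "t \<in> {0..1}" for x t
    unfolding dt_def u_def
    by (rule vector_derivative_within_closed_interval[OF zero_less_one that has_vector_derivative_chain[OF D lt]])
  have "dx (dt 1 u) 0 0 = Db a"
  proof -
    have "((\<lambda>z. D (p + l (z, 0)) b) has_vector_derivative Db a) (at 0)"
      by (rule has_vector_derivative_chain[where f="\<lambda>x. D x b", OF _ lx]) (use b in \<open>simp add: l_def\<close>)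
    then have "vector_derivative (\<lambda>z. D (p + l (z, 0)) b) (at 0) = Db a" by (rule vector_derivative_at)
    then show ?thesis unfolding dx_def by (simp add: dt)
  qed
  moreover have "((\<lambda>s. dx u 0 s) has_vector_derivative Da b) (at 0 within {0..1})"
    unfolding dx by (rule has_vector_derivative_chain[where f="\<lambda>x. D x a", OF _ lt]) (use a in \<open>simp add: l_def\<close>)
  moreover have "((\<lambda>s. dx u 0 s) has_vector_derivative dx (dt 1 u) 0 0) (at 0 within {0..1})"
    by (rule strip_mixed_derivative[OF zero_less_one C]) simp
  ultimately show ?thesis
    using vector_derivative_unique_within_closed_interval[of 0 1 0 "\<lambda>s. dx u 0 s" "Da b" "dx (dt 1 u) 0 0"]
    by simp
qed

section \<open>Gradients, Hessians and bounds for quadratic forms\<close>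

lemma Ck_on_SucD:
  assumes "Ck_on (Suc k) UNIV f"
  shows "(f has_derivative frechet_derivative f (at x)) (at x)"
    and "f differentiable (at x)"
    and "Ck_on k UNIV (\<lambda>x. frechet_derivative f (at x) h)"
proof -
  obtain f' where f': "\<And>x. (f has_derivative f' x) (at x)" "\<And>h. Ck_on k UNIV (\<lambda>x. f' x h)"
    using assms by auto
  have eq: "f' x = frechet_derivative f (at x)" for x
    by (rule frechet_derivative_at[OF f'(1)])
  show "(f has_derivative frechet_derivative f (at x)) (at x)" using f'(1)[of x] unfolding eq .
  show "f differentiable (at x)" using f'(1) unfolding differentiable_def by blast
  show "Ck_on k UNIV (\<lambda>x. frechet_derivative f (at x) h)" using f'(2)[of h] unfolding eq .
qed

lemma multi_deriv_Nil: "multi_deriv f [] = f"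
  by (rule ext) simp

lemma frechet_derivative_eq_grad:
  fixes f :: "real^'n \<Rightarrow> real"
  assumes "f differentiable (at u)"
  shows "frechet_derivative f (at u) y = grad f u \<bullet> y"
proof -
  have l: "linear (frechet_derivative f (at u))"
    using assms frechet_derivative_works has_derivative_linear by blast
  have "frechet_derivative f (at u) y = frechet_derivative f (at u) (\<Sum>i\<in>UNIV. y $ i *\<^sub>R axis i 1)"
    using basis_expansion[of y] by (simp add: scalar_mult_eq_scaleR)
  also have "\<dots> = (\<Sum>i\<in>UNIV. y $ i * frechet_derivative f (at u) (axis i 1))"
    using l by (simp add: linear_sum linear_scale)
  also have "\<dots> = grad f u \<bullet> y"
    by (simp add: grad_def inner_vec_def mult.commute)
  finally show ?thesis .
qed

lemma grad_differentiable:
  fixes f :: "real^'n \<Rightarrow> real"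
  assumes f: "Ck_on (Suc (Suc k)) UNIV f"
  shows "grad f differentiable (at u)"
proof -
  have "(\<lambda>x. grad f x \<bullet> b) differentiable (at u)" for b
    using Ck_on_SucD(2)[OF Ck_on_SucD(3)[OF f], of b u]
    by (simp add: frechet_derivative_eq_grad[OF Ck_on_SucD(2)[OF f]])
  then show ?thesis using differentiable_componentwise_within[of "grad f" u UNIV] by simp
qed

text \<open>Nonnegativity of the form at \<open>x - (1 / c) H x\<close>, the quadratic counterpart
  of the cocoercivity argument. It turns a two-sided form bound into a norm bound without
  eigenvalues.\<close>

lemma quad_form_bounds_imp_norm_le:
  fixes H :: "'a::real_inner \<Rightarrow> 'a"
  assumes l: "linear H" and sym: "\<And>x y. H x \<bullet> y = x \<bullet> H y" and c: "0 < c"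
    and lo: "\<And>x. 0 \<le> H x \<bullet> x" and up: "\<And>x. H x \<bullet> x \<le> c * (norm x)\<^sup>2"
  shows "(norm (H x))\<^sup>2 \<le> c * (H x \<bullet> x)" and "norm (H x) \<le> c * norm x"
proof -
  define s where "s = 1 / c"
  have "0 \<le> H (x - s *\<^sub>R H x) \<bullet> (x - s *\<^sub>R H x)" by (rule lo)
  also have "\<dots> = H x \<bullet> x - 2 * s * (norm (H x))\<^sup>2 + s * s * (H (H x) \<bullet> H x)"
    using sym[of "H x" x]
    by (simp add: linear_diff[OF l] linear_scale[OF l] inner_simps power2_norm_eq_inner algebra_simps inner_commute)
  also have "\<dots> \<le> H x \<bullet> x - 2 * s * (norm (H x))\<^sup>2 + s * s * (c * (norm (H x))\<^sup>2)"
    using up[of "H x"] c by (intro add_left_mono mult_left_mono) (auto simp: s_def)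
  also have "s * s * (c * (norm (H x))\<^sup>2) = s * (norm (H x))\<^sup>2" unfolding s_def using c by simp
  finally have "s * (norm (H x))\<^sup>2 \<le> H x \<bullet> x" by linarith
  then show 1: "(norm (H x))\<^sup>2 \<le> c * (H x \<bullet> x)" unfolding s_def using c by (simp add: divide_le_eq mult.commute)
  have "c * (H x \<bullet> x) \<le> c * (c * (norm x)\<^sup>2)" by (rule mult_left_mono[OF up]) (use c in simp)
  with 1 have "(norm (H x))\<^sup>2 \<le> (c * norm x)\<^sup>2" by (simp add: power2_eq_square mult.assoc mult.left_commute)
  then show "norm (H x) \<le> c * norm x" by (rule power2_le_imp_le) (use c in simp)
qed

text \<open>The minimum of the form on the compact unit sphere is positive; homogeneity extends the
  bound to all vectors.\<close>

lemma pos_def_coercive: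
  fixes A :: "'a::euclidean_space \<Rightarrow> 'a"
  assumes l: "bounded_linear A" and pos: "\<And>x. x \<noteq> 0 \<Longrightarrow> 0 < x \<bullet> A x"
  obtains c where "0 < c" "\<And>x. c * (norm x)\<^sup>2 \<le> x \<bullet> A x"
proof -
  have "continuous_on (sphere 0 1) (\<lambda>x. x \<bullet> A x)"
    by (intro continuous_intros linear_continuous_on[OF l])
  moreover have "sphere (0::'a) 1 \<noteq> {}" by simp
  ultimately have "\<exists>z\<in>sphere 0 1. \<forall>x\<in>sphere 0 1. z \<bullet> A z \<le> x \<bullet> A x"
    by (intro continuous_attains_inf) simp_all
  then obtain z where z: "z \<in> sphere 0 1" "\<And>x. x \<in> sphere 0 1 \<Longrightarrow> z \<bullet> A z \<le> x \<bullet> A x"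
    by blast
  define c where "c = z \<bullet> A z"
  have "z \<noteq> 0" using z(1) by force
  then have "0 < c" unfolding c_def by (rule pos)
  moreover have "c * (norm x)\<^sup>2 \<le> x \<bullet> A x" for x
  proof (cases "x = 0")
    case False
    then have "x /\<^sub>R norm x \<in> sphere 0 1" by simp
    then have "c \<le> (x /\<^sub>R norm x) \<bullet> A (x /\<^sub>R norm x)" unfolding c_def by (rule z(2))
    also have "\<dots> = x \<bullet> A x / (norm x)\<^sup>2"
      unfolding linear_scale[OF bounded_linear.linear[OF l]] by (simp add: power2_eq_square divide_inverse)
    finally show ?thesis using False by (simp add: pos_le_divide_eq)
  qed simp
  ultimately show thesis using that by blast
qed

lemma sym_matrix_inner:
  fixes P :: "real^'n^'n"
  assumes "transpose P = P"
  shows "(P *v x) \<bullet> y = x \<bullet> (P *v y)"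
proof -
  have "x v* P = P *v x" using vector_transpose_matrix[of x P] unfolding assms .
  then show ?thesis using dot_lmul_matrix[of x P y] by (simp only:)
qed

text \<open>Norm bounds are extracted from form inequalities: \<open>H_norm\<close> from symmetry
  and the two-sided Hessian bound, \<open>J_norm\<close> from the subcharacteristic condition, which
  controls the Jacobian by the Hessian and \<open>A\<close>. The mean value inequality turns the
  bounds on the third derivative of \<eta> and the second derivative of \<open>F\<close> into
  \<open>H_lip\<close> and \<open>J_lip\<close>.\<close>

lemma entropy_structure_of_hypotheses:
  fixes F G :: "real^'n \<Rightarrow> real^'n"
    and \<eta> q R :: "real^'n \<Rightarrow> real"
    and A :: "real^'n^'n"
  assumes F_smooth: "smooth_on UNIV F"
    and G_cont: "continuous_on UNIV G"
    and A: "sym_pos_def A"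
    and entropy_smooth: "smooth_on UNIV \<eta>" "smooth_on UNIV q"
    and entropy_pos: "0 < \<alpha>" "0 < \<beta>"
    and entropy_flux: "\<And>u. grad \<eta> u v* jacobian F (at u) = grad q u"
    and entropy_hessian:
      "\<And>u. quad_le (\<beta> *\<^sub>R mat 1) (hessian \<eta> u)"
      "\<And>u. quad_le (hessian \<eta> u) ((\<alpha> / 2) *\<^sub>R mat 1)"
    and subchar_pos: "0 < \<nu>"
    and subchar: "\<And>u. quad_le (\<nu> *\<^sub>R mat 1)
        ((1 / 2) *\<^sub>R (A ** hessian \<eta> u + hessian \<eta> u ** A)
         - \<alpha> *\<^sub>R (transpose (jacobian F (at u)) ** jacobian F (at u)))"
    and M_pos: "0 < M"
    and M_bounds: "\<And>u. deriv_norm_le 2 F u M" "\<And>u. deriv_norm_le 3 \<eta> u M"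
    and weak_dissipation: "\<And>u w. - ((grad \<eta> u - grad \<eta> w) \<bullet> (G u - G w)) \<ge> 0"
    and potential_diff: "\<And>u. R differentiable at u"
    and potential: "\<And>u. G u = - grad R u"
    and R_nonneg: "\<And>u. 0 \<le> R u"
  obtains L a\<^sub>0 a\<^sub>1 where "entropy_structure \<eta> q R (grad \<eta>) F G ((*v) A) (\<lambda>u. (*v) (hessian \<eta> u))
    (\<lambda>u. (*v) (jacobian F (at u))) \<alpha> \<beta> \<nu> M L a\<^sub>0 a\<^sub>1"
proof -
  define g H J where "g = grad \<eta>" and "H u = (*v) (hessian \<eta> u)" and "J u = (*v) (jacobian F (at u))" for u
  have \<eta>C: "Ck_on k UNIV \<eta>" and qC: "Ck_on k UNIV q" and FC: "Ck_on k UNIV F" for k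
    using entropy_smooth F_smooth unfolding smooth_on_def by auto
  note \<eta>d = Ck_on_SucD(2)[OF \<eta>C] and qd = Ck_on_SucD(2)[OF qC] and Fd = Ck_on_SucD(2)[OF FC]
  have \<eta>_deriv: "(\<eta> has_derivative (\<lambda>y. g u \<bullet> y)) (at u)" for u
    using Ck_on_SucD(1)[OF \<eta>C, of u] by (simp add: g_def frechet_derivative_eq_grad[OF \<eta>d, abs_def])
  have g_deriv: "(g has_derivative H u) (at u)" for u
    using grad_differentiable[OF \<eta>C, of u] unfolding g_def H_def hessian_def jacobian_works by simp
  have F_deriv: "(F has_derivative J u) (at u)" for u
    using Fd[of u] unfolding J_def jacobian_works by simp
  have Jfd: "J u = frechet_derivative F (at u)" for u
    by (rule frechet_derivative_at[OF F_deriv])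
  have Hfd: "H u y \<bullet> z = frechet_derivative (\<lambda>x. frechet_derivative \<eta> (at x) z) (at u) y" for u y z
  proof -
    have "((\<lambda>x. frechet_derivative \<eta> (at x) z) has_derivative (\<lambda>y. H u y \<bullet> z)) (at u)"
      unfolding frechet_derivative_eq_grad[OF \<eta>d] g_def[symmetric]
      by (rule has_derivative_inner_left[OF g_deriv])
    from frechet_derivative_at[OF this] show ?thesis by metis
  qed
  have q_deriv: "(q has_derivative (\<lambda>y. g u \<bullet> J u y)) (at u)" for u
    using Ck_on_SucD(1)[OF qC, of u] 
    by (simp add: frechet_derivative_eq_grad[OF qd, abs_def] entropy_flux[symmetric] dot_lmul_matrix g_def J_def)
  have R_deriv: "(R has_derivative (\<lambda>y. - G u \<bullet> y)) (at u)" for u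
    using potential_diff[of u] unfolding frechet_derivative_works
    by (simp add: frechet_derivative_eq_grad[OF potential_diff, abs_def] potential)
  have H_sym: "H u x \<bullet> y = x \<bullet> H u y" for u x y
  proof -
    have d: "((\<lambda>x. g x \<bullet> z) has_derivative (\<lambda>h. H u h \<bullet> z)) (at u)" for z
      by (rule has_derivative_inner_left[OF g_deriv])
    have "H u x \<bullet> y = H u y \<bullet> x"
      by (rule symmetric_second_derivative[OF \<eta>C \<eta>_deriv d d])
    then show ?thesis by (simp add: inner_commute)
  qed
  have J_partial: "((\<lambda>x. J x y) has_derivative frechet_derivative (\<lambda>x. frechet_derivative F (at x) y) (at u)) (at u)" for u y
    unfolding Jfd by (rule Ck_on_SucD(1)[OF Ck_on_SucD(3)[OF FC]])
  have HJ_sym: "H u x \<bullet> J u y = H u y \<bullet> J u x" for u x y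
  proof -
    define E where "E y = frechet_derivative (\<lambda>x. frechet_derivative F (at x) y) (at u)" for y
    have E: "((\<lambda>x. J x y) has_derivative E y) (at u)" for y unfolding E_def by (rule J_partial)
    have "E y x = E x y"
      by (rule symmetric_second_derivative[OF FC F_deriv E E])
    \<comment> \<open>The Hessian of \<open>q\<close> is symmetric. By the product rule it is
      \<open>H u h \<bullet> J u y\<close> plus the gradient of \<eta> against the second derivative
      of \<open>F\<close>; the latter is symmetric too, hence so is the former.\<close>
    moreover have "((\<lambda>x. g x \<bullet> J x y) has_derivative (\<lambda>h. g u \<bullet> E y h + H u h \<bullet> J u y)) (at u)" for y
      by (rule has_derivative_inner[OF g_deriv E])
    from symmetric_second_derivative[OF qC q_deriv this[of y] this[of x]]
    have "g u \<bullet> E y x + H u x \<bullet> J u y = g u \<bullet> E x y + H u y \<bullet> J u x" .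
    ultimately show ?thesis by simp
  qed
  have H_lower: "\<beta> * (norm y)\<^sup>2 \<le> H u y \<bullet> y" and H_upper: "H u y \<bullet> y \<le> \<alpha> / 2 * (norm y)\<^sup>2" for u y
    using entropy_hessian[of u] unfolding quad_le_def H_def
    by (simp_all add: scaleR_matrix_vector_assoc[symmetric] power2_norm_eq_inner inner_commute)
  have H_nonneg: "0 \<le> H u y \<bullet> y" for u y
    using H_lower[of y u] entropy_pos by (meson mult_nonneg_nonneg order_trans zero_le_power2 less_imp_le)
  have Hlin: "linear (H u)" for u unfolding H_def by simp
  have H_norm: "norm (H u y) \<le> \<alpha> / 2 * norm y" for u y
    by (rule quad_form_bounds_imp_norm_le(2)[OF Hlin H_sym _ H_nonneg H_upper]) (use entropy_pos in simp)
  have A_lin: "bounded_linear ((*v) A)" by simp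
  have A_sym: "(A *v x) \<bullet> y = x \<bullet> (A *v y)" for x y
    using A sym_matrix_inner unfolding sym_pos_def_def by blast
  obtain a\<^sub>0 where a\<^sub>0: "0 < a\<^sub>0" "\<And>x. a\<^sub>0 * (norm x)\<^sup>2 \<le> x \<bullet> (A *v x)"
    using pos_def_coercive[OF A_lin] A unfolding sym_pos_def_def by metis
  obtain a\<^sub>1 where a\<^sub>1: "0 < a\<^sub>1" "\<And>x. norm (A *v x) \<le> a\<^sub>1 * norm x"
    using bounded_linear.pos_bounded[OF A_lin] by (metis mult.commute)
  have sub: "\<nu> * (norm y)\<^sup>2 + \<alpha> * (norm (J u y))\<^sup>2 \<le> H u y \<bullet> (A *v y)" for u y
  proof -
    have "\<nu> * (y \<bullet> y) \<le> (1 / 2) * (y \<bullet> (A *v H u y) + y \<bullet> H u (A *v y)) - \<alpha> * (y \<bullet> (transpose (jacobian F (at u)) *v J u y))"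
      using subchar[of u] unfolding quad_le_def H_def J_def
      by (simp add: scaleR_matrix_vector_assoc[symmetric] matrix_vector_mult_add_rdistrib matrix_vector_mult_diff_rdistrib matrix_vector_mul_assoc inner_simps)
    moreover have "y \<bullet> (transpose (jacobian F (at u)) *v J u y) = J u y \<bullet> J u y"
      unfolding J_def using dot_lmul_matrix[of y "transpose (jacobian F (at u))"] 
      by (simp add: vector_transpose_matrix)
    moreover have "y \<bullet> (A *v H u y) = H u y \<bullet> (A *v y)" "y \<bullet> H u (A *v y) = H u y \<bullet> (A *v y)"
      using A_sym[of y "H u y"] H_sym[of u y "A *v y"] inner_commute by metis+
    ultimately show ?thesis by (simp add: power2_norm_eq_inner)
  qed
  \<comment> \<open>\<open>a\<^sub>1 + 1\<close> is a convenient bound for the square root of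
    \<open>a\<^sub>1 / 2\<close>, the constant that \<open>sub\<close> gives.\<close>
  have J_norm: "norm (J u y) \<le> (a\<^sub>1 + 1) * norm y" for u y
  proof -
    have "\<alpha> * (norm (J u y))\<^sup>2 \<le> H u y \<bullet> (A *v y)"
      using sub[of y u] mult_nonneg_nonneg[OF less_imp_le[OF subchar_pos] zero_le_power2[of "norm y"]] by linarith
    also have "\<dots> \<le> norm (H u y) * norm (A *v y)" by (rule norm_cauchy_schwarz)
    also have "\<dots> \<le> (\<alpha> / 2 * norm y) * (a\<^sub>1 * norm y)"
      by (rule mult_mono[OF H_norm a\<^sub>1(2)]) (use entropy_pos in auto)
    also have "\<dots> \<le> \<alpha> * ((a\<^sub>1 + 1) * norm y)\<^sup>2"
    proof -
      have "\<alpha> * (norm y)\<^sup>2 * (a\<^sub>1 / 2) \<le> \<alpha> * (norm y)\<^sup>2 * (a\<^sub>1 + 1)\<^sup>2"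
        using a\<^sub>1 entropy_pos by (intro mult_left_mono) (auto simp: power2_eq_square algebra_simps)
      then show ?thesis by (simp add: power2_eq_square algebra_simps)
    qed
    finally have "(norm (J u y))\<^sup>2 \<le> ((a\<^sub>1 + 1) * norm y)\<^sup>2"
      using entropy_pos(1) by (simp only: mult_le_cancel_left_pos)
    then show ?thesis by (rule power2_le_imp_le) (use a\<^sub>1(1) in simp)
  qed
  have J_lip: "norm (J u y - J v y) \<le> M * norm (u - v) * norm y" for u v y
  proof -
    have md: "multi_deriv F [y] = (\<lambda>x. frechet_derivative F (at x) y)"
      by (rule ext) (simp add: multi_deriv_Nil)
    have "norm (frechet_derivative (\<lambda>x. frechet_derivative F (at x) y) (at x) h) \<le> (M * norm y) * norm h" for x h
      using M_bounds(1)[of x, unfolded deriv_norm_le_def, rule_format, of "[h, y]"]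
      unfolding multi_deriv.simps(2)[of _ h] md by (simp add: algebra_simps)
    then have "norm (J u y - J v y) \<le> (M * norm y) * norm (u - v)"
      by (rule norm_diff_le_of_derivative[OF J_partial])
    then show ?thesis by (simp add: algebra_simps)
  qed
  have H_lip: "norm (H u y - H v y) \<le> M * norm (u - v) * norm y" for u v y
  proof -
    \<comment> \<open>The difference itself serves as third direction, so that the scalar estimate
      for the third derivative bounds \<open>(norm z)\<^sup>2\<close>; one factor
      \<open>norm z\<close> then cancels.\<close>
    define z where "z = H u y - H v y"
    have md1: "multi_deriv \<eta> [z] = (\<lambda>x. frechet_derivative \<eta> (at x) z)"
      by (rule ext) (simp add: multi_deriv_Nil)
    have md: "multi_deriv \<eta> [y, z] = (\<lambda>x. H x y \<bullet> z)"
      unfolding Hfd md1[symmetric] by (rule ext) (rule multi_deriv.simps(2))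
    have "norm (frechet_derivative (\<lambda>x. H x y \<bullet> z) (at x) h) \<le> (M * norm y * norm z) * norm h" for x h
      using M_bounds(2)[of x, unfolded deriv_norm_le_def, rule_format, of "[h, y, z]"]
      unfolding multi_deriv.simps(2)[of _ h] md by (simp add: algebra_simps)
    moreover have "((\<lambda>x. H x y \<bullet> z) has_derivative frechet_derivative (\<lambda>x. H x y \<bullet> z) (at x)) (at x)" for x
      unfolding Hfd by (rule Ck_on_SucD(1)[OF Ck_on_SucD(3)[OF Ck_on_SucD(3)[OF \<eta>C]]])
    ultimately have "norm (H u y \<bullet> z - H v y \<bullet> z) \<le> (M * norm y * norm z) * norm (u - v)"
      by (intro norm_diff_le_of_derivative)
    also have "H u y \<bullet> z - H v y \<bullet> z = (norm z)\<^sup>2"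
      unfolding z_def by (simp add: power2_norm_eq_inner inner_diff_left)
    finally have "norm z * norm z \<le> (M * norm (u - v) * norm y) * norm z"
      by (simp add: power2_eq_square mult.commute mult.left_commute)
    then have "norm z \<le> M * norm (u - v) * norm y"
      using M_pos by (cases "z = 0") (auto simp: mult_le_cancel_right)
    then show ?thesis unfolding z_def .
  qed
  have "entropy_structure \<eta> q R g F G ((*v) A) H J \<alpha> \<beta> \<nu> M (a\<^sub>1 + 1) a\<^sub>0 a\<^sub>1"
  proof (rule entropy_structure.intro)
    show "(g u - g v) \<bullet> (G u - G v) \<le> 0" for u v using weak_dissipation[of u v] unfolding g_def by simp
    show "0 < a\<^sub>1 + 1" using a\<^sub>1 by simp
  qed (fact \<eta>_deriv g_deriv F_deriv q_deriv R_deriv G_cont H_sym HJ_sym H_lower H_upper H_norm H_lip J_norm J_lip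
      sub R_nonneg A_lin A_sym a\<^sub>0 a\<^sub>1 entropy_pos subchar_pos M_pos)+
  then show thesis using that unfolding g_def H_def[abs_def] J_def[abs_def] by blast
qed

section \<open>Twice differentiable sources\<close>

lemma Ck_on_SucI_weaken: "Ck_on (Suc k) S f \<Longrightarrow> Ck_on k S f"
proof (induction k arbitrary: f)
  case 0
  then show ?case using Ck_on_continuous_on[OF 0] by simp
next
  case (Suc k)
  then obtain f' where "\<And>x. x \<in> S \<Longrightarrow> (f has_derivative f' x) (at x within S)" "\<And>h. Ck_on (Suc k) S (\<lambda>x. f' x h)"
    unfolding Ck_on.simps(2)[of "Suc k"] by blast
  with Suc.IH show ?case unfolding Ck_on.simps(2)[of k] by blast
qed

lemma norm_le_sum_Basis:
  fixes l :: "'a::euclidean_space \<Rightarrow> 'b::real_normed_vector"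
  assumes l: "linear l" and b: "\<And>b. b \<in> Basis \<Longrightarrow> norm (l b) \<le> K b"
  shows "norm (l y) \<le> (\<Sum>b\<in>Basis. K b) * norm y"
proof -
  have "l y = l (\<Sum>b\<in>Basis. (y \<bullet> b) *\<^sub>R b)" by (simp add: euclidean_representation)
  also have "\<dots> = (\<Sum>b\<in>Basis. (y \<bullet> b) *\<^sub>R l b)"
    using l by (simp add: linear_sum linear_scale)
  also have "norm \<dots> \<le> (\<Sum>b\<in>Basis. norm ((y \<bullet> b) *\<^sub>R l b))" by (rule norm_sum)
  also have "\<dots> \<le> (\<Sum>b\<in>Basis. norm y * K b)"
    unfolding norm_scaleR using b Basis_le_norm by (intro sum_mono mult_mono) auto
  finally show ?thesis by (simp add: sum_distrib_left mult.commute)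
qed

text \<open>\<open>Ck_on\<close> gives continuity of each directional derivative separately.
  Compactness bounds them along the finitely many basis vectors, and linearity makes the bound
  uniform in the direction.\<close>

lemma Ck_on_derivative_bounded:
  fixes f :: "'a::euclidean_space \<Rightarrow> 'b::real_normed_vector"
  assumes f: "Ck_on (Suc k) UNIV f"
  obtains K where "0 \<le> K" "\<And>x y. x \<in> cball 0 r \<Longrightarrow> norm (frechet_derivative f (at x) y) \<le> K * norm y"
proof -
  have "\<exists>K. \<forall>x\<in>cball 0 r. norm (frechet_derivative f (at x) b) \<le> K" for b
  proof -
    have "continuous_on (cball 0 r) (\<lambda>x. frechet_derivative f (at x) b)"
      using Ck_on_continuous_on[OF Ck_on_SucD(3)[OF f]] continuous_on_subset by blast
    then have "bounded ((\<lambda>x. frechet_derivative f (at x) b) ` cball 0 r)"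
      by (intro compact_imp_bounded compact_continuous_image) auto
    then show ?thesis unfolding bounded_iff by auto
  qed
  then have "\<exists>K. \<forall>b. \<forall>x\<in>cball 0 r. norm (frechet_derivative f (at x) b) \<le> K b" by (intro choice allI)
  then obtain K where K: "\<And>b x. x \<in> cball 0 r \<Longrightarrow> norm (frechet_derivative f (at x) b) \<le> K b" by blast
  show thesis
  proof (rule that[of "\<Sum>b\<in>Basis. \<bar>K b\<bar>"])
    show "0 \<le> (\<Sum>b\<in>Basis. \<bar>K b\<bar>)" by (intro sum_nonneg) auto
    fix x y assume x: "x \<in> cball (0::'a) r"
    show "norm (frechet_derivative f (at x) y) \<le> (\<Sum>b\<in>Basis. \<bar>K b\<bar>) * norm y"
      by (rule norm_le_sum_Basis[OF has_derivative_linear[OF Ck_on_SucD(1)[OF f]]])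
        (rule order_trans[OF K[OF x] abs_ge_self])
  qed
qed

lemma Ck_on_lipschitz:
  fixes f :: "'a::euclidean_space \<Rightarrow> 'b::real_normed_vector"
  assumes f: "Ck_on (Suc k) UNIV f"
  obtains K where "0 \<le> K" "\<And>x y. x \<in> cball 0 r \<Longrightarrow> y \<in> cball 0 r \<Longrightarrow> norm (f x - f y) \<le> K * norm (x - y)"
proof -
  obtain K where K: "0 \<le> K" "\<And>x y. x \<in> cball 0 r \<Longrightarrow> norm (frechet_derivative f (at x) y) \<le> K * norm y"
    using Ck_on_derivative_bounded[OF f, of r] by blast
  have "norm (f x - f y) \<le> K * norm (x - y)" if "x \<in> cball 0 r" "y \<in> cball 0 r" for x y
  proof (rule differentiable_bound[of "cball 0 r" f "\<lambda>x. frechet_derivative f (at x)"])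
    show "(f has_derivative frechet_derivative f (at x)) (at x within cball 0 r)" for x
      using Ck_on_SucD(1)[OF f] has_derivative_at_withinI by blast
    show "onorm (frechet_derivative f (at x)) \<le> K" if "x \<in> cball 0 r" for x
      by (rule onorm_le) (rule K(2)[OF that])
  qed (use that in auto)
  then show thesis using that K(1) by blast
qed

lemma Ck_on_derivative_lipschitz:
  fixes f :: "'a::euclidean_space \<Rightarrow> 'b::real_normed_vector"
  assumes f: "Ck_on (Suc (Suc k)) UNIV f"
  obtains K where "0 \<le> K"
    "\<And>x v y. x \<in> cball 0 r \<Longrightarrow> v \<in> cball 0 r \<Longrightarrow>
      norm (frechet_derivative f (at x) y - frechet_derivative f (at v) y) \<le> K * norm (x - v) * norm y"
proof -
  let ?D = "\<lambda>x. frechet_derivative f (at x)"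
  have "\<exists>K\<ge>0. \<forall>x\<in>cball 0 r. \<forall>v\<in>cball 0 r. norm (?D x b - ?D v b) \<le> K * norm (x - v)" for b
    using Ck_on_lipschitz[OF Ck_on_SucD(3)[OF f, of b], of r] by metis
  then have "\<exists>K. \<forall>b. 0 \<le> K b \<and> (\<forall>x\<in>cball 0 r. \<forall>v\<in>cball 0 r. norm (?D x b - ?D v b) \<le> K b * norm (x - v))"
    by (intro choice allI)
  then obtain K where K: "\<And>b. 0 \<le> K b" "\<And>b x v. x \<in> cball 0 r \<Longrightarrow> v \<in> cball 0 r \<Longrightarrow> norm (?D x b - ?D v b) \<le> K b * norm (x - v)"
    by blast
  show thesis
  proof (rule that[of "\<Sum>b\<in>Basis. K b"])
    show "0 \<le> (\<Sum>b\<in>Basis. K b)" using K(1) by (intro sum_nonneg) auto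
    fix x v y assume x: "x \<in> cball (0::'a) r" "v \<in> cball (0::'a) r"
    have "linear (\<lambda>y. ?D x y - ?D v y)"
      by (intro linear_compose_sub has_derivative_linear[OF Ck_on_SucD(1)[OF f]])
    from norm_le_sum_Basis[OF this, of "\<lambda>b. K b * norm (x - v)", OF K(2)[OF x]]
    show "norm (?D x y - ?D v y) \<le> (\<Sum>b\<in>Basis. K b) * norm (x - v) * norm y"
      by (simp add: sum_distrib_right)
  qed
qed

text \<open>Lyapunov's argument: a minimiser of the quadratic form of \<open>B\<close> on the unit sphere is an
  eigenvector.\<close>

lemma lyapunov_nonneg:
  fixes H B :: "'a::euclidean_space \<Rightarrow> 'a"
  assumes B: "bounded_linear B" and sym: "\<And>x y. B x \<bullet> y = x \<bullet> B y"
    and H: "\<And>x. x \<noteq> 0 \<Longrightarrow> 0 < H x \<bullet> x" and HB: "\<And>x. 0 \<le> H x \<bullet> B x"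
  shows "0 \<le> B y \<bullet> y"
proof -
  note lin = bounded_linear.linear[OF B]
  have "continuous_on (sphere 0 1) (\<lambda>x. x \<bullet> B x)"
    by (intro continuous_intros linear_continuous_on[OF B])
  moreover have "sphere (0::'a) 1 \<noteq> {}" by simp
  ultimately have "\<exists>z\<in>sphere 0 1. \<forall>x\<in>sphere 0 1. z \<bullet> B z \<le> x \<bullet> B x"
    by (intro continuous_attains_inf) simp_all
  then obtain z where z: "z \<in> sphere 0 1" "\<And>x. x \<in> sphere 0 1 \<Longrightarrow> z \<bullet> B z \<le> x \<bullet> B x"
    by blast
  define c where "c = z \<bullet> B z"
  have zz: "z \<bullet> z = 1" using z(1) by (simp add: dot_square_norm)
  have le: "c * (norm x)\<^sup>2 \<le> x \<bullet> B x" for x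
  proof (cases "x = 0")
    case False
    then have "x /\<^sub>R norm x \<in> sphere 0 1" by simp
    then have "c \<le> (x /\<^sub>R norm x) \<bullet> B (x /\<^sub>R norm x)" unfolding c_def by (rule z(2))
    also have "\<dots> = x \<bullet> B x / (norm x)\<^sup>2"
      unfolding linear_scale[OF lin] by (simp add: power2_eq_square divide_inverse)
    finally show ?thesis using False by (simp add: pos_le_divide_eq)
  qed simp
  \<comment> \<open>\<open>P\<close> is positive semidefinite by minimality of \<open>c\<close>, and
    its form vanishes at \<open>z\<close>. Such a form controls the norm of \<open>P z\<close>, so
    \<open>P z = 0\<close> and \<open>z\<close> is an eigenvector of \<open>B\<close> for
    \<open>c\<close>.\<close>
  define P where "P x = B x - c *\<^sub>R x" for x
  obtain K where K: "0 < K" "\<And>x. norm (B x) \<le> norm x * K"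
    using bounded_linear.pos_bounded[OF B] by blast
  have P_upper: "P x \<bullet> x \<le> (K + \<bar>c\<bar>) * (norm x)\<^sup>2" for x
  proof -
    have "B x \<bullet> x \<le> norm (B x) * norm x" by (rule norm_cauchy_schwarz)
    also have "\<dots> \<le> norm x * K * norm x" using K(2) by (intro mult_right_mono) auto
    finally have "B x \<bullet> x \<le> K * (norm x)\<^sup>2" by (simp add: power2_eq_square mult.commute mult.left_commute)
    moreover have "- c * (norm x)\<^sup>2 \<le> \<bar>c\<bar> * (norm x)\<^sup>2" by (intro mult_right_mono) auto
    ultimately show ?thesis unfolding P_def by (simp add: inner_simps power2_norm_eq_inner distrib_right)
  qed
  have "(norm (P z))\<^sup>2 \<le> (K + \<bar>c\<bar>) * (P z \<bullet> z)"
  proof (rule quad_form_bounds_imp_norm_le(1)[OF _ _ _ _ P_upper])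
    show "linear P"
      by (rule linearI) (simp_all add: P_def linear_add[OF lin] linear_scale[OF lin] algebra_simps)
    show "P x \<bullet> y = x \<bullet> P y" for x y unfolding P_def by (simp add: inner_simps sym)
    show "0 \<le> P x \<bullet> x" for x
      using le[of x] unfolding P_def by (simp add: inner_simps power2_norm_eq_inner inner_commute)
  qed (use K in auto)
  also have "P z \<bullet> z = 0" unfolding P_def by (simp add: inner_simps zz c_def inner_commute)
  finally have "B z = c *\<^sub>R z" by (simp add: P_def)
  \<comment> \<open>At the eigenvector \<open>H z \<bullet> B z = c * (H z \<bullet> z)\<close>, so
    positivity of \<open>H\<close> decides the sign of \<open>c\<close>.\<close>
  with HB[of z] have "0 \<le> c * (H z \<bullet> z)" by simp
  moreover have "0 < H z \<bullet> z" by (rule H) (use zz in auto)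
  ultimately have "0 \<le> c" by (simp add: zero_le_mult_iff)
  then show ?thesis using le[of y] by (metis inner_commute mult_nonneg_nonneg order_trans zero_le_power2)
qed

section \<open>Convexity of the source potential and the remainder of \<open>G\<close>\<close>

context entropy_structure
begin

context
  assumes G: "Ck_on 2 UNIV G"
begin

abbreviation "DG u \<equiv> frechet_derivative G (at u)"

lemma G_deriv: "(G has_derivative DG u) (at u)"
  using Ck_on_SucD(1)[of 1 G u] G by (simp add: numeral_2_eq_2)

text \<open>\<open>- G\<close> is the gradient of \<open>R\<close>, so \<open>R\<close> is of class
  C2 and \<open>- DG\<close> is its Hessian.\<close>

lemma DG_sym: "DG u x \<bullet> y = x \<bullet> DG u y"
proof -
  have "Ck_on 1 UNIV G" using Ck_on_SucI_weaken[of 1 UNIV G] G by (simp add: numeral_2_eq_2)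
  then have "Ck_on 1 UNIV (\<lambda>x. - G x \<bullet> h)" for h
    using Ck_on_bounded_linear[OF bounded_linear_minus[OF bounded_linear_inner_left[of h]], of 1 UNIV G] by simp
  then have C: "Ck_on 2 UNIV R"
    using R_deriv unfolding numeral_2_eq_2 Ck_on.simps(2)[of "Suc 0"] One_nat_def
    by (intro exI[of _ "\<lambda>u y. - G u \<bullet> y"]) simp
  have d: "((\<lambda>x. - G x \<bullet> z) has_derivative (\<lambda>h. - DG u h \<bullet> z)) (at u)" for z
    by (rule has_derivative_inner_left[OF has_derivative_minus[OF G_deriv]])
  have "- DG u x \<bullet> y = - DG u y \<bullet> x"
    by (rule symmetric_second_derivative[OF C R_deriv d d])
  then show ?thesis by (simp add: inner_commute)
qed

text \<open>Weak dissipation between \<open>u + s x\<close> and \<open>u\<close>, divided by the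
  square of \<open>s\<close>, in the limit \<open>s \<rightarrow> 0\<close>.\<close>

lemma H_DG: "H u x \<bullet> DG u x \<le> 0"
proof -
  have q: "((\<lambda>s. (f (u + s *\<^sub>R x) - f u) /\<^sub>R s) \<longlongrightarrow> D x) (at 0)"
    if "(f has_derivative D) (at u)" for f :: "'a \<Rightarrow> 'a" and D
  proof -
    have "((\<lambda>s::real. u + s *\<^sub>R x) has_vector_derivative x) (at 0)"
      unfolding has_vector_derivative_def by (auto intro!: derivative_eq_intros)
    then have "((\<lambda>s. f (u + s *\<^sub>R x)) has_vector_derivative D x) (at 0)"
      using has_vector_derivative_chain[where u="\<lambda>s::real. u + s *\<^sub>R x" and t=0 and f=f and D=D] that by simp
    then have "((\<lambda>h. norm (f (u + h *\<^sub>R x) - f u - h *\<^sub>R D x) / norm h) \<longlongrightarrow> 0) (at 0)"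
      unfolding has_vector_derivative_def has_derivative_at by simp
    then have "((\<lambda>h. norm ((f (u + h *\<^sub>R x) - f u) /\<^sub>R h - D x)) \<longlongrightarrow> 0) (at 0)"
    proof (rule Lim_transform_eventually)
      have "norm (f (u + h *\<^sub>R x) - f u - h *\<^sub>R D x) / norm h = norm ((f (u + h *\<^sub>R x) - f u) /\<^sub>R h - D x)"
        if "h \<noteq> 0" for h :: real
      proof -
        have "(f (u + h *\<^sub>R x) - f u) /\<^sub>R h - D x = (f (u + h *\<^sub>R x) - f u - h *\<^sub>R D x) /\<^sub>R h"
          using that by (simp add: scaleR_diff_right)
        then show ?thesis by (simp add: divide_inverse mult.commute)
      qed
      then show "\<forall>\<^sub>F h in at 0. norm (f (u + h *\<^sub>R x) - f u - h *\<^sub>R D x) / norm h = norm ((f (u + h *\<^sub>R x) - f u) /\<^sub>R h - D x)"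
        unfolding eventually_at by (auto intro: exI[of _ 1])
    qed
    then show ?thesis by (simp add: LIM_zero_iff tendsto_norm_zero_iff)
  qed
  have "((\<lambda>s. ((g (u + s *\<^sub>R x) - g u) /\<^sub>R s) \<bullet> ((G (u + s *\<^sub>R x) - G u) /\<^sub>R s)) \<longlongrightarrow> H u x \<bullet> DG u x) (at 0)"
    by (intro tendsto_intros q g_deriv G_deriv)
  \<comment> \<open>At \<open>s = 0\<close> both quotients are \<open>0\<close> by the convention
    for \<open>inverse 0\<close>, so the bound holds for every \<open>s\<close>.\<close>
  moreover have "((g (u + s *\<^sub>R x) - g u) /\<^sub>R s) \<bullet> ((G (u + s *\<^sub>R x) - G u) /\<^sub>R s) \<le> 0" for s
    using dissipation[of "u + s *\<^sub>R x" u]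
    by (simp add: mult.assoc[symmetric] mult_nonneg_nonpos)
  ultimately show ?thesis
    by (intro tendsto_upperbound[where F="at (0::real)"]) (auto intro: always_eventually)
qed

text \<open>\<open>H_DG\<close> concerns the product of \<open>H\<close> and \<open>DG\<close>, not
  \<open>DG\<close> itself. Because \<open>- DG\<close> is symmetric and \<open>H\<close> positive
  definite, \<open>lyapunov_nonneg\<close> makes \<open>- DG\<close> positive semidefinite, and the
  Taylor formula for \<open>R\<close> concludes.\<close>

lemma Rrel_nonneg: "0 \<le> R z - R y + G y \<bullet> (z - y)"
proof -
  have "0 \<le> - DG \<xi> x \<bullet> x" for \<xi> x
  proof (rule lyapunov_nonneg[of "\<lambda>x. - DG \<xi> x" "H \<xi>"])
    show "bounded_linear (\<lambda>x. - DG \<xi> x)"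
      using has_derivative_bounded_linear[OF G_deriv] bounded_linear_minus by blast
    show "- DG \<xi> x \<bullet> y = x \<bullet> - DG \<xi> y" for x y by (simp add: DG_sym)
    show "0 < H \<xi> x \<bullet> x" if "x \<noteq> 0" for x
      using H_lower[of x \<xi>] pos that by (meson less_le_trans mult_pos_pos zero_less_norm_iff zero_less_power)
    show "0 \<le> H \<xi> x \<bullet> - DG \<xi> x" for x using H_DG by simp
  qed
  moreover obtain \<xi> where "R z - R y - (- G y) \<bullet> (z - y) = (- DG \<xi> (z - y) \<bullet> (z - y)) / 2"
    using taylor2_along_segment[OF R_deriv has_derivative_minus[OF G_deriv], of z y] by blast
  ultimately show ?thesis by simp
qed

text \<open>Close to \<open>v\<close> the Taylor estimate on a ball suffices. Far from
  \<open>v\<close> no derivative bound along the segment is at hand; there the growth condition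
  bounds \<open>G u\<close> by \<open>R u\<close>, and \<open>R u\<close> is the relative potential
  plus terms at most linear in \<open>u - v\<close>, which the square dominates once
  \<open>norm (u - v) > 1\<close>.\<close>

lemma G_remainder:
  assumes growth: "\<And>u. norm (G u) \<le> C * (1 + R u)"
  obtains K where "0 \<le> K" "\<And>u v. norm v \<le> B \<Longrightarrow>
    norm (G u - G v - DG v (u - v)) \<le> K * ((norm (u - v))\<^sup>2 + (R u - R v + G v \<bullet> (u - v)))"
proof -
  have G2: "Ck_on (Suc (Suc 0)) UNIV G" using G by (simp add: numeral_2_eq_2)
  \<comment> \<open>The radius \<open>B + 1\<close> covers the segment from \<open>v\<close> to
    \<open>u\<close> when \<open>norm (u - v) \<le> 1\<close>.\<close>
  obtain K1 where K1: "0 \<le> K1" "\<And>x v y. x \<in> cball 0 (B + 1) \<Longrightarrow> v \<in> cball 0 (B + 1) \<Longrightarrow>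
      norm (DG x y - DG v y) \<le> K1 * norm (x - v) * norm y"
    using Ck_on_derivative_lipschitz[OF G2, of "B + 1"] by blast
  obtain K2 where K2: "0 \<le> K2" "\<And>v y. v \<in> cball 0 B \<Longrightarrow> norm (DG v y) \<le> K2 * norm y"
    using Ck_on_derivative_bounded[OF G2, of B] by blast
  have bdd: "\<exists>K. \<forall>v\<in>cball 0 B. norm (f v) \<le> K" if "continuous_on UNIV f" for f :: "'a \<Rightarrow> 'c::real_normed_vector"
  proof -
    have "bounded (f ` cball 0 B)"
      using that by (intro compact_imp_bounded compact_continuous_image) (auto intro: continuous_on_subset)
    then show ?thesis unfolding bounded_iff by auto
  qed
  obtain K3 where K3: "\<And>v. v \<in> cball 0 B \<Longrightarrow> norm (G v) \<le> K3" using bdd[OF G_cont] by blast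
  have "continuous_on UNIV R"
    using R_deriv by (auto intro!: continuous_at_imp_continuous_on has_derivative_continuous)
  then obtain K4 where K4: "\<And>v. v \<in> cball 0 B \<Longrightarrow> norm (R v) \<le> K4" using bdd by blast
  define K where "K = K1 + \<bar>C\<bar> * (1 + \<bar>K4\<bar> + \<bar>K3\<bar>) + \<bar>K3\<bar> + K2"
  have p: "0 \<le> \<bar>C\<bar> * (1 + \<bar>K4\<bar> + \<bar>K3\<bar>)" by auto
  show thesis
  proof (rule that[of K])
    show "0 \<le> K" unfolding K_def using K1 K2 p by linarith
    fix u v :: 'a assume v: "norm v \<le> B"
    define X Q where "X = norm (u - v)" and "Q = R u - R v + G v \<bullet> (u - v)"
    have Q: "0 \<le> Q" unfolding Q_def by (rule Rrel_nonneg)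
    have X: "0 \<le> X" unfolding X_def by simp
    show "norm (G u - G v - DG v (u - v)) \<le> K * (X\<^sup>2 + Q)"
    proof (cases "X \<le> 1")
      case True
      have cb: "x \<in> cball 0 (B + 1)" if "x \<in> closed_segment v u" for x
      proof -
        have "norm (x - v) \<le> 1" using segment_bound1[OF that] True unfolding X_def by (simp add: norm_minus_commute)
        then have "norm x \<le> norm v + 1" using norm_triangle_sub[of x v] by linarith
        then show ?thesis using v by simp
      qed
      have "norm (G u - G v - DG v (u - v)) \<le> K1 * X\<^sup>2"
        unfolding X_def
        by (rule norm_remainder_le[OF G_deriv]) (use K1 cb in auto)
      also have "\<dots> \<le> K * (X\<^sup>2 + Q)"
        using K1 K2 p Q unfolding K_def by (intro mult_mono) auto
      finally show ?thesis .
    next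
      case False
      then have X1: "1 \<le> X\<^sup>2" "X \<le> X\<^sup>2"
        using one_le_power[of X 2] mult_left_mono[of 1 X X] X by (auto simp: power2_eq_square)
      have vB: "v \<in> cball 0 B" using v by simp
      have Gv: "norm (G v) \<le> \<bar>K3\<bar>" using K3[OF vB] by simp
      have Rv: "R v \<le> \<bar>K4\<bar>" using K4[OF vB] by simp
      have S: "1 \<le> X\<^sup>2 + Q" "X \<le> X\<^sup>2 + Q" "Q \<le> X\<^sup>2 + Q" using X1 Q by auto
      have "- (G v \<bullet> (u - v)) \<le> \<bar>K3\<bar> * X" unfolding X_def by (rule minus_inner_le[OF Gv]) simp
      then have Ru: "1 + R u \<le> 1 + Q + \<bar>K4\<bar> + \<bar>K3\<bar> * X" using Rv unfolding Q_def by linarith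
      have "norm (G u) \<le> C * (1 + R u)" by (rule growth)
      also have "\<dots> \<le> \<bar>C\<bar> * (1 + R u)" using R_nonneg[of u] by (intro mult_right_mono) auto
      also have "\<dots> \<le> \<bar>C\<bar> * (1 + Q + \<bar>K4\<bar> + \<bar>K3\<bar> * X)" using Ru by (intro mult_left_mono) auto
      also have "\<dots> \<le> \<bar>C\<bar> * ((1 + \<bar>K4\<bar> + \<bar>K3\<bar>) * (X\<^sup>2 + Q))"
      proof (intro mult_left_mono)
        have "\<bar>K4\<bar> * 1 \<le> \<bar>K4\<bar> * (X\<^sup>2 + Q)" "\<bar>K3\<bar> * X \<le> \<bar>K3\<bar> * (X\<^sup>2 + Q)"
          using mult_left_mono[OF S(1), of "\<bar>K4\<bar>"] mult_left_mono[OF S(2), of "\<bar>K3\<bar>"] by auto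
        then show "1 + Q + \<bar>K4\<bar> + \<bar>K3\<bar> * X \<le> (1 + \<bar>K4\<bar> + \<bar>K3\<bar>) * (X\<^sup>2 + Q)"
          using X1 by (simp add: distrib_right)
      qed auto
      finally have 1: "norm (G u) \<le> \<bar>C\<bar> * (1 + \<bar>K4\<bar> + \<bar>K3\<bar>) * (X\<^sup>2 + Q)" by (simp add: mult.assoc)
      have 2: "norm (G v) \<le> \<bar>K3\<bar> * (X\<^sup>2 + Q)"
        using Gv mult_left_mono[OF S(1), of "\<bar>K3\<bar>"] by simp
      have "norm (DG v (u - v)) \<le> K2 * X" unfolding X_def by (rule K2(2)[OF vB])
      also have "\<dots> \<le> K2 * (X\<^sup>2 + Q)" using S K2 by (intro mult_left_mono) auto
      finally have 3: "norm (DG v (u - v)) \<le> K2 * (X\<^sup>2 + Q)" .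
      have 4: "0 \<le> K1 * (X\<^sup>2 + Q)" using K1 Q by auto
      have "norm (G u - G v - DG v (u - v)) \<le> norm (G u) + norm (G v) + norm (DG v (u - v))"
        by (meson add_right_mono norm_triangle_ineq4 order_trans)
      also have "\<dots> \<le> K * (X\<^sup>2 + Q)"
        using 1 2 3 4 unfolding K_def by (simp only: distrib_right)
      finally show ?thesis .
    qed
  qed
qed

end

end

section \<open>The stability theorem\<close>

lemma smooth_stripD: "smooth_strip T u \<Longrightarrow> Ck_on k (UNIV \<times> {0..T}) (\<lambda>(x, t). u x t)"
  unfolding smooth_strip_def smooth_on_def by blast

lemma smooth_strip_dx:
  fixes u :: "real \<Rightarrow> real \<Rightarrow> 'a::euclidean_space"
  assumes "0 < T" "smooth_strip T u"
  shows "smooth_strip T (dx u)"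
  unfolding smooth_strip_def smooth_on_def
  using strip_partial_derivatives(1)[OF assms(1) smooth_stripD[OF assms(2)]] by simp

lemma smooth_strip_dt:
  fixes u :: "real \<Rightarrow> real \<Rightarrow> 'a::euclidean_space"
  assumes "0 < T" "smooth_strip T u"
  shows "smooth_strip T (dt T u)"
  unfolding smooth_strip_def smooth_on_def
  using strip_partial_derivatives(2)[OF assms(1) smooth_stripD[OF assms(2)]] by simp

text \<open>\<open>decays\<close> speaks of \<open>dx (dt T u)\<close> as the mixed derivative;
  \<open>strip_mixed_derivative\<close> identifies it with the time derivative of
  \<open>dx u\<close>.\<close>

lemma profile_of_decays:
  fixes u :: "real \<Rightarrow> real \<Rightarrow> 'a::euclidean_space"
  assumes T: "0 < T" and u: "smooth_strip T u" and d: "decays T u"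
  obtains h where "profile T u (dt T u) (dx u) (dt T (dt T u)) (dx (dt T u)) (dx (dx u)) h"
proof -
  note ut = smooth_strip_dt[OF T u] and ux = smooth_strip_dx[OF T u]
  note p = strip_partial_derivatives(3,4)[OF T smooth_stripD[of T _ 1, unfolded One_nat_def]]
  obtain h where h: "integrable lborel h"
    "\<And>i j x t. i + j \<le> 2 \<Longrightarrow> t \<in> {0..T} \<Longrightarrow> (norm ((dx ^^ i) ((dt T ^^ j) u) x t))\<^sup>2 \<le> h x"
  proof -
    from conjunct2[OF d[unfolded decays_def]] obtain h where "integrable lborel h \<and>
      (\<forall>i j. i + j \<le> 2 \<longrightarrow> (\<forall>x. \<forall>t\<in>{0..T}. (norm ((dx ^^ i) ((dt T ^^ j) u) x t))\<^sup>2 \<le> h x))" ..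
    then show thesis by (intro that[of h]) simp_all
  qed
  have l: "((\<lambda>x. (dx ^^ i) ((dt T ^^ j) u) x t) \<longlongrightarrow> 0) at_infinity" if "i + j \<le> 2" "t \<in> {0..T}" for i j t
  proof -
    have "uniform_limit {0..T} (\<lambda>x t. (dx ^^ i) ((dt T ^^ j) u) x t) (\<lambda>t. 0) at_infinity"
      using conjunct1[OF d[unfolded decays_def]] that(1) by simp
    from tendsto_uniform_limitI[OF this that(2)] show ?thesis .
  qed
  have "profile T u (dt T u) (dx u) (dt T (dt T u)) (dx (dt T u)) (dx (dx u)) h"
  proof (rule profile.intro)
    fix t assume t: "t \<in> {0..T}"
    show "((\<lambda>x. u x t) \<longlongrightarrow> 0) at_infinity" "((\<lambda>x. dt T u x t) \<longlongrightarrow> 0) at_infinity" "((\<lambda>x. dx u x t) \<longlongrightarrow> 0) at_infinity"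
      using l[OF _ t, of 0 0] l[OF _ t, of 0 1] l[OF _ t, of 1 0] by simp_all
    fix x
    show "((\<lambda>s. dx u x s) has_vector_derivative dx (dt T u) x t) (at t within {0..T})"
      by (rule strip_mixed_derivative[OF T smooth_stripD[OF u] t])
    show "(norm (u x t))\<^sup>2 \<le> h x" "(norm (dt T u x t))\<^sup>2 \<le> h x" "(norm (dx u x t))\<^sup>2 \<le> h x"
      "(norm (dt T (dt T u) x t))\<^sup>2 \<le> h x" "(norm (dx (dt T u) x t))\<^sup>2 \<le> h x" "(norm (dx (dx u) x t))\<^sup>2 \<le> h x"
      using h(2)[OF _ t, of 0 0] h(2)[OF _ t, of 0 1] h(2)[OF _ t, of 1 0] h(2)[OF _ t, of 0 2]
        h(2)[OF _ t, of 1 1] h(2)[OF _ t, of 2 0] by (simp_all add: numeral_2_eq_2)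
    show "((\<lambda>s. u x s) has_vector_derivative dt T u x t) (at t within {0..T})"
      "((\<lambda>s. dt T u x s) has_vector_derivative dt T (dt T u) x t) (at t within {0..T})"
      "((\<lambda>z. u z t) has_vector_derivative dx u x t) (at x)"
      "((\<lambda>z. dt T u z t) has_vector_derivative dx (dt T u) x t) (at x)"
      "((\<lambda>z. dx u z t) has_vector_derivative dx (dx u) x t) (at x)"
      by (fact p(2)[OF u t] p(2)[OF ut t] p(1)[OF u t] p(1)[OF ut t] p(1)[OF ux t])+
  qed (fact h(1) T)+
  then show thesis by (rule that)
qed

text \<open>Uniform decay bounds \<open>f\<close> by \<open>1\<close> outside a compact rectangle,
  and continuity bounds it inside.\<close>

lemma strip_bounded:
  fixes f :: "real \<Rightarrow> real \<Rightarrow> 'a::real_normed_vector"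
  assumes c: "continuous_on (UNIV \<times> {0..T}) (\<lambda>(x, t). f x t)"
    and l: "uniform_limit {0..T} (\<lambda>x t. f x t) (\<lambda>t. 0) at_infinity"
  shows "\<exists>B. \<forall>x. \<forall>t\<in>{0..T}. norm (f x t) \<le> B"
proof -
  have "\<forall>\<^sub>F x in at_infinity. \<forall>t\<in>{0..T}. dist (f x t) 0 < 1"
    using uniform_limitD[OF l, of 1] by simp
  then obtain r where r: "\<forall>x. r \<le> norm x \<longrightarrow> (\<forall>t\<in>{0..T}. dist (f x t) 0 < 1)"
    unfolding eventually_at_infinity ..
  have "compact ((\<lambda>(x, t). f x t) ` ({- r..r} \<times> {0..T}))"
    by (rule compact_continuous_image[OF continuous_on_subset[OF c]]) (auto intro: compact_Times)
  from compact_imp_bounded[OF this]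
  obtain K where K: "\<forall>y\<in>(\<lambda>(x, t). f x t) ` ({- r..r} \<times> {0..T}). norm y \<le> K"
    unfolding bounded_iff ..
  have "norm (f x t) \<le> max 1 K" if t: "t \<in> {0..T}" for x t
  proof (cases "r \<le> norm x")
    case True
    then have "dist (f x t) 0 < 1" using r t by simp
    then show ?thesis by simp
  next
    case False
    then have "(x, t) \<in> {- r..r} \<times> {0..T}" using t by auto
    then have "norm (f x t) \<le> K" using K by simp
    then show ?thesis by simp
  qed
  then show ?thesis by blast
qed

lemma decays_bounded:
  fixes u :: "real \<Rightarrow> real \<Rightarrow> 'a::euclidean_space"
  assumes T: "0 < T" and u: "smooth_strip T u" and d: "decays T u"
  obtains B where "\<And>x t. t \<in> {0..T} \<Longrightarrow> norm (u x t) \<le> B" "\<And>x t. t \<in> {0..T} \<Longrightarrow> norm (dt T u x t) \<le> B"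
    "\<And>x t. t \<in> {0..T} \<Longrightarrow> norm (dx u x t) \<le> B"
proof -
  have c: "continuous_on (UNIV \<times> {0..T}) (\<lambda>(x, t). v x t)" if "smooth_strip T v" for v :: "real \<Rightarrow> real \<Rightarrow> 'a"
    by (rule Ck_on_continuous_on[OF smooth_stripD[OF that, of 0]])
  have l: "uniform_limit {0..T} (\<lambda>x t. (dx ^^ i) ((dt T ^^ j) u) x t) (\<lambda>t. 0) at_infinity" if "i + j \<le> 2" for i j
    using conjunct1[OF d[unfolded decays_def]] that by simp
  obtain B0 where B0: "\<And>x t. t \<in> {0..T} \<Longrightarrow> norm (u x t) \<le> B0"
    using strip_bounded[OF c[OF u] l[of 0 0, simplified]] by blast
  obtain B1 where B1: "\<And>x t. t \<in> {0..T} \<Longrightarrow> norm (dt T u x t) \<le> B1"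
    using strip_bounded[OF c[OF smooth_strip_dt[OF T u]] l[of 0 1, simplified]] by blast
  obtain B2 where B2: "\<And>x t. t \<in> {0..T} \<Longrightarrow> norm (dx u x t) \<le> B2"
    using strip_bounded[OF c[OF smooth_strip_dx[OF T u]] l[of 1 0, simplified]] by blast
  show thesis
    by (rule that[of "max B0 (max B1 B2)"]) (use B0 B1 B2 in \<open>auto simp: le_max_iff_disj\<close>)
qed

text \<open>The \<open>x\<close>-derivative of the second equation. The antiderivative contributes
  \<open>G (u x t)\<close> whatever its free function of \<open>t\<close> is, and the first equation
  gives \<open>v\<^sub>t\<^sub>x = - u\<^sub>t\<^sub>t\<close> once the order of differentiation is
  exchanged.\<close>

lemma relaxation_solution_wave_equation:
  fixes u v :: "real \<Rightarrow> real \<Rightarrow> real^'n"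
  assumes T: "0 < T" and \<epsilon>: "0 < \<epsilon>" and s: "relaxation_solution A F G T \<epsilon> u v"
    and F: "\<And>z. (F has_derivative J z) (at z)" and t: "t \<in> {0..T}"
  shows "dt T u x t + J (u x t) (dx u x t) = G (u x t) + \<epsilon> *\<^sub>R (A *v dx (dx u) x t - dt T (dt T u) x t)"
proof -
  have u: "smooth_strip T u" and v: "smooth_strip T v" and uv: "\<And>x t. t \<in> {0..T} \<Longrightarrow> dx v x t = - dt T u x t"
    using s unfolding relaxation_solution_def by (auto simp: eq_neg_iff_add_eq_0 add.commute)
  obtain \<Gamma> where \<Gamma>: "\<And>x t. t \<in> {0..T} \<Longrightarrow> ((\<lambda>z. \<Gamma> z t) has_vector_derivative G (u x t)) (at x)"
    "\<And>x t. t \<in> {0..T} \<Longrightarrow> dt T v x t + A *v dx u x t = - (1 / \<epsilon>) *\<^sub>R (v x t - F (u x t) + \<Gamma> x t)"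
    using s unfolding relaxation_solution_def by blast
  note p = strip_partial_derivatives(3,4)[OF T smooth_stripD[of T _ 1, unfolded One_nat_def]]
  note ut = smooth_strip_dt[OF T u] and ux = smooth_strip_dx[OF T u] and vt = smooth_strip_dt[OF T v]
  have d1: "((\<lambda>s. - dt T u x s) has_vector_derivative dx (dt T v) x t) (at t within {0..T})"
    by (rule has_vector_derivative_transform[OF t _ strip_mixed_derivative[OF T smooth_stripD[OF v] t]]) (simp add: uv)
  have d2: "((\<lambda>s. - dt T u x s) has_vector_derivative - dt T (dt T u) x t) (at t within {0..T})"
    by (rule has_vector_derivative_minus[OF p(2)[OF ut t]])
  \<comment> \<open>Two values of the same derivative within \<open>{0..T}\<close>, that of
    \<open>dx v = - dt T u\<close>; it is unique because \<open>0 < T\<close>.\<close>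
  have vtx: "dx (dt T v) x t = - dt T (dt T u) x t"
    using vector_derivative_unique_within_closed_interval[of 0 T t, unfolded cbox_interval, OF T t d1 d2] .
  have "((\<lambda>z. dt T v z t + A *v dx u z t) has_vector_derivative dx (dt T v) x t + A *v dx (dx u) x t) (at x)"
    by (intro has_vector_derivative_add p(1)[OF vt t] p(1)[OF ux t]
        bounded_linear.has_vector_derivative[OF matrix_vector_mul_bounded_linear])
  moreover have "((\<lambda>z. - (1 / \<epsilon>) *\<^sub>R (v z t - F (u z t) + \<Gamma> z t)) has_vector_derivative
      - (1 / \<epsilon>) *\<^sub>R (dx v x t - J (u x t) (dx u x t) + G (u x t))) (at x)"
    by (intro bounded_linear.has_vector_derivative[OF bounded_linear_scaleR_right] has_vector_derivative_add
        has_vector_derivative_diff \<Gamma>(1)[OF t] p(1)[OF v t] has_vector_derivative_chain[OF F p(1)[OF u t]])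
  ultimately have "dx (dt T v) x t + A *v dx (dx u) x t = - (1 / \<epsilon>) *\<^sub>R (dx v x t - J (u x t) (dx u x t) + G (u x t))"
    unfolding \<Gamma>(2)[OF t] by (rule vector_derivative_unique_at)
  then have "\<epsilon> *\<^sub>R (A *v dx (dx u) x t - dt T (dt T u) x t) = - (- dt T u x t - J (u x t) (dx u x t) + G (u x t))"
    unfolding vtx uv[OF t] using \<epsilon> by simp
  then show ?thesis by simp
qed

theorem theorem5p3p1:
  fixes F G :: "real^'n \<Rightarrow> real^'n"
    and \<eta> q R :: "real^'n \<Rightarrow> real"
    and A :: "real^'n^'n"
    and ubar :: "real \<Rightarrow> real \<Rightarrow> real^'n"
    and T \<alpha> \<beta> \<nu> M C\<^sub>R :: real
  assumes T: "0 < T"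
    and F_smooth: "smooth_on UNIV F"
    and G_cont: "continuous_on UNIV G" and G_0: "G 0 = 0"
    and A: "sym_pos_def A"
    and ubar: "balance_law_solution F G T ubar" "decays T ubar"
    and entropy_smooth: "smooth_on UNIV \<eta>" "smooth_on UNIV q"
    and entropy_pos: "0 < \<alpha>" "0 < \<beta>"
    and entropy_convex: "strictly_convex \<eta>"
    and entropy_flux: "\<And>u. grad \<eta> u v* jacobian F (at u) = grad q u"
    and entropy_hessian:
      "\<And>u. quad_le (\<beta> *\<^sub>R mat 1) (hessian \<eta> u)"
      "\<And>u. quad_le (hessian \<eta> u) ((\<alpha> / 2) *\<^sub>R mat 1)"
    and entropy_min: "\<And>u. \<eta> 0 \<le> \<eta> u" "\<eta> 0 = 0" "grad \<eta> 0 = 0"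
    and subchar_pos: "0 < \<nu>"
    and subchar: "\<And>u. quad_le (\<nu> *\<^sub>R mat 1)
        ((1 / 2) *\<^sub>R (A ** hessian \<eta> u + hessian \<eta> u ** A)
         - \<alpha> *\<^sub>R (transpose (jacobian F (at u)) ** jacobian F (at u)))"
    and M_pos: "0 < M"
    and M_bounds: "\<And>u. deriv_norm_le 2 F u M" "\<And>u. deriv_norm_le 3 \<eta> u M"
    and weak_dissipation: "\<And>u w. - ((grad \<eta> u - grad \<eta> w) \<bullet> (G u - G w)) \<ge> 0"
    and potential_diff: "\<And>u. R differentiable at u"
    and potential: "\<And>u. G u = - grad R u"
    and potential_min: "\<And>u. R 0 \<le> R u" "R 0 = 0" "grad R 0 = 0"
    and potential_growth: "\<And>u. norm (grad R u) \<le> C\<^sub>R * (1 + R u)"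
  shows
    "(\<exists>C>0. \<forall>U V.
        (\<forall>\<epsilon>\<in>{0<..1}. relaxation_solution A F G T \<epsilon> (U \<epsilon>) (V \<epsilon>) \<and> decays T (U \<epsilon>) \<and>
             (\<forall>t\<in>{0..T}. integrable lborel (\<lambda>x. R (U \<epsilon> x t)))) \<longrightarrow>
        (\<forall>\<epsilon>\<in>{0<..1}. \<forall>t\<in>{0..T}.
           Psi T \<epsilon> ubar (U \<epsilon>) t + \<epsilon> * (\<integral>x. R (U \<epsilon> x t) \<partial>lborel)
           \<le> C * (Psi T \<epsilon> ubar (U \<epsilon>) 0 + \<epsilon> * (\<integral>x. R (U \<epsilon> x 0) \<partial>lborel) + \<epsilon>)))
     \<and>
     (Ck_on 2 UNIV G \<longrightarrow>
      (\<exists>C>0. \<forall>U V.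
        (\<forall>\<epsilon>\<in>{0<..1}. relaxation_solution A F G T \<epsilon> (U \<epsilon>) (V \<epsilon>) \<and> decays T (U \<epsilon>) \<and>
             (\<forall>t\<in>{0..T}. integrable lborel (\<lambda>x. R (U \<epsilon> x t)))) \<longrightarrow>
        (\<forall>\<epsilon>\<in>{0<..1}. \<forall>t\<in>{0..T}.
           Psi T \<epsilon> ubar (U \<epsilon>) t + \<epsilon> * (\<integral>x. Rrel R (ubar x t) (U \<epsilon> x t) \<partial>lborel)
           \<le> C * (Psi T \<epsilon> ubar (U \<epsilon>) 0
                    + \<epsilon> * (\<integral>x. Rrel R (ubar x 0) (U \<epsilon> x 0) \<partial>lborel) + \<epsilon>\<^sup>2))))"
proof -
  define H J where "H = (\<lambda>u. (*v) (hessian \<eta> u))" and "J = (\<lambda>u. (*v) (jacobian F (at u)))"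
  have R_nonneg: "0 \<le> R u" for u using potential_min(1)[of u] potential_min(2) by simp
  obtain L a\<^sub>0 a\<^sub>1 where "entropy_structure \<eta> q R (grad \<eta>) F G ((*v) A) H J \<alpha> \<beta> \<nu> M L a\<^sub>0 a\<^sub>1"
    unfolding H_def J_def
    by (rule entropy_structure_of_hypotheses[OF F_smooth G_cont A entropy_smooth entropy_pos entropy_flux
        entropy_hessian subchar_pos subchar M_pos M_bounds weak_dissipation potential_diff potential R_nonneg]) blast+
  then interpret E: entropy_structure \<eta> q R "grad \<eta>" F G "(*v) A" H J \<alpha> \<beta> \<nu> M L a\<^sub>0 a\<^sub>1 .
  have ub: "smooth_strip T ubar" using ubar(1) unfolding balance_law_solution_def by blast
  obtain h where h: "profile T ubar (dt T ubar) (dx ubar) (dt T (dt T ubar)) (dx (dt T ubar)) (dx (dx ubar)) h"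
    using profile_of_decays[OF T ub ubar(2)] by blast
  interpret V: profile T ubar "dt T ubar" "dx ubar" "dt T (dt T ubar)" "dx (dt T ubar)" "dx (dx ubar)" h by (rule h)
  obtain B where B: "\<And>x t. t \<in> {0..T} \<Longrightarrow> norm (ubar x t) \<le> B" "\<And>x t. t \<in> {0..T} \<Longrightarrow> norm (dt T ubar x t) \<le> B"
    "\<And>x t. t \<in> {0..T} \<Longrightarrow> norm (dx ubar x t) \<le> B"
    using decays_bounded[OF T ub ubar(2)] by blast
  have v_eq: "dt T ubar x t + J (ubar x t) (dx ubar x t) = G (ubar x t)" if t: "t \<in> {0..T}" for x t
  proof -
    have "dx (\<lambda>x t. F (ubar x t)) x t = J (ubar x t) (dx ubar x t)"
      unfolding dx_def[of "\<lambda>x t. F (ubar x t)"]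
      by (rule vector_derivative_at[OF has_vector_derivative_chain[OF E.F_deriv V.deriv_x(1)[OF t]]])
    then show ?thesis using ubar(1) t unfolding balance_law_solution_def by metis
  qed
  let ?I = "\<integral>x. h x \<partial>lborel"
  have I: "0 \<le> ?I" using V.h_nonneg by (intro integral_nonneg_AE) auto
  have B_nonneg: "0 \<le> B" using order_trans[OF norm_ge_zero B(1)[of 0 0]] T by simp
  \<comment> \<open>Subtraction as an operation on functions: applied to \<open>ubar\<close> and
    \<open>u\<close> or to their derivatives, it supplies all \<open>w\<close>-parameters of the
    locale.\<close>
  define w :: "(real \<Rightarrow> real \<Rightarrow> real^'n) \<Rightarrow> (real \<Rightarrow> real \<Rightarrow> real^'n) \<Rightarrow> real \<Rightarrow> real \<Rightarrow> real^'n"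
    where "w = (\<lambda>y u x t. u x t - y x t)"
  \<comment> \<open>The majorant of the difference depends on \<open>u\<close> and thus on
    \<epsilon>; it is hidden behind the existential quantifier and no constant refers to it.\<close>
  have pair: "\<exists>k. relaxation_pair \<eta> q R (grad \<eta>) F G ((*v) A) H J \<alpha> \<beta> \<nu> M L a\<^sub>0 a\<^sub>1 T
      ubar (dt T ubar) (dx ubar) (dt T (dt T ubar)) (dx (dt T ubar)) (dx (dx ubar)) h
      (w ubar u) (w (dt T ubar) (dt T u)) (w (dx ubar) (dx u)) (w (dt T (dt T ubar)) (dt T (dt T u)))
      (w (dx (dt T ubar)) (dx (dt T u))) (w (dx (dx ubar)) (dx (dx u))) k \<epsilon> B"
    if \<epsilon>: "0 < \<epsilon>" "\<epsilon> \<le> 1" and s: "relaxation_solution A F G T \<epsilon> u v" and d: "decays T u"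
      and Ri: "\<And>t. t \<in> {0..T} \<Longrightarrow> integrable lborel (\<lambda>x. R (u x t))" for u v \<epsilon>
  proof -
    have u: "smooth_strip T u" using s unfolding relaxation_solution_def by blast
    obtain hu where hu: "profile T u (dt T u) (dx u) (dt T (dt T u)) (dx (dt T u)) (dx (dx u)) hu"
      using profile_of_decays[OF T u d] by blast
    show ?thesis
    proof (intro exI relaxation_pair.intro relaxation_pair_axioms.intro E.entropy_structure_axioms h \<epsilon>)
      show "profile T (w ubar u) (w (dt T ubar) (dt T u)) (w (dx ubar) (dx u)) (w (dt T (dt T ubar)) (dt T (dt T u)))
        (w (dx (dt T ubar)) (dx (dt T u))) (w (dx (dx ubar)) (dx (dx u))) (\<lambda>x. 2 * (hu x + h x))"
        unfolding w_def by (rule profile_diff[OF hu h])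
      fix x t assume t: "t \<in> {0..T}"
      have ueq: "dt T u x t + J (u x t) (dx u x t) = G (u x t) + \<epsilon> *\<^sub>R (A *v dx (dx u) x t - dt T (dt T u) x t)"
        by (rule relaxation_solution_wave_equation[OF T \<epsilon>(1) s E.F_deriv t])
      have Gu: "G (u x t) = dt T u x t + J (u x t) (dx u x t) - \<epsilon> *\<^sub>R (A *v dx (dx u) x t - dt T (dt T u) x t)"
        using ueq by simp
      show "\<epsilon> *\<^sub>R (w (dt T (dt T ubar)) (dt T (dt T u)) x t - A *v w (dx (dx ubar)) (dx (dx u)) x t) =
         - w (dt T ubar) (dt T u) x t
         - (J (ubar x t + w ubar u x t) (dx ubar x t + w (dx ubar) (dx u) x t) - J (ubar x t) (dx ubar x t))
         + (G (ubar x t + w ubar u x t) - G (ubar x t))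
         + \<epsilon> *\<^sub>R (A *v dx (dx ubar) x t - dt T (dt T ubar) x t)"
        unfolding w_def by (simp add: Gu v_eq[OF t, symmetric] matrix_vector_mult_diff_distrib algebra_simps)
    next
      show "integrable lborel (\<lambda>x. R (ubar x t + w ubar u x t))" if "t \<in> {0..T}" for t
        using Ri[OF that] by (simp add: w_def)
    qed (use v_eq B in auto)
  qed
  have Psi_eq: "Psi T \<epsilon> ubar u t = (\<integral>x. (norm (w ubar u x t))\<^sup>2 + \<epsilon>\<^sup>2 * (norm (w (dx ubar) (dx u) x t))\<^sup>2
      + \<epsilon>\<^sup>2 * (norm (w (dt T ubar) (dt T u) x t))\<^sup>2 \<partial>lborel)"
    if u: "smooth_strip T u" and t: "t \<in> {0..T}" for u t \<epsilon>
  proof -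
    note p = strip_partial_derivatives(3,4)[OF T smooth_stripD[OF u, of "Suc 0"] t]
    have "dx (\<lambda>x t. ubar x t - u x t) x t = dx ubar x t - dx u x t" for x
      unfolding dx_def[of "\<lambda>x t. ubar x t - u x t"]
      by (rule vector_derivative_at[OF has_vector_derivative_diff[OF V.deriv_x(1)[OF t] p(1)]])
    moreover have "dt T (\<lambda>x t. ubar x t - u x t) x t = dt T ubar x t - dt T u x t" for x
      unfolding dt_def[of T "\<lambda>x t. ubar x t - u x t"]
      by (rule vector_derivative_within_closed_interval[OF T t has_vector_derivative_diff[OF V.deriv_t(1)[OF t] p(2)]])
    ultimately show ?thesis
      unfolding Psi_def Let_def w_def by (simp add: norm_minus_commute)
  qed
  have t0: "0 \<in> {0..T}" using T by simp
  \<comment> \<open>The factor \<open>1 + ?I\<close> absorbs the integral of the majorant of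
    \<open>ubar\<close>, so that the estimates end with a bare \<epsilon> or
    \<open>\<epsilon>\<^sup>2\<close>.\<close>
  have combine: "K * (X + e * ?I) \<le> K * (1 + ?I) * (X + e)" if "0 \<le> K" "0 \<le> X" "0 \<le> e" for K X e
  proof -
    have "X + e * ?I \<le> (1 + ?I) * (X + e)"
      using that I mult_nonneg_nonneg[OF I \<open>0 \<le> X\<close>] by (simp add: algebra_simps)
    from mult_left_mono[OF this \<open>0 \<le> K\<close>] show ?thesis by (simp add: mult.assoc)
  qed
  have Psi_nonneg: "0 \<le> Psi T \<epsilon> ubar u t" for \<epsilon> u t
    unfolding Psi_def Let_def by (intro integral_nonneg_AE) auto
  \<comment> \<open>Built from \<open>ubar\<close>, \<open>T\<close> and the data alone, which makes
    the final constant independent of \<epsilon> and of the family.\<close>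
  define K1 where "K1 = E.C2 / E.c0 * exp ((E.C0 B + E.C1 B) / E.c0 * T)"
  have K1: "0 < K1" unfolding K1_def using E.C2_pos E.c0(1) by simp
  have part1: "Psi T \<epsilon> ubar u t + \<epsilon> * (\<integral>x. R (u x t) \<partial>lborel)
      \<le> K1 * (1 + ?I) * (Psi T \<epsilon> ubar u 0 + \<epsilon> * (\<integral>x. R (u x 0) \<partial>lborel) + \<epsilon>)"
    if \<epsilon>: "0 < \<epsilon>" "\<epsilon> \<le> 1" and s: "relaxation_solution A F G T \<epsilon> u v" and d: "decays T u"
      and Ri: "\<And>t. t \<in> {0..T} \<Longrightarrow> integrable lborel (\<lambda>x. R (u x t))" and t: "t \<in> {0..T}" for u v \<epsilon> t
  proof -
    have u: "smooth_strip T u" using s unfolding relaxation_solution_def by blast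
    obtain k where "relaxation_pair \<eta> q R (grad \<eta>) F G ((*v) A) H J \<alpha> \<beta> \<nu> M L a\<^sub>0 a\<^sub>1 T
      ubar (dt T ubar) (dx ubar) (dt T (dt T ubar)) (dx (dt T ubar)) (dx (dx ubar)) h
      (w ubar u) (w (dt T ubar) (dt T u)) (w (dx ubar) (dx u)) (w (dt T (dt T ubar)) (dt T (dt T u)))
      (w (dx (dt T ubar)) (dx (dt T u))) (w (dx (dx ubar)) (dx (dx u))) k \<epsilon> B"
      using pair[OF \<epsilon> s d Ri] by blast
    then interpret P: relaxation_pair \<eta> q R "grad \<eta>" F G "(*v) A" H J \<alpha> \<beta> \<nu> M L a\<^sub>0 a\<^sub>1 T
      ubar "dt T ubar" "dx ubar" "dt T (dt T ubar)" "dx (dt T ubar)" "dx (dx ubar)" h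
      "w ubar u" "w (dt T ubar) (dt T u)" "w (dx ubar) (dx u)" "w (dt T (dt T ubar)) (dt T (dt T u))"
      "w (dx (dt T ubar)) (dx (dt T u))" "w (dx (dx ubar)) (dx (dx u))" k \<epsilon> B .
    have Y: "(\<integral>x. P.Y x s \<partial>lborel) = Psi T \<epsilon> ubar u s" if "s \<in> {0..T}" for s
      unfolding Psi_eq[OF u that] P.Y_def ..
    have uw: "ubar x s + w ubar u x s = u x s" for x s by (simp add: w_def)
    have "Psi T \<epsilon> ubar u t + \<epsilon> * (\<integral>x. R (u x t) \<partial>lborel)
      \<le> K1 * (Psi T \<epsilon> ubar u 0 + \<epsilon> * (\<integral>x. R (u x 0) \<partial>lborel) + \<epsilon> * ?I)"
      using P.relative_energy_estimate[OF t] unfolding uw Y[OF t] Y[OF t0] K1_def .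
    also have "\<dots> \<le> K1 * (1 + ?I) * (Psi T \<epsilon> ubar u 0 + \<epsilon> * (\<integral>x. R (u x 0) \<partial>lborel) + \<epsilon>)"
      using K1 \<epsilon> Psi_nonneg R_nonneg by (intro combine) (auto intro!: add_nonneg_nonneg integral_nonneg_AE)
    finally show ?thesis .
  qed
  have growth: "norm (G u) \<le> C\<^sub>R * (1 + R u)" for u
    using potential_growth[of u] by (simp add: potential)
  have Rrel_eq: "Rrel R y z = R z - R y + G y \<bullet> (z - y)" for y z
    by (simp add: Rrel_def potential)
  \<comment> \<open>The constant is existential because it contains \<open>Cg\<close>, which is
    obtained from the assumption that \<open>G\<close> is of class C2; it is still chosen before
    \<epsilon> and \<open>u\<close>.\<close>
  have part2: "\<exists>K2>0. \<forall>\<epsilon> u v t. 0 < \<epsilon> \<longrightarrow> \<epsilon> \<le> 1 \<longrightarrow> relaxation_solution A F G T \<epsilon> u v \<longrightarrow> decays T u \<longrightarrow>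
      (\<forall>t\<in>{0..T}. integrable lborel (\<lambda>x. R (u x t))) \<longrightarrow> t \<in> {0..T} \<longrightarrow>
      Psi T \<epsilon> ubar u t + \<epsilon> * (\<integral>x. Rrel R (ubar x t) (u x t) \<partial>lborel)
      \<le> K2 * (Psi T \<epsilon> ubar u 0 + \<epsilon> * (\<integral>x. Rrel R (ubar x 0) (u x 0) \<partial>lborel) + \<epsilon>\<^sup>2)"
    if G2: "Ck_on 2 UNIV G"
  proof -
    obtain Cg where Cg: "0 \<le> Cg" "\<And>u v. norm v \<le> B \<Longrightarrow>
      norm (G u - G v - frechet_derivative G (at v) (u - v)) \<le> Cg * ((norm (u - v))\<^sup>2 + (R u - R v + G v \<bullet> (u - v)))"
      using E.G_remainder[OF G2 growth, of B] by blast
    obtain Cd where Cd: "0 \<le> Cd" "\<And>x y. x \<in> cball 0 B \<Longrightarrow> norm (frechet_derivative G (at x) y) \<le> Cd * norm y"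
      using Ck_on_derivative_bounded[OF G2[unfolded numeral_2_eq_2], of B] by blast
    have Rrel_nonneg: "0 \<le> Rrel R y z" for y z unfolding Rrel_eq by (rule E.Rrel_nonneg[OF G2])
    define K2 where "K2 = E.C2 / E.c0 * exp ((E.C0 B + \<alpha> * Cg * B) / E.c0 * T)"
    have K2: "0 < K2" unfolding K2_def using E.C2_pos E.c0(1) by simp
    have "Psi T \<epsilon> ubar u t + \<epsilon> * (\<integral>x. Rrel R (ubar x t) (u x t) \<partial>lborel)
      \<le> K2 * (1 + ?I) * (Psi T \<epsilon> ubar u 0 + \<epsilon> * (\<integral>x. Rrel R (ubar x 0) (u x 0) \<partial>lborel) + \<epsilon>\<^sup>2)"
      if \<epsilon>: "0 < \<epsilon>" "\<epsilon> \<le> 1" and s: "relaxation_solution A F G T \<epsilon> u v" and d: "decays T u"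
        and Ri: "\<And>t. t \<in> {0..T} \<Longrightarrow> integrable lborel (\<lambda>x. R (u x t))" and t: "t \<in> {0..T}" for u v \<epsilon> t
    proof -
      have u: "smooth_strip T u" using s unfolding relaxation_solution_def by blast
      obtain k where "relaxation_pair \<eta> q R (grad \<eta>) F G ((*v) A) H J \<alpha> \<beta> \<nu> M L a\<^sub>0 a\<^sub>1 T
        ubar (dt T ubar) (dx ubar) (dt T (dt T ubar)) (dx (dt T ubar)) (dx (dx ubar)) h
        (w ubar u) (w (dt T ubar) (dt T u)) (w (dx ubar) (dx u)) (w (dt T (dt T ubar)) (dt T (dt T u)))
        (w (dx (dt T ubar)) (dx (dt T u))) (w (dx (dx ubar)) (dx (dx u))) k \<epsilon> B"
        using pair[OF \<epsilon> s d Ri] by blast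
      then interpret P: relaxation_pair \<eta> q R "grad \<eta>" F G "(*v) A" H J \<alpha> \<beta> \<nu> M L a\<^sub>0 a\<^sub>1 T
        ubar "dt T ubar" "dx ubar" "dt T (dt T ubar)" "dx (dt T ubar)" "dx (dx ubar)" h
        "w ubar u" "w (dt T ubar) (dt T u)" "w (dx ubar) (dx u)" "w (dt T (dt T ubar)) (dt T (dt T u))"
        "w (dx (dt T ubar)) (dx (dt T u))" "w (dx (dx ubar)) (dx (dx u))" k \<epsilon> B .
      have Y: "(\<integral>x. P.Y x s \<partial>lborel) = Psi T \<epsilon> ubar u s" if "s \<in> {0..T}" for s
        unfolding Psi_eq[OF u that] P.Y_def ..
      have uw: "ubar x s + w ubar u x s = u x s" for x s by (simp add: w_def)
      have Rr: "P.Rr z y = Rrel R y z" for z y by (simp add: P.Rr_def Rrel_eq)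
      have "Psi T \<epsilon> ubar u t + \<epsilon> * (\<integral>x. Rrel R (ubar x t) (u x t) \<partial>lborel)
        \<le> K2 * (Psi T \<epsilon> ubar u 0 + \<epsilon> * (\<integral>x. Rrel R (ubar x 0) (u x 0) \<partial>lborel) + \<epsilon>\<^sup>2 * ?I)"
      proof -
        have "norm (G (ubar x t + w ubar u x t) - G (ubar x t) - frechet_derivative G (at (ubar x t)) (w ubar u x t))
            \<le> Cg * ((norm (w ubar u x t))\<^sup>2 + P.Rr (ubar x t + w ubar u x t) (ubar x t))" if "t \<in> {0..T}" for x t
          using Cg(2)[OF B(1)[OF that], of "ubar x t + w ubar u x t" x] by (simp add: P.Rr_def)
        moreover have "norm (frechet_derivative G (at (ubar x t)) y) \<le> Cd * norm y" if "t \<in> {0..T}" for x t y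
          using Cd(2)[of "ubar x t" y] B(1)[OF that] by simp
        moreover have "0 \<le> P.Rr z y" for z y unfolding Rr by (rule Rrel_nonneg)
        ultimately show ?thesis
          using P.relative_energy_estimate_C2[OF E.G_deriv[OF G2] E.DG_sym[OF G2] _ _ Cd(1) Cg(1) _ potential_min(2) t]
          unfolding uw Y[OF t] Y[OF t0] Rr K2_def by blast
      qed
      also have "\<dots> \<le> K2 * (1 + ?I) * (Psi T \<epsilon> ubar u 0 + \<epsilon> * (\<integral>x. Rrel R (ubar x 0) (u x 0) \<partial>lborel) + \<epsilon>\<^sup>2)"
        using K2 \<epsilon> Psi_nonneg Rrel_nonneg by (intro combine) (auto intro!: add_nonneg_nonneg integral_nonneg_AE)
      finally show ?thesis .
    qed
    moreover have "0 < K2 * (1 + ?I)" using K2 I by (intro mult_pos_pos) auto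
    ultimately show ?thesis by (intro exI[of _ "K2 * (1 + ?I)"]) blast
  qed
  have "0 < K1 * (1 + ?I)" using K1 I by (intro mult_pos_pos) auto
  then have "\<exists>C>0. \<forall>U V.
        (\<forall>\<epsilon>\<in>{0<..1}. relaxation_solution A F G T \<epsilon> (U \<epsilon>) (V \<epsilon>) \<and> decays T (U \<epsilon>) \<and>
             (\<forall>t\<in>{0..T}. integrable lborel (\<lambda>x. R (U \<epsilon> x t)))) \<longrightarrow>
        (\<forall>\<epsilon>\<in>{0<..1}. \<forall>t\<in>{0..T}.
           Psi T \<epsilon> ubar (U \<epsilon>) t + \<epsilon> * (\<integral>x. R (U \<epsilon> x t) \<partial>lborel)
           \<le> C * (Psi T \<epsilon> ubar (U \<epsilon>) 0 + \<epsilon> * (\<integral>x. R (U \<epsilon> x 0) \<partial>lborel) + \<epsilon>))"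
  proof (intro exI[of _ "K1 * (1 + ?I)"] conjI allI impI ballI)
    fix U V :: "real \<Rightarrow> real \<Rightarrow> real \<Rightarrow> real^'n" and \<epsilon> t :: real
    assume "\<forall>\<epsilon>\<in>{0<..1}. relaxation_solution A F G T \<epsilon> (U \<epsilon>) (V \<epsilon>) \<and> decays T (U \<epsilon>) \<and>
      (\<forall>t\<in>{0..T}. integrable lborel (\<lambda>x. R (U \<epsilon> x t)))" "\<epsilon> \<in> {0<..1}" "t \<in> {0..T}"
    then show "Psi T \<epsilon> ubar (U \<epsilon>) t + \<epsilon> * (\<integral>x. R (U \<epsilon> x t) \<partial>lborel)
      \<le> K1 * (1 + ?I) * (Psi T \<epsilon> ubar (U \<epsilon>) 0 + \<epsilon> * (\<integral>x. R (U \<epsilon> x 0) \<partial>lborel) + \<epsilon>)"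
      by (intro part1[where v="V \<epsilon>"]) auto
  qed
  moreover have "\<exists>C>0. \<forall>U V.
        (\<forall>\<epsilon>\<in>{0<..1}. relaxation_solution A F G T \<epsilon> (U \<epsilon>) (V \<epsilon>) \<and> decays T (U \<epsilon>) \<and>
             (\<forall>t\<in>{0..T}. integrable lborel (\<lambda>x. R (U \<epsilon> x t)))) \<longrightarrow>
        (\<forall>\<epsilon>\<in>{0<..1}. \<forall>t\<in>{0..T}.
           Psi T \<epsilon> ubar (U \<epsilon>) t + \<epsilon> * (\<integral>x. Rrel R (ubar x t) (U \<epsilon> x t) \<partial>lborel)
           \<le> C * (Psi T \<epsilon> ubar (U \<epsilon>) 0
                    + \<epsilon> * (\<integral>x. Rrel R (ubar x 0) (U \<epsilon> x 0) \<partial>lborel) + \<epsilon>\<^sup>2))"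
    if G2: "Ck_on 2 UNIV G"
  proof -
    from part2[OF G2] obtain K2 where K2: "0 < K2"
      "\<And>\<epsilon> u v t. 0 < \<epsilon> \<Longrightarrow> \<epsilon> \<le> 1 \<Longrightarrow> relaxation_solution A F G T \<epsilon> u v \<Longrightarrow> decays T u \<Longrightarrow>
        (\<forall>t\<in>{0..T}. integrable lborel (\<lambda>x. R (u x t))) \<Longrightarrow> t \<in> {0..T} \<Longrightarrow>
        Psi T \<epsilon> ubar u t + \<epsilon> * (\<integral>x. Rrel R (ubar x t) (u x t) \<partial>lborel)
        \<le> K2 * (Psi T \<epsilon> ubar u 0 + \<epsilon> * (\<integral>x. Rrel R (ubar x 0) (u x 0) \<partial>lborel) + \<epsilon>\<^sup>2)"
      by blast
    show ?thesis
    proof (intro exI[of _ K2] conjI K2(1) allI impI ballI)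
      fix U V :: "real \<Rightarrow> real \<Rightarrow> real \<Rightarrow> real^'n" and \<epsilon> t :: real
      assume "\<forall>\<epsilon>\<in>{0<..1}. relaxation_solution A F G T \<epsilon> (U \<epsilon>) (V \<epsilon>) \<and> decays T (U \<epsilon>) \<and>
        (\<forall>t\<in>{0..T}. integrable lborel (\<lambda>x. R (U \<epsilon> x t)))" "\<epsilon> \<in> {0<..1}" "t \<in> {0..T}"
      then show "Psi T \<epsilon> ubar (U \<epsilon>) t + \<epsilon> * (\<integral>x. Rrel R (ubar x t) (U \<epsilon> x t) \<partial>lborel)
        \<le> K2 * (Psi T \<epsilon> ubar (U \<epsilon>) 0 + \<epsilon> * (\<integral>x. Rrel R (ubar x 0) (U \<epsilon> x 0) \<partial>lborel) + \<epsilon>\<^sup>2)"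
        by (intro K2(2)[where v="V \<epsilon>"]) auto
    qed
  qed
  ultimately show ?thesis by blast
qed

end
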